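(* Let $M$ be an oriented matroid on a linearly ordered set $E=\{e_1<\dots<e_n\}$ and let $X\subseteq E$. Let $P=P_M(X)$, $Q=Q_M(X)$ and $B=(X\setminus Q)\cup P$; equivalently, $B$ is the basis of $M$ such that $X$ belongs to the interval of $B$, and $X=(B\setminus P)\cup Q$ with $P\subseteq\mathrm{Int}(B)$ and $Q\subseteq\mathrm{Ext}(B)$. Then the preimage of $X$ under the bijection $\alpha_M:2^E\to2^E$ is the set of elements reoriented by the following procedure (signs below are those in the current reorientation of $M$). For $k$ from $1$ to $n$ do: (I) If $e_k\in B$ and $e_k\in\mathrm{Int}(B)$: $e_k$ is internal, $\mathrm{Part}(e_k):=e_k$, and reorient $e_k$ if and only if $e_k\in P$. (II) If $e_k\in B$ and $e_k\notin\mathrm{Int}(B)$: if there exists an external $c<e_k$ in $C^*(B;e_k)$, then $e_k$ is external and $\mathrm{Part}(e_k):=\mathrm{Part}(c)$ where $c\in C^*(B;e_k)$, $c<e_k$, $c$ is external and $\mathrm{Part}(c)$ is the greatest possible; otherwise $e_k$ is internal and $\mathrm{Part}(e_k):=\mathrm{Part}(c)$ where $c\in C^*(B;e_k)$, $c<e_k$ and $\mathrm{Part}(c)$ is the smallest possible. Then let $a$ be the smallest element of $C^*(B;e_k)$ with $\mathrm{Part}(a)=\mathrm{Part}(e_k)$, and reorient $e_k$ if necessary so that $e_k$ and $a$ have opposite signs in $C^*(B;e_k)$. (III) If $e_k\notin B$ and $e_k\in\mathrm{Ext}(B)$: $e_k$ is external, $\mathrm{Part}(e_k):=e_k$, and reorient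 $e_k$ if and only if $e_k\in Q$. (IV) If $e_k\notin B$ and $e_k\notin\mathrm{Ext}(B)$: if there exists an internal $c<e_k$ in $C(B;e_k)$, then $e_k$ is internal and $\mathrm{Part}(e_k):=\mathrm{Part}(c)$ where $c\in C(B;e_k)$, $c<e_k$, $c$ is internal and $\mathrm{Part}(c)$ is the greatest possible; otherwise $e_k$ is external and $\mathrm{Part}(e_k):=\mathrm{Part}(c)$ where $c\in C(B;e_k)$, $c<e_k$ and $\mathrm{Part}(c)$ is the smallest possible. Then let $a$ be the smallest element of $C(B;e_k)$ with $\mathrm{Part}(a)=\mathrm{Part}(e_k)$, and reorient $e_k$ if necessary so that $e_k$ and $a$ have opposite signs in $C(B;e_k)$.
   Context: General conventions. $\subset$ is strict inclusion. $M(F)$ is the restriction to $F$, $M/F$ the contraction of $F$, $M^*$ the dual; all inherit the order of $E$. For $A\subseteq E$, $-_AM$ is the oriented matroid obtained by reorienting $A$. Signed circuits and cocircuits come in opposite pairs; one is positive if all its signs are positive. An oriented matroid is bounded w.r.t. $p$ if it has no positive circuit and every positive cocircuit contains $p$; dual-bounded w.r.t. $p$ if it has no positive cocircuit and every positive circuit contains $p$. Basis activities. For a basis $B$, $C^*(B;b)$ ($b\in B$) is the fundamental cocircuit, contained in $(E\setminus B)\cup\{b\}$, and $C(B;e)$ ($e\notin B$) the fundamental circuit, contained in $B\cup\{e\}$. $\mathrm{Int}(B)=\{b\in B: b=\min C^*(B;b)\}$, $\mathrm{Ext}(B)=\{e\in E\setminus B: e=\min C(B;e)\}$. The interval of $B$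 is $[B\setminus\mathrm{Int}(B),B\cup\mathrm{Ext}(B)]$; the intervals of all bases partition $2^E$ (known). For $X$ in the interval of $B$: $P_M(X)=\mathrm{Int}(B)\setminus X$, $Q_M(X)=\mathrm{Ext}(B)\cap X$. Orientation activities of an ordered oriented matroid $N$ on $E$: $O^*(N)=\{a_1<\dots<a_\iota\}$ is the set of smallest elements of positive cocircuits, $O(N)=\{a'_1<\dots<a'_\varepsilon\}$ the set of smallest elements of positive circuits. The active filtration of $N$ is $\emptyset=F'_\varepsilon\subset\cdots\subset F'_0=F_c=F_0\subset\cdots\subset F_\iota=E$ where $F_c$ is the union of all positive circuits; $F'_k$ is the union of all positive circuits $C$ with $\min C\ge a'_{k+1}$ ($0\le k\le\varepsilon-1$); $F_k$ is the complement of the union of all positive cocircuits $D$ with $\min D\ge a_{k+1}$ ($0\le k\le\iota-1$). Active basis $\alpha(N)$. Fundamental cocircuits/circuits are signed with $b$, resp. $e$, positive. If $N$ is bounded w.r.t. $p=\min(E)$, $\alpha(N)$ is the unique (it is known that exactly one exists) basis $B$ such that for all $b\in B\setminus\{p\}$ the signs of $b$ and $\min C^*(B;b)$ are opposite in $C^*(B;b)$, and for all $e\in E\setminus B$ the signs of $e$ and $\min C(B;e)$ are opposite in $C(B;e)$. If $N$ is dual-bounded w.r.t. $p$, $\alpha(N)=E\setminus\alpha(N^* )$. In general, with the active filtration of $N$, $\alpha(N)=\biguplus_{1\le k\le\iota}\alpha(N(F_k)/F_{k-1})\uplus\biguplus_{1\le k\le\varepsilon}\alpha(N(F'_{k-1})/F'_k)$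 (these minors being respectively bounded and dual-bounded w.r.t. their smallest elements). Refined active bijection: $\alpha_M(A)=\bigl(\alpha(-_AM)\setminus(A\cap O^*(-_AM))\bigr)\cup\bigl(A\cap O(-_AM)\bigr)$ for $A\subseteq E$; it is a bijection from $2^E$ to $2^E$. *)

theory Defs
  imports Main
begin

section \<open>Oriented matroids by signed circuits\<close>

text \<open>A signed subset is a function with values in \<open>{-1, 0, 1}\<close>; the value \<open>0\<close> means
  that the element is not in the underlying set \<open>supp X\<close>.\<close>

type_synonym 'a signed = "'a \<Rightarrow> int"

definition supp :: "'a signed \<Rightarrow> 'a set" where
  "supp X = {e. X e \<noteq> 0}"

definition pos :: "'a signed \<Rightarrow> 'a set" where
  "pos X = {e. X e = 1}"

definition neg :: "'a signed \<Rightarrow> 'a set" where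
  "neg X = {e. X e = -1}"

definition opposite :: "'a signed \<Rightarrow> 'a signed" where
  "opposite X = (\<lambda>e. - X e)"

definition positive :: "'a signed \<Rightarrow> bool" where
  "positive X \<longleftrightarrow> (\<forall>e\<in>supp X. X e = 1)"

definition signed_subset :: "'a set \<Rightarrow> 'a signed \<Rightarrow> bool" where
  "signed_subset E X \<longleftrightarrow> (\<forall>e. X e \<in> {-1, 0, 1}) \<and> supp X \<subseteq> E"

definition orthogonal :: "'a signed \<Rightarrow> 'a signed \<Rightarrow> bool" where
  "orthogonal X Y \<longleftrightarrow> supp X \<inter> supp Y = {} \<or>
     (\<exists>e\<in>supp X \<inter> supp Y. \<exists>f\<in>supp X \<inter> supp Y. X e * Y e = - (X f * Y f))"

record 'a omatroid =
  ground :: "'a set"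
  circuits :: "'a signed set"

definition oriented_matroid :: "'a omatroid \<Rightarrow> bool" where
  "oriented_matroid M \<longleftrightarrow>
     finite (ground M) \<and>
     (\<forall>X\<in>circuits M. signed_subset (ground M) X \<and> supp X \<noteq> {}) \<and>
     (\<forall>X\<in>circuits M. opposite X \<in> circuits M) \<and>
     (\<forall>X\<in>circuits M. \<forall>Y\<in>circuits M. supp X \<subseteq> supp Y \<longrightarrow> X = Y \<or> X = opposite Y) \<and>
     (\<forall>X\<in>circuits M. \<forall>Y\<in>circuits M. \<forall>e. X \<noteq> opposite Y \<and> e \<in> pos X \<inter> neg Y \<longrightarrow>
        (\<exists>Z\<in>circuits M. pos Z \<subseteq> (pos X \<union> pos Y) - {e} \<and> neg Z \<subseteq> (neg X \<union> neg Y) - {e}))"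

section \<open>Bases, duality, minors, reorientation\<close>

definition indep :: "'a omatroid \<Rightarrow> 'a set \<Rightarrow> bool" where
  "indep M S \<longleftrightarrow> S \<subseteq> ground M \<and> (\<forall>X\<in>circuits M. \<not> supp X \<subseteq> S)"

definition is_basis :: "'a omatroid \<Rightarrow> 'a set \<Rightarrow> bool" where
  "is_basis M B \<longleftrightarrow> indep M B \<and> (\<forall>S. indep M S \<and> B \<subseteq> S \<longrightarrow> S = B)"

text \<open>The cocircuits of the underlying matroid are the minimal dependent sets of the dual
  matroid (whose bases are the complements of the bases), that is, the inclusion-minimal sets
  meeting every basis.\<close>

definition underlying_cocircuit :: "'a omatroid \<Rightarrow> 'a set \<Rightarrow> bool" where
  "underlying_cocircuit M D \<longleftrightarrow>
     D \<subseteq> ground M \<and> (\<forall>B. is_basis M B \<longrightarrow> D \<inter> B \<noteq> {}) \<and>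
     (\<forall>D'. D' \<subset> D \<longrightarrow> (\<exists>B. is_basis M B \<and> D' \<inter> B = {}))"

text \<open>The signed cocircuits are given by the signature of the underlying cocircuits that is
  orthogonal to all signed circuits.\<close>

definition cocircuits :: "'a omatroid \<Rightarrow> 'a signed set" where
  "cocircuits M = {Y. signed_subset (ground M) Y \<and> underlying_cocircuit M (supp Y) \<and>
     (\<forall>X\<in>circuits M. orthogonal X Y)}"

definition dual :: "'a omatroid \<Rightarrow> 'a omatroid" where
  "dual M = \<lparr>ground = ground M, circuits = cocircuits M\<rparr>"

definition om_restrict :: "'a omatroid \<Rightarrow> 'a set \<Rightarrow> 'a omatroid" where
  "om_restrict M F = \<lparr>ground = F, circuits = {X \<in> circuits M. supp X \<subseteq> F}\<rparr>"

definition sdelete :: "'a set \<Rightarrow> 'a signed \<Rightarrow> 'a signed" where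
  "sdelete F X = (\<lambda>e. if e \<in> F then 0 else X e)"

text \<open>The circuits of \<open>M/F\<close> are the nonempty traces on the complement of \<open>F\<close> of circuits
  of \<open>M\<close> whose support is inclusion-minimal among those.\<close>

definition om_contract :: "'a omatroid \<Rightarrow> 'a set \<Rightarrow> 'a omatroid" where
  "om_contract M F =
     (let T = {Y \<in> sdelete F ` circuits M. supp Y \<noteq> {}}
      in \<lparr>ground = ground M - F,
          circuits = {Y \<in> T. \<forall>Z\<in>T. supp Z \<subseteq> supp Y \<longrightarrow> supp Z = supp Y}\<rparr>)"

definition reorient :: "'a set \<Rightarrow> 'a omatroid \<Rightarrow> 'a omatroid" where
  "reorient A M =
     \<lparr>ground = ground M, circuits = (\<lambda>X e. if e \<in> A then - X e else X e) ` circuits M\<rparr>"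

section \<open>Basis activities\<close>

definition fund_circuit :: "'a omatroid \<Rightarrow> 'a set \<Rightarrow> 'a \<Rightarrow> 'a signed" where
  "fund_circuit M B e = (THE X. X \<in> circuits M \<and> supp X \<subseteq> insert e B \<and> X e = 1)"

definition fund_cocircuit :: "'a omatroid \<Rightarrow> 'a set \<Rightarrow> 'a \<Rightarrow> 'a signed" where
  "fund_cocircuit M B b =
     (THE Y. Y \<in> cocircuits M \<and> supp Y \<subseteq> insert b (ground M - B) \<and> Y b = 1)"

definition Int_act :: "'a::linorder omatroid \<Rightarrow> 'a set \<Rightarrow> 'a set" where
  "Int_act M B = {b \<in> B. b = Min (supp (fund_cocircuit M B b))}"

definition Ext_act :: "'a::linorder omatroid \<Rightarrow> 'a set \<Rightarrow> 'a set" where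
  "Ext_act M B = {e \<in> ground M - B. e = Min (supp (fund_circuit M B e))}"

definition basis_interval :: "'a::linorder omatroid \<Rightarrow> 'a set \<Rightarrow> 'a set set" where
  "basis_interval M B = {X. B - Int_act M B \<subseteq> X \<and> X \<subseteq> B \<union> Ext_act M B}"

definition interval_basis :: "'a::linorder omatroid \<Rightarrow> 'a set \<Rightarrow> 'a set" where
  "interval_basis M X = (THE B. is_basis M B \<and> X \<in> basis_interval M B)"

definition P_set :: "'a::linorder omatroid \<Rightarrow> 'a set \<Rightarrow> 'a set" where
  "P_set M X = Int_act M (interval_basis M X) - X"

definition Q_set :: "'a::linorder omatroid \<Rightarrow> 'a set \<Rightarrow> 'a set" where
  "Q_set M X = Ext_act M (interval_basis M X) \<inter> X"

section \<open>Orientation activities and the active filtration\<close>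

definition Ostar_act :: "'a::linorder omatroid \<Rightarrow> 'a set" where
  "Ostar_act N = {Min (supp D) | D. D \<in> cocircuits N \<and> positive D}"

definition O_act :: "'a::linorder omatroid \<Rightarrow> 'a set" where
  "O_act N = {Min (supp C) | C. C \<in> circuits N \<and> positive C}"

text \<open>In \<open>filt N k\<close> (the set \<open>F\<^sub>k\<close>) and \<open>filt' N k\<close> (the set \<open>F'\<^sub>k\<close>) the list entry
  with index \<open>k\<close> is \<open>a\<^sub>k\<^sub>+\<^sub>1\<close>, respectively \<open>a'\<^sub>k\<^sub>+\<^sub>1\<close>, since lists are indexed from \<open>0\<close>.\<close>

definition filt :: "'a::linorder omatroid \<Rightarrow> nat \<Rightarrow> 'a set" where
  "filt N k = (let as = sorted_list_of_set (Ostar_act N) in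
     if k < length as
     then ground N - \<Union> {supp D | D. D \<in> cocircuits N \<and> positive D \<and> as ! k \<le> Min (supp D)}
     else ground N)"

definition filt' :: "'a::linorder omatroid \<Rightarrow> nat \<Rightarrow> 'a set" where
  "filt' N k = (let as = sorted_list_of_set (O_act N) in
     if k < length as
     then \<Union> {supp C | C. C \<in> circuits N \<and> positive C \<and> as ! k \<le> Min (supp C)}
     else {})"

section \<open>Active basis and refined active bijection\<close>

text \<open>Defining condition of the active basis of an oriented matroid that is bounded with
  respect to its smallest element.\<close>

definition fully_optimal :: "'a::linorder omatroid \<Rightarrow> 'a set \<Rightarrow> bool" where
  "fully_optimal N B \<longleftrightarrow> is_basis N B \<and>
     (\<forall>b\<in>B - {Min (ground N)}. let D = fund_cocircuit N B b in D b = - D (Min (supp D))) \<and>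
     (\<forall>e\<in>ground N - B. let C = fund_circuit N B e in C e = - C (Min (supp C)))"

definition alpha_bounded :: "'a::linorder omatroid \<Rightarrow> 'a set" where
  "alpha_bounded N = (THE B. fully_optimal N B)"

definition alpha_dual_bounded :: "'a::linorder omatroid \<Rightarrow> 'a set" where
  "alpha_dual_bounded N = ground N - alpha_bounded (dual N)"

text \<open>The minors in the first union are bounded and those in the second one dual-bounded, each
  with respect to its smallest element. If \<open>N\<close> itself is bounded or dual-bounded, its
  filtration has a single step and \<open>alpha N\<close> is \<open>alpha_bounded N\<close>, respectively
  \<open>alpha_dual_bounded N\<close>.\<close>

definition alpha :: "'a::linorder omatroid \<Rightarrow> 'a set" where
  "alpha N =
     (\<Union>k\<in>{1..card (Ostar_act N)}.
        alpha_bounded (om_contract (om_restrict N (filt N k)) (filt N (k - 1)))) \<union>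
     (\<Union>k\<in>{1..card (O_act N)}.
        alpha_dual_bounded (om_contract (om_restrict N (filt' N (k - 1))) (filt' N k)))"

definition refined_alpha :: "'a::linorder omatroid \<Rightarrow> 'a set \<Rightarrow> 'a set" where
  "refined_alpha M A =
     (alpha (reorient A M) - (A \<inter> Ostar_act (reorient A M))) \<union> (A \<inter> O_act (reorient A M))"

section \<open>The single pass procedure\<close>

text \<open>The sets \<open>internal\<close> and \<open>external\<close> only contain elements already processed, and
  \<open>part\<close> is meaningful only for those. The elements reoriented so far form \<open>flipped\<close>.\<close>

record 'a state =
  internal :: "'a set"
  external :: "'a set"
  part :: "'a \<Rightarrow> 'a"
  flipped :: "'a set"

definition set_internal :: "'a \<Rightarrow> 'a \<Rightarrow> 'a state \<Rightarrow> 'a state" where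
  "set_internal e q s = s\<lparr>internal := insert e (internal s), part := (part s)(e := q)\<rparr>"

definition set_external :: "'a \<Rightarrow> 'a \<Rightarrow> 'a state \<Rightarrow> 'a state" where
  "set_external e q s = s\<lparr>external := insert e (external s), part := (part s)(e := q)\<rparr>"

definition flip_if :: "bool \<Rightarrow> 'a \<Rightarrow> 'a state \<Rightarrow> 'a state" where
  "flip_if b e s = (if b then s\<lparr>flipped := insert e (flipped s)\<rparr> else s)"

text \<open>Flip \<open>e\<close> unless its sign in \<open>Y\<close> is opposite to that of the smallest element \<open>a\<close>
  of \<open>Y\<close> in the same part. Only processed elements \<open>c < e\<close> have a part; one of them shares
  the part of \<open>e\<close> when this is used, so \<open>a < e\<close>.\<close>

definition adjust :: "'a::linorder signed \<Rightarrow> 'a \<Rightarrow> 'a state \<Rightarrow> 'a state" where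
  "adjust Y e s =
     (let a = Min {c \<in> supp Y. c < e \<and> part s c = part s e}
      in flip_if (Y e \<noteq> - Y a) e s)"

definition step ::
  "'a::linorder omatroid \<Rightarrow> 'a set \<Rightarrow> 'a set \<Rightarrow> 'a set \<Rightarrow> 'a \<Rightarrow> 'a state \<Rightarrow> 'a state" where
  "step M B P Q e s =
    (let N = reorient (flipped s) M in
     if e \<in> B then
       if e \<in> Int_act M B then flip_if (e \<in> P) e (set_internal e e s)
       else
         let D = fund_cocircuit N B e;
             J = {c \<in> supp D. c < e}
         in adjust D e
              (if J \<inter> external s \<noteq> {}
               then set_external e (Max (part s ` (J \<inter> external s))) s
               else set_internal e (Min (part s ` J)) s)
     else
       if e \<in> Ext_act M B then flip_if (e \<in> Q) e (set_external e e s)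
       else
         let C = fund_circuit N B e;
             J = {c \<in> supp C. c < e}
         in adjust C e
              (if J \<inter> internal s \<noteq> {}
               then set_internal e (Max (part s ` (J \<inter> internal s))) s
               else set_external e (Min (part s ` J)) s))"

definition initial_state :: "'a state" where
  "initial_state = \<lparr>internal = {}, external = {}, part = (\<lambda>e. e), flipped = {}\<rparr>"

definition procedure_result ::
  "'a::linorder omatroid \<Rightarrow> 'a set \<Rightarrow> 'a set \<Rightarrow> 'a set \<Rightarrow> 'a set" where
  "procedure_result M B P Q =
     flipped (fold (step M B P Q) (sorted_list_of_set (ground M)) initial_state)"

end

theory Submission
  imports Defs
begin

text \<open>The flips of the single pass make \<open>B\<close> satisfy, inside every part, the sign condition of a
  fully optimal basis, and the rules choosing the parts make the unions of parts along the filtration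
  closed under fundamental circuits, respectively cocircuits. Orthogonality with the fundamental
  circuits and cocircuits of \<open>B\<close> and the painting lemma then show that the positive cocircuits and
  circuits of the final orientation produce exactly these parts as its active filtration, so that its
  active basis is \<open>B\<close> and its active elements are \<open>Int(B)\<close> and \<open>Ext(B)\<close>.

  A fully optimal basis is unique: for two such bases \<open>B\<close> and \<open>B'\<close>, painting \<open>B - B'\<close> positive,
  \<open>B' - B\<close> negative and leaving \<open>B \<inter> B'\<close> free for circuits yields a circuit or a cocircuit, and
  both are impossible by lexicographic complementary slackness. Finally, the procedure being a right
  inverse of the refined active bijection on a finite set, it is its inverse.\<close>

section \<open>Signed sets\<close>

text \<open>Only circuits are axiomatic here. Cocircuits are minimal sets meeting all bases that
  carry a signature orthogonal to every circuit, and the definition does not provide that such a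
  signature exists. It is constructed: \<open>cosig B b\<close> has the values which orthogonality
  to the fundamental circuits of one basis forces, and basis exchanges extend this orthogonality to
  all circuits. Painting follows from it, and elimination for cocircuits follows from painting.
  Contractions are reached through the dual, because their circuits are minimal traces, for which
  signed elimination is awkward to verify directly. Since \<open>alpha_bounded\<close> is a definite
  description, exhibiting an optimal basis of a minor identifies its value only together with
  uniqueness; existence comes from the procedure itself. External statements are internal ones
  applied to the dual.\<close>

lemma supp_iff [simp]: "e \<in> supp X \<longleftrightarrow> X e \<noteq> 0"
  by (simp add: supp_def)

lemma opposite_apply [simp]: "opposite X e = - X e"
  by (simp add: opposite_def)

lemma supp_opposite [simp]: "supp (opposite X) = supp X"
  by auto

lemma opposite_opposite [simp]: "opposite (opposite X) = X"
  by (simp add: opposite_def)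

lemma neq_oppositeI: "X e \<noteq> - Y e \<Longrightarrow> X \<noteq> opposite Y"
  by auto

lemma signed_cases: "signed_subset E X \<Longrightarrow> X e = 0 \<or> X e = 1 \<or> X e = -1"
  by (auto simp: signed_subset_def)

lemma orthogonal_sym: "orthogonal X Y \<longleftrightarrow> orthogonal Y X"
  by (auto simp: orthogonal_def mult.commute Int_commute)

text \<open>If the supports met, orthogonality would supply two common elements with opposite
  products, so \<open>c = - c\<close> with \<open>c\<close> nonzero. Most contradictions below arise
  by producing such a constant product.\<close>

lemma orthogonal_const:
  assumes "orthogonal X Y" "\<And>e. X e \<noteq> 0 \<Longrightarrow> Y e \<noteq> 0 \<Longrightarrow> X e * Y e = c"
  shows "X e = 0 \<or> Y e = 0"
proof (rule ccontr)
  assume e: "\<not> (X e = 0 \<or> Y e = 0)"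
  then have c: "c \<noteq> 0" using assms(2)[of e] by auto
  from e have "supp X \<inter> supp Y \<noteq> {}" by auto
  then obtain f g where "f \<in> supp X \<inter> supp Y" "g \<in> supp X \<inter> supp Y" "X f * Y f = - (X g * Y g)"
    using assms(1) unfolding orthogonal_def by blast
  then have "c = - c" using assms(2)[of f] assms(2)[of g] by auto
  then show False using c by simp
qed

text \<open>The opposite pair must be formed by the only two candidates; for disjoint supports both
  sides vanish. This computes one value of a signed set from another.\<close>

lemma orthogonal_two:
  assumes "orthogonal X Y" "\<And>g. X g \<noteq> 0 \<Longrightarrow> Y g \<noteq> 0 \<Longrightarrow> g = e \<or> g = f" "e \<noteq> f"
  shows "X e * Y e = - (X f * Y f)"
proof (cases "supp X \<inter> supp Y = {}")
  case True
  then have "X e = 0 \<or> Y e = 0" "X f = 0 \<or> Y f = 0" by auto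
  then show ?thesis by auto
next
  case False
  then obtain g h where gh: "X g \<noteq> 0" "Y g \<noteq> 0" "X h \<noteq> 0" "Y h \<noteq> 0" "X g * Y g = - (X h * Y h)"
    using assms(1) unfolding orthogonal_def by auto
  then have "g \<noteq> h" by (metis mult_eq_0_iff equal_neg_zero)
  then show ?thesis using assms(2)[of g] assms(2)[of h] gh by auto
qed

lemma not_orthogonal_const:
  assumes "signed_subset E X" "signed_subset E Y" "\<not> orthogonal X Y"
  obtains c where "c = 1 \<or> c = (-1::int)" "\<And>e. X e \<noteq> 0 \<Longrightarrow> Y e \<noteq> 0 \<Longrightarrow> X e * Y e = c"
proof -
  from assms(3) obtain e where e: "X e \<noteq> 0" "Y e \<noteq> 0"
    unfolding orthogonal_def by auto
  have v: "X f * Y f = 1 \<or> X f * Y f = -1" if "X f \<noteq> 0" "Y f \<noteq> 0" for f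
    using that signed_cases[OF assms(1), of f] signed_cases[OF assms(2), of f] by auto
  have "X f * Y f = X e * Y e" if f: "X f \<noteq> 0" "Y f \<noteq> 0" for f
  proof (rule ccontr)
    assume "X f * Y f \<noteq> X e * Y e"
    then have "X f * Y f = - (X e * Y e)" using v[OF e] v[OF f] by auto
    then show False using assms(3) e f unfolding orthogonal_def by (meson IntI supp_iff)
  qed
  then show ?thesis using v[OF e] that[of "X e * Y e"] by blast
qed

section \<open>Circuits and bases\<close>

text \<open>Pointwise form of the conclusion of the elimination axiom, which frees the later
  arguments from \<open>pos\<close> and \<open>neg\<close>.\<close>

lemma signed_elimination_iff:
  assumes "\<forall>e. Z e \<in> {-1, 0, 1::int}"
  shows "pos Z \<subseteq> (pos X \<union> pos Y) - {e} \<and> neg Z \<subseteq> (neg X \<union> neg Y) - {e} \<longleftrightarrow>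
    Z e = 0 \<and> (\<forall>f. Z f \<noteq> 0 \<longrightarrow> Z f = X f \<or> Z f = Y f)"
proof -
  have "(Z f = 1 \<longrightarrow> (X f = 1 \<or> Y f = 1) \<and> f \<noteq> e) \<and> (Z f = -1 \<longrightarrow> (X f = -1 \<or> Y f = -1) \<and> f \<noteq> e) \<longleftrightarrow>
      (f = e \<longrightarrow> Z f = 0) \<and> (Z f \<noteq> 0 \<longrightarrow> Z f = X f \<or> Z f = Y f)" for f
    using assms by (cases "Z f = 0"; cases "Z f = 1") auto
  then have "(\<forall>f. (Z f = 1 \<longrightarrow> (X f = 1 \<or> Y f = 1) \<and> f \<noteq> e) \<and> (Z f = -1 \<longrightarrow> (X f = -1 \<or> Y f = -1) \<and> f \<noteq> e)) \<longleftrightarrow>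
      (\<forall>f. (f = e \<longrightarrow> Z f = 0) \<and> (Z f \<noteq> 0 \<longrightarrow> Z f = X f \<or> Z f = Y f))" by presburger
  then show ?thesis unfolding pos_def neg_def subset_iff by (simp add: all_conj_distrib)
qed

locale om =
  fixes M :: "'a omatroid"
  assumes om: "oriented_matroid M"
begin

abbreviation E where "E \<equiv> ground M"

lemma finite_ground: "finite E"
  using om by (simp add: oriented_matroid_def)

lemma circuit_signed: "X \<in> circuits M \<Longrightarrow> signed_subset E X"
  using om by (simp add: oriented_matroid_def)

lemma circuit_values: "X \<in> circuits M \<Longrightarrow> X e = 0 \<or> X e = 1 \<or> X e = -1"
  by (rule signed_cases[OF circuit_signed])

lemma circuit_ground: "X \<in> circuits M \<Longrightarrow> X e \<noteq> 0 \<Longrightarrow> e \<in> E"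
  using circuit_signed[of X] by (auto simp: signed_subset_def subset_iff)

lemma circuit_nonempty: "X \<in> circuits M \<Longrightarrow> \<exists>e. X e \<noteq> 0"
  using om by (auto simp: oriented_matroid_def)

lemma circuit_opposite: "X \<in> circuits M \<Longrightarrow> opposite X \<in> circuits M"
  using om by (simp add: oriented_matroid_def)

lemma circuit_scale: "X \<in> circuits M \<Longrightarrow> c = 1 \<or> c = -1 \<Longrightarrow> (\<lambda>e. c * X e) \<in> circuits M"
  using circuit_opposite[of X] by (auto simp: opposite_def)

lemma circuit_incomparable:
  "X \<in> circuits M \<Longrightarrow> Y \<in> circuits M \<Longrightarrow> supp X \<subseteq> supp Y \<Longrightarrow> X = Y \<or> X = opposite Y"
  using om by (simp add: oriented_matroid_def)

text \<open>The axiom treats the signs 1 and -1 at \<open>e\<close> in this order only; exchanging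
  \<open>X\<close> and \<open>Y\<close> gives the other order.\<close>

lemma circuit_elim:
  assumes X: "X \<in> circuits M" and Y: "Y \<in> circuits M" and "X \<noteq> opposite Y"
    and "X e \<noteq> 0" "Y e = - X e"
  obtains Z where "Z \<in> circuits M" "Z e = 0" "\<And>f. Z f \<noteq> 0 \<Longrightarrow> Z f = X f \<or> Z f = Y f"
proof -
  have ax: "\<exists>Z\<in>circuits M. pos Z \<subseteq> (pos X \<union> pos Y) - {e} \<and> neg Z \<subseteq> (neg X \<union> neg Y) - {e}"
    if "X \<in> circuits M" "Y \<in> circuits M" "X \<noteq> opposite Y" "X e = 1" "Y e = -1" for X Y
    using om that unfolding oriented_matroid_def pos_def neg_def by blast
  have sg: "\<forall>e. X e \<in> {-1, 0, 1}" if "X \<in> circuits M" for X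
    using circuit_signed[OF that] by (simp add: signed_subset_def)
  have "\<exists>Z\<in>circuits M. pos Z \<subseteq> (pos X \<union> pos Y) - {e} \<and> neg Z \<subseteq> (neg X \<union> neg Y) - {e}"
  proof (cases "X e = 1")
    case True
    then show ?thesis using ax[OF X Y] assms by simp
  next
    case False
    then have "X e = -1" using circuit_values[OF X, of e] assms by auto
    moreover have "Y \<noteq> opposite X" using assms(3) by auto
    ultimately show ?thesis using ax[OF Y X] assms(5) by (simp add: Un_commute)
  qed
  then show ?thesis using signed_elimination_iff[OF sg] that by metis
qed

end

lemma oriented_matroidI:
  assumes "finite (ground M)"
    and sg: "\<And>X. X \<in> circuits M \<Longrightarrow> signed_subset (ground M) X"
    and "\<And>X. X \<in> circuits M \<Longrightarrow> \<exists>e. X e \<noteq> 0"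
    and "\<And>X. X \<in> circuits M \<Longrightarrow> opposite X \<in> circuits M"
    and "\<And>X Y. X \<in> circuits M \<Longrightarrow> Y \<in> circuits M \<Longrightarrow> supp X \<subseteq> supp Y \<Longrightarrow> X = Y \<or> X = opposite Y"
    and el: "\<And>X Y e. X \<in> circuits M \<Longrightarrow> Y \<in> circuits M \<Longrightarrow> X \<noteq> opposite Y \<Longrightarrow> X e = 1 \<Longrightarrow> Y e = -1 \<Longrightarrow>
        \<exists>Z\<in>circuits M. Z e = 0 \<and> (\<forall>f. Z f \<noteq> 0 \<longrightarrow> Z f = X f \<or> Z f = Y f)"
  shows "oriented_matroid M"
proof -
  have v: "\<forall>e. X e \<in> {-1, 0, 1}" if "X \<in> circuits M" for X
    using sg[OF that] by (simp add: signed_subset_def)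
  have "\<exists>Z\<in>circuits M. pos Z \<subseteq> (pos X \<union> pos Y) - {e} \<and> neg Z \<subseteq> (neg X \<union> neg Y) - {e}"
    if XY: "X \<in> circuits M" "Y \<in> circuits M" "X \<noteq> opposite Y" "e \<in> pos X \<inter> neg Y" for X Y e
  proof -
    from XY(4) have "X e = 1" "Y e = -1" by (auto simp: pos_def neg_def)
    from el[OF XY(1-3) this] obtain Z where "Z \<in> circuits M" "Z e = 0 \<and> (\<forall>f. Z f \<noteq> 0 \<longrightarrow> Z f = X f \<or> Z f = Y f)"
      by blast
    then show ?thesis using signed_elimination_iff[OF v] by metis
  qed
  moreover have "supp X \<noteq> {}" if "X \<in> circuits M" for X
    using assms(3)[OF that] by auto
  ultimately show ?thesis using assms(1-5) unfolding oriented_matroid_def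
    by (intro conjI ballI allI impI; simp)
qed

context om
begin

section \<open>Independent sets, fundamental circuits and basis exchange\<close>

lemma indep_ground: "indep M S \<Longrightarrow> S \<subseteq> E"
  by (simp add: indep_def)

lemma indep_circuit: "indep M S \<Longrightarrow> X \<in> circuits M \<Longrightarrow> \<exists>e. X e \<noteq> 0 \<and> e \<notin> S"
  by (auto simp: indep_def subset_iff)

lemma basis_indep: "is_basis M B \<Longrightarrow> indep M B"
  by (simp add: is_basis_def)

lemma basis_ground: "is_basis M B \<Longrightarrow> B \<subseteq> E"
  by (simp add: is_basis_def indep_def)

lemma basis_maximal: "is_basis M B \<Longrightarrow> indep M S \<Longrightarrow> B \<subseteq> S \<Longrightarrow> S = B"
  by (simp add: is_basis_def)

lemma indep_extend:
  assumes "indep M S"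
  obtains B where "is_basis M B" "S \<subseteq> B"
proof -
  have "finite {T. indep M T}"
    by (rule finite_subset[of _ "Pow E"]) (auto simp: finite_ground dest: indep_ground)
  from finite_has_maximal2[OF this, of S] assms
  obtain B where "indep M B" "S \<subseteq> B" "\<forall>T. indep M T \<longrightarrow> B \<subseteq> T \<longrightarrow> B = T" by auto
  then show ?thesis using that[of B] unfolding is_basis_def by blast
qed

text \<open>Eliminating \<open>e\<close> between \<open>X\<close> and the opposite of
  \<open>Y\<close> would leave a circuit inside the independent set \<open>B\<close>.\<close>

lemma circuit_unique:
  assumes "indep M B" "X \<in> circuits M" "Y \<in> circuits M" "supp X \<subseteq> insert e B" "supp Y \<subseteq> insert e B"
    and "X e = Y e"
  shows "X = Y"
proof (rule ccontr)
  assume ne: "X \<noteq> Y"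
  have "X e \<noteq> 0" using indep_circuit[OF assms(1,2)] assms(4) by auto
  then obtain Z where Z: "Z \<in> circuits M" "Z e = 0" "\<And>f. Z f \<noteq> 0 \<Longrightarrow> Z f = X f \<or> Z f = opposite Y f"
    using circuit_elim[OF assms(2) circuit_opposite[OF assms(3)], of e] ne assms(6) by auto
  have "f \<in> B" if "Z f \<noteq> 0" for f
  proof -
    have "f \<noteq> e" using that Z(2) by auto
    moreover have "X f \<noteq> 0 \<or> Y f \<noteq> 0" using Z(3)[OF that] that by auto
    ultimately show ?thesis using assms(4,5) by auto
  qed
  then show False using indep_circuit[OF assms(1) Z(1)] by blast
qed

lemma ex_fund_circuit:
  assumes "is_basis M B" "e \<in> E - B"
  shows "\<exists>X \<in> circuits M. supp X \<subseteq> insert e B \<and> X e = 1"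
proof -
  have "\<not> indep M (insert e B)" using basis_maximal[OF assms(1), of "insert e B"] assms(2) by blast
  then obtain X where X: "X \<in> circuits M" "supp X \<subseteq> insert e B"
    using assms basis_ground[OF assms(1)] by (auto simp: indep_def)
  have "X e \<noteq> 0" using indep_circuit[OF basis_indep[OF assms(1)] X(1)] X(2) by auto
  then have "X e = 1 \<or> opposite X e = 1" using circuit_values[OF X(1), of e] by auto
  then show ?thesis using X circuit_opposite[OF X(1)] supp_opposite by metis
qed

lemma fund_circuit_props:
  assumes "is_basis M B" "e \<in> E - B"
  shows fund_circuit_circuit: "fund_circuit M B e \<in> circuits M"
    and fund_circuit_supp: "supp (fund_circuit M B e) \<subseteq> insert e B"
    and fund_circuit_self: "fund_circuit M B e e = 1"
proof -
  have "\<exists>!X. X \<in> circuits M \<and> supp X \<subseteq> insert e B \<and> X e = 1"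
    using ex_fund_circuit[OF assms] circuit_unique[OF basis_indep[OF assms(1)]] by metis
  from theI'[OF this] show "fund_circuit M B e \<in> circuits M"
    "supp (fund_circuit M B e) \<subseteq> insert e B" "fund_circuit M B e e = 1"
    unfolding fund_circuit_def by auto
qed

lemma fund_circuit_in: "is_basis M B \<Longrightarrow> e \<in> E - B \<Longrightarrow> fund_circuit M B e f \<noteq> 0 \<Longrightarrow> f = e \<or> f \<in> B"
  using fund_circuit_supp by fastforce

lemma circuit_eq_fund:
  assumes "is_basis M B" "e \<in> E - B" "X \<in> circuits M" "supp X \<subseteq> insert e B"
  shows "X e \<noteq> 0" "X f = X e * fund_circuit M B e f"
proof -
  show ne: "X e \<noteq> 0" using indep_circuit[OF basis_indep[OF assms(1)] assms(3)] assms(4) by auto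
  then have c: "X e = 1 \<or> X e = -1" using circuit_values[OF assms(3), of e] by auto
  note F = fund_circuit_props[OF assms(1,2)]
  have "supp (\<lambda>f. X e * fund_circuit M B e f) \<subseteq> insert e B" using F(2) by auto
  then have "X = (\<lambda>f. X e * fund_circuit M B e f)"
    by (rule circuit_unique[OF basis_indep[OF assms(1)] assms(3) circuit_scale[OF F(1) c] assms(4)])
       (simp add: F(3))
  then show "X f = X e * fund_circuit M B e f" by metis
qed

text \<open>A circuit inside the new set would be a multiple of the fundamental circuit of
  \<open>e\<close>, hence contain \<open>b\<close>. For maximality, a further element
  \<open>x\<close> creates a circuit: eliminate \<open>b\<close> between the fundamental circuits of
  \<open>x\<close> and \<open>e\<close>.\<close>

lemma basis_exchange:
  assumes B: "is_basis M B" and e: "e \<in> E - B" and b: "b \<in> B" "fund_circuit M B e b \<noteq> 0"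
  shows "is_basis M (insert e (B - {b}))"
proof -
  let ?B = "insert e (B - {b})"
  have ind: "indep M ?B"
    unfolding indep_def
  proof (intro conjI ballI notI)
    show "?B \<subseteq> E" using e basis_ground[OF B] by blast
  next
    fix X assume X: "X \<in> circuits M" "supp X \<subseteq> ?B"
    from X(2) have "supp X \<subseteq> insert e B" by blast
    from circuit_eq_fund[OF B e X(1) this] have "X b \<noteq> 0" using b by (metis mult_eq_0_iff)
    then show False using X(2) b e by auto
  qed
  have "S = ?B" if S: "indep M S" "?B \<subseteq> S" for S
  proof (rule ccontr)
    assume "S \<noteq> ?B"
    then obtain x where x: "x \<in> S" "x \<notin> ?B" using S by auto
    show False
    proof (cases "x = b")
      case True
      then have "supp (fund_circuit M B e) \<subseteq> S" using x S(2) fund_circuit_supp[OF B e] by auto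
      then show False using S(1) fund_circuit_circuit[OF B e] by (auto simp: indep_def)
    next
      case False
      then have xE: "x \<in> E - B" using x indep_ground[OF S(1)] by auto
      note Fx = fund_circuit_props[OF B xE] and Fe = fund_circuit_props[OF B e]
      show False
      proof (cases "fund_circuit M B x b = 0")
        case True
        then have "supp (fund_circuit M B x) \<subseteq> S" using x S(2) Fx(2) by fastforce
        then show False using S(1) Fx(1) by (auto simp: indep_def)
      next
        case nz: False
        \<comment> \<open>Nonzero values are signs, so the product serves as a quotient: with this
          factor the two circuits are opposite at \<open>b\<close>.\<close>
        let ?c = "- fund_circuit M B x b * fund_circuit M B e b"
        have c: "?c = 1 \<or> ?c = -1"
          using nz b circuit_values[OF Fx(1), of b] circuit_values[OF Fe(1), of b] by auto
        have "fund_circuit M B e x = 0" using Fe(2) xE x by auto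
        then have "fund_circuit M B x \<noteq> opposite (\<lambda>f. ?c * fund_circuit M B e f)"
          by (intro neq_oppositeI[of _ x]) (simp add: Fx(3))
        moreover have "?c * fund_circuit M B e b = - fund_circuit M B x b"
          using b circuit_values[OF Fe(1), of b] by auto
        ultimately obtain Z where Z: "Z \<in> circuits M" "Z b = 0"
          "\<And>f. Z f \<noteq> 0 \<Longrightarrow> Z f = fund_circuit M B x f \<or> Z f = ?c * fund_circuit M B e f"
          using circuit_elim[OF Fx(1) circuit_scale[OF Fe(1) c] _ nz] by metis
        have "f \<in> S" if "Z f \<noteq> 0" for f
        proof -
          have "f \<noteq> b" using that Z(2) by auto
          moreover have "fund_circuit M B x f \<noteq> 0 \<or> fund_circuit M B e f \<noteq> 0"
            using Z(3)[OF that] that by auto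
          ultimately have "f \<in> insert x ?B"
            using fund_circuit_in[OF B xE] fund_circuit_in[OF B e] by blast
          then show ?thesis using S(2) x by auto
        qed
        then show False using indep_circuit[OF S(1) Z(1)] by blast
      qed
    qed
  qed
  then show ?thesis using ind unfolding is_basis_def by blast
qed

section \<open>The signature of the cocircuits\<close>


abbreviation fc where "fc \<equiv> fund_circuit M"

text \<open>Candidate for the signed fundamental cocircuit. The fundamental circuit of
  \<open>e\<close> can meet it only in \<open>e\<close>, with value 1, and in \<open>b\<close>, so
  orthogonality forces the value at \<open>e\<close>.\<close>

definition cosig :: "'a set \<Rightarrow> 'a \<Rightarrow> 'a signed" where
  "cosig B b = (\<lambda>e. if e = b then 1 else if e \<in> E - B then - fc B e b else 0)"

lemma cosig_self: "cosig B b b = 1"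
  by (simp add: cosig_def)

lemma cosig_outside: "b \<in> B \<Longrightarrow> e \<in> E - B \<Longrightarrow> cosig B b e = - fc B e b"
  by (auto simp: cosig_def)

lemma cosig_support: "cosig B b e \<noteq> 0 \<Longrightarrow> e = b \<or> e \<in> E - B"
  by (auto simp: cosig_def split: if_splits)

lemma cosig_supp: "supp (cosig B b) \<subseteq> insert b (E - B)"
  by (auto dest: cosig_support)

lemma cosig_signed: "is_basis M B \<Longrightarrow> b \<in> B \<Longrightarrow> signed_subset E (cosig B b)"
  using basis_ground circuit_values[OF fund_circuit_circuit, of B]
  by (auto simp: signed_subset_def cosig_def split: if_splits) fastforce

text \<open>Elimination of \<open>b\<close> between the fundamental circuits of \<open>f\<close> and
  \<open>e\<close>. It may lose elements of the former, which is why agreement is claimed only where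
  \<open>Z\<close> is nonzero.\<close>

lemma fund_circuit_exchange_nz:
  assumes B: "is_basis M B" and e: "e \<in> E - B" and f: "f \<in> E - B" "f \<noteq> e"
    and b: "b \<in> B" "fc B e b \<noteq> 0"
  obtains Z where "Z \<in> circuits M" "supp Z \<subseteq> insert f (insert e (B - {b}))"
    "\<And>g. Z g \<noteq> 0 \<Longrightarrow> fc B e g = 0 \<Longrightarrow> Z g = fc B f g"
proof (cases "fc B f b = 0")
  case True
  then show ?thesis
    using that[of "fc B f"] fund_circuit_props[OF B f(1)] by fastforce
next
  case nz: False
  note Fe = fund_circuit_props[OF B e] and Ff = fund_circuit_props[OF B f(1)]
  define c where "c = - fc B f b * fc B e b"
  have c: "c = 1 \<or> c = -1" "c * fc B e b = - fc B f b"
    using nz b circuit_values[OF Fe(1), of b] circuit_values[OF Ff(1), of b] by (auto simp: c_def)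
  have "fc B e f = 0" using fund_circuit_in[OF B e] f by auto
  then have ne: "fc B f \<noteq> opposite (\<lambda>g. c * fc B e g)"
    by (intro neq_oppositeI[of _ f]) (simp add: Ff(3))
  obtain Z where Z: "Z \<in> circuits M" "Z b = 0" "\<And>g. Z g \<noteq> 0 \<Longrightarrow> Z g = fc B f g \<or> Z g = c * fc B e g"
    using circuit_elim[OF Ff(1) circuit_scale[OF Fe(1) c(1)] ne nz c(2)] by blast
  have "supp Z \<subseteq> insert f (insert e (B - {b}))"
  proof
    fix g assume g: "g \<in> supp Z"
    then have "g \<noteq> b" using Z(2) by auto
    moreover have "fc B f g \<noteq> 0 \<or> fc B e g \<noteq> 0" using Z(3)[of g] g by auto
    ultimately show "g \<in> insert f (insert e (B - {b}))"
      using fund_circuit_in[OF B e] fund_circuit_in[OF B f(1)] by blast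
  qed
  moreover have "Z g = fc B f g" if "Z g \<noteq> 0" "fc B e g = 0" for g
    using Z(3)[OF that(1)] that by auto
  ultimately show ?thesis using that Z(1) by blast
qed

text \<open>As \<open>e\<close> lies off the fundamental cocircuit of \<open>b\<close>, exchanging
  it into the basis should not alter that cocircuit. The substance is that the fundamental circuits
  of each \<open>f\<close> with respect to the two bases agree at \<open>b\<close>.\<close>

lemma cosig_exchange:
  assumes B: "is_basis M B" and b: "b \<in> B" and e: "e \<in> E - B" "fc B e b = 0"
    and b': "b' \<in> B" "fc B e b' \<noteq> 0"
  shows "cosig (insert e (B - {b'})) b = cosig B b"
proof
  fix f
  let ?B = "insert e (B - {b'})"
  have B': "is_basis M ?B" by (rule basis_exchange[OF B e(1) b'])
  have bb: "b \<noteq> b'" using e(2) b'(2) by auto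
  have b1: "b \<in> ?B" using b bb by auto
  have b'E: "b' \<in> E - ?B" using b' e basis_ground[OF B] by auto
  note Fe = fund_circuit_props[OF B e(1)]
  have Fes: "supp (fc B e) \<subseteq> insert b' ?B" using Fe(2) by auto
  have e': "fc B e g = fc B e b' * fc ?B b' g" for g
    by (rule circuit_eq_fund(2)[OF B' b'E Fe(1) Fes])
  consider "f = b" | "f \<notin> E" "f \<noteq> b" | "f \<in> B" "f \<noteq> b'" "f \<noteq> b" | "f = b'" | "f = e" | "f \<in> E - B" "f \<noteq> e" by blast
  then show "cosig ?B b f = cosig B b f"
  proof cases
    case 4
    have "fc ?B b' b = 0" using e'[of b] e(2) b'(2) by auto
    then show ?thesis using 4 bb b' b'E by (auto simp: cosig_def)
  next
    case 5
    then show ?thesis using e b by (auto simp: cosig_def)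
  next
    case 6
    then have f': "f \<in> E - ?B" "f \<noteq> b'" using b' by auto
    obtain Z where Z: "Z \<in> circuits M" "supp Z \<subseteq> insert f ?B"
      "\<And>g. Z g \<noteq> 0 \<Longrightarrow> fc B e g = 0 \<Longrightarrow> Z g = fc B f g"
      using fund_circuit_exchange_nz[OF B e(1) 6 b'] by blast
    have ef: "fc B e f = 0" using fund_circuit_in[OF B e(1)] 6 by auto
    have Zf: "Z f = 1"
      using circuit_eq_fund(1)[OF B' f'(1) Z(1,2)] Z(3)[OF _ ef] fund_circuit_self[OF B 6(1)] by auto
    have ZF: "Z g = fc ?B f g" for g
      using circuit_eq_fund(2)[OF B' f'(1) Z(1,2), of g] Zf by simp
    have "fc ?B f b = fc B f b"
    proof (cases "Z b = 0")
      case False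
      then show ?thesis using Z(3)[OF False e(2)] ZF[of b] by simp
    next
      case True
      \<comment> \<open>Elimination may have dropped \<open>b\<close> from \<open>Z\<close>.
        Exchanging back from \<open>?B\<close> to \<open>B\<close> gives a second circuit without
        \<open>b\<close>, so \<open>fc B f b\<close> is 0 as well.\<close>
      have e1: "e \<in> ?B" by simp
      have "fc B e e \<noteq> 0" using Fe(3) by simp
      then have e2: "fc ?B b' e \<noteq> 0" using e'[of e] by auto
      obtain W where W: "W \<in> circuits M" "supp W \<subseteq> insert f (insert b' (?B - {e}))"
        "\<And>g. W g \<noteq> 0 \<Longrightarrow> fc ?B b' g = 0 \<Longrightarrow> W g = fc ?B f g"
        using fund_circuit_exchange_nz[OF B' b'E f' e1 e2] by blast
      have "insert f (insert b' (?B - {e})) = insert f B" using e b' by auto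
      then have Ws: "supp W \<subseteq> insert f B" using W(2) by simp
      have "fc ?B b' b = 0" using e'[of b] e(2) b'(2) by auto
      then have "W b = 0" using W(3)[of b] True ZF[of b] by auto
      then have "fc B f b = 0"
        using circuit_eq_fund[OF B 6(1) W(1) Ws] by (metis mult_eq_0_iff)
      then show ?thesis using True ZF[of b] by simp
    qed
    then show ?thesis using 6 f' b by (auto simp: cosig_def)
  qed (use e in \<open>auto simp: cosig_def\<close>)
qed

text \<open>Induction on the number of elements of \<open>X\<close> outside the basis, with circuit
  and basis both varying. If \<open>X\<close> has an element outside \<open>B\<close> on which the
  cocircuit vanishes, it is exchanged into the basis for an element not in \<open>X\<close>, leaving
  the cocircuit unchanged. Otherwise one outside element is eliminated against its fundamental
  circuit; constancy of the products survives, so by induction the new circuit misses the cocircuit,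
  although it still has an element outside \<open>B\<close>.\<close>

lemma cosig_orthogonal:
  assumes "is_basis M B" "b \<in> B" "X \<in> circuits M"
  shows "orthogonal X (cosig B b)"
  using assms
proof (induction "card (supp X - B)" arbitrary: B X rule: less_induct)
  case less
  note B = less.prems(1) and b = less.prems(2) and X = less.prems(3)
  let ?D = "cosig B b"
  have fin: "finite (supp X)"
    using circuit_ground[OF X] by (intro finite_subset[OF _ finite_ground]) auto
  show ?case
  proof (rule ccontr)
    assume "\<not> orthogonal X ?D"
    then obtain c where c: "c = 1 \<or> c = -1" "\<And>f. X f \<noteq> 0 \<Longrightarrow> ?D f \<noteq> 0 \<Longrightarrow> X f * ?D f = c"
      using not_orthogonal_const[OF circuit_signed[OF X] cosig_signed[OF B b]] by blast
    obtain d where d: "X d \<noteq> 0" "?D d \<noteq> 0"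
      using \<open>\<not> orthogonal X ?D\<close> by (auto simp: orthogonal_def)
    have XB: "\<exists>e. X e \<noteq> 0 \<and> e \<notin> B" using indep_circuit[OF basis_indep[OF B] X] .
    \<comment> \<open>For a multiple of a fundamental circuit the only common elements are
      \<open>b\<close> and \<open>e\<close>, where the products are opposite by construction. So
      \<open>X\<close> is not of this form, which both cases use.\<close>
    have fund: "\<not> supp X \<subseteq> insert e B" if e: "X e \<noteq> 0" "e \<notin> B" for e
    proof
      assume s: "supp X \<subseteq> insert e B"
      have eE: "e \<in> E - B" using e circuit_ground[OF X] by auto
      have Xb: "X b = X e * fc B e b" by (rule circuit_eq_fund(2)[OF B eE X s])
      have "d = b \<or> d = e" using s d cosig_support[of B b d] by auto
      then have nz: "fc B e b \<noteq> 0" using d Xb cosig_outside[OF b eE] by auto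
      then have "X b * ?D b = c" "X e * ?D e = c"
        using c(2)[of b] c(2)[of e] cosig_self cosig_outside[OF b eE] Xb e by auto
      then show False using Xb c(1) cosig_self[of B b] cosig_outside[OF b eE] by auto
    qed
    show False
    proof (cases "\<exists>e. X e \<noteq> 0 \<and> e \<notin> B \<and> ?D e = 0")
      case True
      then obtain e where e: "X e \<noteq> 0" "e \<notin> B" "?D e = 0" by blast
      then have eE: "e \<in> E - B" using circuit_ground[OF X] by auto
      note Fe = fund_circuit_props[OF B eE]
      have eb: "fc B e b = 0" using e cosig_outside[OF b eE] by auto
      have "\<not> supp (fc B e) \<subseteq> supp X"
      proof
        assume "supp (fc B e) \<subseteq> supp X"
        then have "supp X = supp (fc B e)" using circuit_incomparable[OF Fe(1) X] by auto
        then show False using fund[OF e(1,2)] Fe(2) by simp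
      qed
      then obtain b' where b': "fc B e b' \<noteq> 0" "X b' = 0" by auto
      then have b'B: "b' \<in> B" using fund_circuit_in[OF B eE] e(1) by metis
      let ?B = "insert e (B - {b'})"
      have "b' \<notin> supp X" using b'(2) by simp
      then have "supp X - ?B \<subseteq> supp X - B" by blast
      moreover have "e \<in> supp X - B" "e \<notin> supp X - ?B" using e(1,2) by simp_all
      ultimately have "supp X - ?B \<subset> supp X - B" by blast
      then have "card (supp X - ?B) < card (supp X - B)" using fin by (simp add: psubset_card_mono)
      moreover have "is_basis M ?B" by (rule basis_exchange[OF B eE b'B b'(1)])
      moreover have "b \<in> ?B" using b b' eb by auto
      ultimately have "orthogonal X (cosig ?B b)" using less.hyps X by blast
      then show False
        using \<open>\<not> orthogonal X ?D\<close> cosig_exchange[OF B b eE eb b'B b'(1)] by simp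
    next
      case False
      obtain e where e: "X e \<noteq> 0" "e \<notin> B" using XB by blast
      then have eE: "e \<in> E - B" using circuit_ground[OF X] by auto
      note Fe = fund_circuit_props[OF B eE]
      \<comment> \<open>The sign \<open>- X e\<close> makes the elimination at \<open>e\<close>
        possible, and it turns the value at \<open>b\<close> into \<open>c\<close>, so that the new
        circuit keeps the constant product even if it gains \<open>b\<close>.\<close>
      define k where "k = - X e"
      have k: "k = 1 \<or> k = -1" using e circuit_values[OF X, of e] by (auto simp: k_def)
      have De: "?D e = - fc B e b" by (rule cosig_outside[OF b eE])
      have Dnz: "?D e \<noteq> 0" using False e by auto
      have kc: "k * fc B e b = c" using c(2)[OF e(1) Dnz] by (simp add: De k_def)
      have ne: "X \<noteq> opposite (\<lambda>f. k * fc B e f)"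
      proof
        assume "X = opposite (\<lambda>f. k * fc B e f)"
        then have "supp X \<subseteq> supp (fc B e)" by auto
        then show False using fund[OF e] Fe(2) by blast
      qed
      obtain Z where Z: "Z \<in> circuits M" "Z e = 0" "\<And>f. Z f \<noteq> 0 \<Longrightarrow> Z f = X f \<or> Z f = k * fc B e f"
        using circuit_elim[OF X circuit_scale[OF Fe(1) k] ne e(1)] by (auto simp: k_def Fe(3))
      have ZX: "Z f = X f" if "Z f \<noteq> 0" "f \<notin> B" for f
      proof -
        have "f \<noteq> e" using Z(2) that(1) by metis
        then have "fc B e f = 0" using fund_circuit_in[OF B eE, of f] that(2) by blast
        then show ?thesis using Z(3)[OF that(1)] that(1) by simp
      qed
      have "supp Z - B \<subseteq> supp X - B" using ZX by fastforce
      moreover have "e \<in> supp X - B" "e \<notin> supp Z - B" using e Z(2) by simp_all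
      ultimately have "supp Z - B \<subset> supp X - B" by blast
      then have "card (supp Z - B) < card (supp X - B)" using fin by (simp add: psubset_card_mono)
      then have orth: "orthogonal Z ?D" using less.hyps B b Z(1) by blast
      have "Z f * ?D f = c" if f: "Z f \<noteq> 0" "?D f \<noteq> 0" for f
      proof (cases "Z f = X f")
        case True
        then show ?thesis using f c(2)[of f] by simp
      next
        case False
        then have "f = b" using ZX f cosig_support[of B b f] by auto
        then show ?thesis using False Z(3)[OF f(1)] kc cosig_self[of B b] by auto
      qed
      then have z: "Z f = 0 \<or> ?D f = 0" for f by (rule orthogonal_const[OF orth])
      obtain f where "Z f \<noteq> 0" "f \<notin> B" using indep_circuit[OF basis_indep[OF B] Z(1)] by blast
      then show False using z[of f] ZX[of f] False by auto
    qed
  qed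
qed

section \<open>Cocircuits\<close>

text \<open>If \<open>B\<close> avoided \<open>S\<close>, the fundamental circuit of
  \<open>e\<close> would meet \<open>S\<close> in \<open>e\<close> alone.\<close>

lemma meets_basis:
  assumes B: "is_basis M B" and "S \<subseteq> E" "e \<in> S" "\<And>X. X \<in> circuits M \<Longrightarrow> X e \<noteq> 0 \<Longrightarrow> \<exists>f\<in>S. f \<noteq> e \<and> X f \<noteq> 0"
  shows "S \<inter> B \<noteq> {}"
proof
  assume S: "S \<inter> B = {}"
  then have eE: "e \<in> E - B" using assms by auto
  note Fe = fund_circuit_props[OF B eE]
  obtain f where "f \<in> S" "f \<noteq> e" "fc B e f \<noteq> 0" using assms(4)[OF Fe(1)] Fe(3) by auto
  then show False using fund_circuit_in[OF B eE] S by blast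
qed

lemma orthogonal_meets:
  assumes "orthogonal X Y" "X e \<noteq> 0" "Y e \<noteq> 0"
  shows "\<exists>f\<in>supp Y. f \<noteq> e \<and> X f \<noteq> 0"
proof (rule ccontr)
  assume "\<not> ?thesis"
  then have "X f * Y f = X e * Y e" if "X f \<noteq> 0" "Y f \<noteq> 0" for f using that by auto
  from orthogonal_const[OF assms(1) this] show False using assms by blast
qed

text \<open>Minimality: without \<open>b\<close> the support avoids \<open>B\<close>, and without
  another element \<open>d\<close> it avoids the basis in which \<open>d\<close> replaces
  \<open>b\<close>.\<close>

lemma cosig_cocircuit:
  assumes B: "is_basis M B" and b: "b \<in> B"
  shows "cosig B b \<in> cocircuits M"
proof -
  let ?D = "cosig B b"
  have sub: "supp ?D \<subseteq> E" using cosig_signed[OF B b] by (simp add: signed_subset_def)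
  have "supp ?D \<inter> B' \<noteq> {}" if B': "is_basis M B'" for B'
    by (rule meets_basis[OF B' sub, of b])
       (use cosig_self orthogonal_meets[OF cosig_orthogonal[OF B b]] in auto)
  moreover have "\<exists>B'. is_basis M B' \<and> D' \<inter> B' = {}" if D': "D' \<subset> supp ?D" for D'
  proof -
    obtain d where "d \<in> supp ?D" and d2: "d \<notin> D'" using D' by blast
    then have d: "?D d \<noteq> 0" "d \<notin> D'" by simp_all
    show ?thesis
    proof (cases "d = b")
      case True
      have "D' \<inter> B = {}" using D' d(2) cosig_support[of B b] True by fastforce
      then show ?thesis using B by blast
    next
      case False
      then have dE: "d \<in> E - B" using cosig_support[OF d(1)] by auto
      then have "fc B d b \<noteq> 0" using cosig_outside[OF b dE] d by auto
      from basis_exchange[OF B dE b this]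
      have "is_basis M (insert d (B - {b}))" .
      moreover have "D' \<inter> insert d (B - {b}) = {}" using D' d(2) cosig_support[of B b] by fastforce
      ultimately show ?thesis by blast
    qed
  qed
  ultimately show ?thesis using cosig_signed[OF B b] cosig_orthogonal[OF B b] sub
    by (auto simp: cocircuits_def underlying_cocircuit_def)
qed

text \<open>The fundamental circuit of \<open>e\<close> meets \<open>Y\<close> at most in
  \<open>e\<close> and \<open>b\<close>. Only orthogonality and the support of \<open>Y\<close>
  enter, so the lemma also applies to vectors not yet known to be cocircuits.\<close>

lemma cosig_unique:
  assumes B: "is_basis M B" and b: "b \<in> B" and Y: "\<And>X. X \<in> circuits M \<Longrightarrow> orthogonal X Y"
    and sub: "supp Y \<subseteq> insert b (E - B)"
  shows "Y e = Y b * cosig B b e"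
proof -
  have sub': "g = b \<or> g \<in> E - B" if "Y g \<noteq> 0" for g using that sub by (auto simp: subset_iff)
  show ?thesis
  proof (cases "e \<in> E - B")
    case True
    note Fe = fund_circuit_props[OF B True]
    have "fc B e e * Y e = - (fc B e b * Y b)"
    proof (rule orthogonal_two[OF Y[OF Fe(1)]])
      show "g = e \<or> g = b" if "fc B e g \<noteq> 0" "Y g \<noteq> 0" for g
        using fund_circuit_in[OF B True that(1)] sub'[OF that(2)] by blast
    qed (use True b in blast)
    then show ?thesis using cosig_outside[OF b True] Fe(3) by simp
  next
    case False
    then show ?thesis
      using sub'[of e] cosig_self[of B b] cosig_support[of B b e] mult_1_right mult_zero_right by metis
  qed
qed

lemma fund_cocircuit_eq:
  assumes B: "is_basis M B" and b: "b \<in> B"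
  shows "fund_cocircuit M B b = cosig B b"
  unfolding fund_cocircuit_def
proof (rule the_equality)
  show "cosig B b \<in> cocircuits M \<and> supp (cosig B b) \<subseteq> insert b (E - B) \<and> cosig B b b = 1"
    using cosig_cocircuit[OF B b] cosig_supp[of B b] cosig_self[of B b] by blast
  fix Y assume Y: "Y \<in> cocircuits M \<and> supp Y \<subseteq> insert b (E - B) \<and> Y b = 1"
  then have o: "\<And>X. X \<in> circuits M \<Longrightarrow> orthogonal X Y" by (simp add: cocircuits_def)
  show "Y = cosig B b"
    using cosig_unique[OF B b o] Y by (simp add: fun_eq_iff)
qed

lemma fund_cocircuit_outside:
  "is_basis M B \<Longrightarrow> b \<in> B \<Longrightarrow> e \<in> E - B \<Longrightarrow> fund_cocircuit M B b e = - fc B e b"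
  by (simp only: fund_cocircuit_eq cosig_outside)

lemma fund_cocircuit_props:
  assumes "is_basis M B" "b \<in> B"
  shows fund_cocircuit_cocircuit: "fund_cocircuit M B b \<in> cocircuits M"
    and fund_cocircuit_in: "fund_cocircuit M B b f \<noteq> 0 \<Longrightarrow> f = b \<or> f \<in> E - B"
    and fund_cocircuit_self: "fund_cocircuit M B b b = 1"
  using cosig_cocircuit[OF assms] cosig_support[of B b f] cosig_self[of B b] fund_cocircuit_eq[OF assms]
  by auto

lemma orthogonal_cocircuit: "X \<in> circuits M \<Longrightarrow> Y \<in> cocircuits M \<Longrightarrow> orthogonal X Y"
  by (simp add: cocircuits_def)

text \<open>By minimality some basis meets \<open>D\<close> only in \<open>d\<close>. Every exchange
  of \<open>d\<close> for an \<open>f\<close> in its fundamental cocircuit gives a basis that must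
  meet \<open>D\<close> again, so \<open>f\<close> is in \<open>D\<close>; minimality then yields
  equality. Thus every cocircuit is fundamental.\<close>

lemma underlying_cocircuit_cosig:
  assumes D: "underlying_cocircuit M D" and d: "d \<in> D"
  obtains B where "is_basis M B" "d \<in> B" "D = supp (cosig B d)"
proof -
  have D1: "D \<subseteq> E" "\<And>B. is_basis M B \<Longrightarrow> D \<inter> B \<noteq> {}"
    and D2: "\<And>D'. D' \<subset> D \<Longrightarrow> \<exists>B. is_basis M B \<and> D' \<inter> B = {}"
    using D by (auto simp: underlying_cocircuit_def)
  obtain B where B: "is_basis M B" "(D - {d}) \<inter> B = {}" using D2[of "D - {d}"] d by auto
  have dB: "d \<in> B" using D1(2)[OF B(1)] B(2) by auto
  have sub: "supp (cosig B d) \<subseteq> D"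
  proof
    fix f assume f: "f \<in> supp (cosig B d)"
    show "f \<in> D"
    proof (cases "f = d")
      case False
      then have fE: "f \<in> E - B" using f cosig_support by auto
      then have nz: "fc B f d \<noteq> 0" using f cosig_outside[OF dB fE] by auto
      show ?thesis using D1(2)[OF basis_exchange[OF B(1) fE dB nz]] B(2) by auto
    qed (use d in simp)
  qed
  have "supp (cosig B d) \<inter> B' \<noteq> {}" if "is_basis M B'" for B'
    using cosig_cocircuit[OF B(1) dB] that by (auto simp: cocircuits_def underlying_cocircuit_def)
  then have "D = supp (cosig B d)" using sub D2 by blast
  then show ?thesis using that B(1) dB by blast
qed

lemma cocircuit_cosig:
  assumes Y: "Y \<in> cocircuits M" and d: "Y d \<noteq> 0"
  obtains B where "is_basis M B" "d \<in> B" "\<And>e. Y e = Y d * cosig B d e"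
proof -
  have "underlying_cocircuit M (supp Y)" using Y by (simp add: cocircuits_def)
  then obtain B where B: "is_basis M B" "d \<in> B" "supp Y = supp (cosig B d)"
    using underlying_cocircuit_cosig[of "supp Y" d] d by auto
  have "supp Y \<subseteq> insert d (E - B)" using B(3) cosig_supp[of B d] by simp
  then have "Y e = Y d * cosig B d e" for e
    using cosig_unique[OF B(1,2) orthogonal_cocircuit[OF _ Y]] by blast
  then show ?thesis using that B(1,2) by blast
qed

section \<open>The painting lemma\<close>


lemma cocircuit_signed: "Y \<in> cocircuits M \<Longrightarrow> signed_subset E Y"
  by (simp add: cocircuits_def)

lemma cocircuit_values: "Y \<in> cocircuits M \<Longrightarrow> Y e = 0 \<or> Y e = 1 \<or> Y e = -1"
  by (rule signed_cases[OF cocircuit_signed])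

lemma orthogonal_opposite: "orthogonal X Y \<Longrightarrow> orthogonal X (opposite Y)"
  unfolding orthogonal_def supp_opposite opposite_apply mult_minus_right by (metis minus_minus)

lemma signed_opposite: "signed_subset S Y \<Longrightarrow> signed_subset S (opposite Y)"
  unfolding signed_subset_def supp_opposite opposite_apply by (simp add: minus_equation_iff[of "Y _"]) blast

lemma cocircuit_opposite: "Y \<in> cocircuits M \<Longrightarrow> opposite Y \<in> cocircuits M"
  unfolding cocircuits_def mem_Collect_eq supp_opposite
  using orthogonal_opposite signed_opposite by blast

lemma cocircuit_scale: "Y \<in> cocircuits M \<Longrightarrow> c = 1 \<or> c = -1 \<Longrightarrow> (\<lambda>e. c * Y e) \<in> cocircuits M"
  using cocircuit_opposite[of Y] by (auto simp: opposite_def)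

lemma indep_empty: "indep M {}"
  using circuit_nonempty unfolding indep_def by (metis empty_subsetI empty_iff subset_empty supp_iff)

text \<open>Let \<open>I\<close> be a maximal independent subset of \<open>G\<close>. Either
  \<open>x\<close> depends on \<open>I\<close>, or \<open>I\<close> with \<open>x\<close> extends to
  a basis whose fundamental cocircuit at \<open>x\<close> misses \<open>G\<close>.\<close>

lemma painting_single:
  assumes "x \<in> E - G" "G \<subseteq> E"
  shows "(\<exists>C\<in>circuits M. C x \<noteq> 0 \<and> supp C \<subseteq> insert x G) \<or>
    (\<exists>D\<in>cocircuits M. D x \<noteq> 0 \<and> supp D \<inter> G = {})"
proof -
  have fin: "finite {I. indep M I \<and> I \<subseteq> G}"
    by (rule finite_subset[of _ "Pow E"]) (auto simp: finite_ground dest: indep_ground)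
  have "indep M {}" by (rule indep_empty)
  with finite_has_maximal2[OF fin, of "{}"]
  obtain I where I: "indep M I" "I \<subseteq> G" and
    I_max: "\<And>J. indep M J \<Longrightarrow> J \<subseteq> G \<Longrightarrow> I \<subseteq> J \<Longrightarrow> I = J" by auto
  show ?thesis
  proof (cases "\<exists>C\<in>circuits M. C x \<noteq> 0 \<and> supp C \<subseteq> insert x I")
    case True
    then show ?thesis using I(2) by blast
  next
    case False
    have "indep M (insert x I)"
      unfolding indep_def
    proof (intro conjI ballI notI)
      show "insert x I \<subseteq> E" using assms indep_ground[OF I(1)] by blast
    next
      fix C assume C: "C \<in> circuits M" "supp C \<subseteq> insert x I"
      then have "C x = 0" using False by blast
      then have "supp C \<subseteq> I" using C(2) by (auto simp: subset_iff)
      then show False using I(1) C(1) by (auto simp: indep_def)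
    qed
    then obtain B where B: "is_basis M B" "insert x I \<subseteq> B" using indep_extend by blast
    then have xB: "x \<in> B" by blast
    have "g = x" if g: "cosig B x g \<noteq> 0" "g \<in> G" for g
    proof (rule ccontr)
      assume gx: "g \<noteq> x"
      then have gE: "g \<in> E - B" using cosig_support[OF g(1)] by blast
      then have "\<not> indep M (insert g I)" using I_max[of "insert g I"] I(2) g(2) B(2) by blast
      then obtain C where C: "C \<in> circuits M" "supp C \<subseteq> insert g I"
        using gE indep_ground[OF I(1)] by (auto simp: indep_def)
      have CB: "supp C \<subseteq> insert g B" using C(2) B(2) by blast
      have "C x = 0" using C(2) gx I(2) assms(1) by (auto simp: subset_iff)
      then have "fc B g x = 0" using circuit_eq_fund[OF B(1) gE C(1) CB] by (metis mult_eq_0_iff)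
      then show False using g(1) cosig_outside[OF xB gE] by simp
    qed
    then have "supp (cosig B x) \<inter> G = {}" using assms(1) by (metis DiffD2 disjoint_iff supp_iff)
    then show ?thesis using cosig_cocircuit[OF B(1) xB] cosig_self[of B x] by force
  qed
qed


text \<open>Elements of \<open>K\<close> carry prescribed signs; \<open>G\<close> is free for
  circuits and forbidden to cocircuits, the rest of \<open>E\<close> the reverse. In the induction a
  colored \<open>f\<close> is once moved to the rest and once to \<open>G\<close>. If this yields
  only a cocircuit the first time and a circuit the second time, both with the wrong sign at
  \<open>f\<close>, all their products are 1, against orthogonality at \<open>x\<close>.\<close>

lemma painting:
  assumes "finite K" "x \<in> K" "K \<subseteq> E" "G \<subseteq> E" "K \<inter> G = {}"
    and "\<And>f. f \<in> K \<Longrightarrow> \<sigma> f = 1 \<or> \<sigma> f = (-1::int)"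
  shows "(\<exists>C\<in>circuits M. C x \<noteq> 0 \<and> supp C \<subseteq> K \<union> G \<and> (\<forall>f\<in>K. C f \<noteq> 0 \<longrightarrow> C f = \<sigma> f)) \<or>
    (\<exists>D\<in>cocircuits M. D x \<noteq> 0 \<and> supp D \<inter> G = {} \<and> (\<forall>f\<in>K. D f \<noteq> 0 \<longrightarrow> D f = \<sigma> f))"
  using assms
proof (induction "card K" arbitrary: K G rule: less_induct)
  case less
  show ?case
  proof (cases "K = {x}")
    case True
    have s: "\<sigma> x = 1 \<or> \<sigma> x = -1" using less.prems by blast
    have "x \<in> E - G" using less.prems by blast
    from painting_single[OF this less.prems(4)] show ?thesis
    proof
      assume "\<exists>C\<in>circuits M. C x \<noteq> 0 \<and> supp C \<subseteq> insert x G"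
      then obtain C where C: "C \<in> circuits M" "C x \<noteq> 0" "supp C \<subseteq> insert x G" by blast
      define c where "c = \<sigma> x * C x"
      have "c = 1 \<or> c = -1" "c * C x = \<sigma> x" using s C(2) circuit_values[OF C(1), of x] by (auto simp: c_def)
      with circuit_scale[OF C(1), of c] C(2,3) True show ?thesis
        by (intro disjI1 bexI[of _ "\<lambda>e. c * C e"]) (auto simp: subset_iff)
    next
      assume "\<exists>D\<in>cocircuits M. D x \<noteq> 0 \<and> supp D \<inter> G = {}"
      then obtain D where D: "D \<in> cocircuits M" "D x \<noteq> 0" "supp D \<inter> G = {}" by blast
      define c where "c = \<sigma> x * D x"
      have "c = 1 \<or> c = -1" "c * D x = \<sigma> x" using s D(2) cocircuit_values[OF D(1), of x] by (auto simp: c_def)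
      with cocircuit_scale[OF D(1), of c] D(2,3) True show ?thesis
        by (intro disjI2 bexI[of _ "\<lambda>e. c * D e"]) auto
    qed
  next
    case False
    then obtain f where f: "f \<in> K" "f \<noteq> x" using less.prems(2) by blast
    let ?K = "K - {f}"
    have c: "card ?K < card K" using f less.prems(1) by (meson card_Diff1_less)
    have K: "finite ?K" "x \<in> ?K" "?K \<subseteq> E" "?K \<inter> G = {}" "?K \<inter> insert f G = {}" "insert f G \<subseteq> E"
      and s: "\<And>g. g \<in> ?K \<Longrightarrow> \<sigma> g = 1 \<or> \<sigma> g = -1"
      using less.prems f by auto
    have sf: "\<sigma> f = 1 \<or> \<sigma> f = -1" using less.prems(6) f by blast
    from less.hyps[OF c K(1-3) less.prems(4) K(4) s]
    consider C where "C \<in> circuits M" "C x \<noteq> 0" "supp C \<subseteq> ?K \<union> G" "\<forall>f\<in>?K. C f \<noteq> 0 \<longrightarrow> C f = \<sigma> f"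
      | D where "D \<in> cocircuits M" "D x \<noteq> 0" "supp D \<inter> G = {}" "\<forall>f\<in>?K. D f \<noteq> 0 \<longrightarrow> D f = \<sigma> f" by blast
    then show ?thesis
    proof cases
      case 1
      then have "C f = 0" using f less.prems(5) by (auto simp: subset_iff)
      then have "\<forall>f\<in>K. C f \<noteq> 0 \<longrightarrow> C f = \<sigma> f" using 1(4) by blast
      then show ?thesis using 1 by blast
    next
      case D: 2
      from less.hyps[OF c K(1-3) K(6) K(5) s]
      consider C where "C \<in> circuits M" "C x \<noteq> 0" "supp C \<subseteq> ?K \<union> insert f G" "\<forall>f\<in>?K. C f \<noteq> 0 \<longrightarrow> C f = \<sigma> f"
        | D where "D \<in> cocircuits M" "D x \<noteq> 0" "supp D \<inter> insert f G = {}" "\<forall>f\<in>?K. D f \<noteq> 0 \<longrightarrow> D f = \<sigma> f" by blast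
      then show ?thesis
      proof cases
        case 2
        then have "D f = 0" by auto
        then have "\<forall>f\<in>K. D f \<noteq> 0 \<longrightarrow> D f = \<sigma> f" using 2(4) by blast
        then show ?thesis using 2 by blast
      next
        case C: 1
        show ?thesis
        proof (cases "(D f \<noteq> 0 \<longrightarrow> D f = \<sigma> f) \<or> (C f \<noteq> 0 \<longrightarrow> C f = \<sigma> f)")
          case True
          then have "(\<forall>f\<in>K. D f \<noteq> 0 \<longrightarrow> D f = \<sigma> f) \<or> (\<forall>f\<in>K. C f \<noteq> 0 \<longrightarrow> C f = \<sigma> f)"
            using C(4) D(4) by blast
          moreover have "supp C \<subseteq> K \<union> G" using C(3) f by blast
          ultimately show ?thesis using C D by blast
        next
          case False
          then have "C f = - \<sigma> f" "D f = - \<sigma> f"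
            using sf circuit_values[OF C(1), of f] cocircuit_values[OF D(1), of f] by auto
          then have cf: "C f * D f = 1" using sf by auto
          have "C g * D g = 1" if g: "C g \<noteq> 0" "D g \<noteq> 0" for g
          proof (cases "g = f")
            case False
            then have "g \<in> ?K" using g C(3) D(3) by (auto simp: subset_iff)
            then have "C g = \<sigma> g" "D g = \<sigma> g" "\<sigma> g = 1 \<or> \<sigma> g = -1" using g C(4) D(4) s by blast+
            then show ?thesis by auto
          qed (simp add: cf)
          from orthogonal_const[OF orthogonal_cocircuit[OF C(1) D(1)] this]
          show ?thesis using C(2) D(2) by blast
        qed
      qed
    qed
  qed
qed

section \<open>Duality\<close>

lemma ex_basis: "\<exists>B. is_basis M B"
proof -
  have "indep M {}" by (rule indep_empty)
  then show ?thesis using indep_extend by blast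
qed

lemma ground_dual [simp]: "ground (dual M) = E"
  by (simp add: dual_def)

lemma circuits_dual [simp]: "circuits (dual M) = cocircuits M"
  by (simp add: dual_def)

lemma cocircuit_nonempty: "Y \<in> cocircuits M \<Longrightarrow> \<exists>e. Y e \<noteq> 0"
  using ex_basis by (auto simp: cocircuits_def underlying_cocircuit_def)

lemma cocircuit_incomparable:
  assumes "X \<in> cocircuits M" "Y \<in> cocircuits M" "supp X \<subseteq> supp Y"
  shows "X = Y \<or> X = opposite Y"
proof -
  obtain d where d: "X d \<noteq> 0" using cocircuit_nonempty[OF assms(1)] by blast
  then have d': "Y d \<noteq> 0" using assms(3) by auto
  obtain B where B: "is_basis M B" "d \<in> B" "\<And>e. Y e = Y d * cosig B d e"
    using cocircuit_cosig[OF assms(2) d'] by blast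
  have "supp Y \<subseteq> supp (cosig B d)" using B(3) by (metis mult_zero_right subsetI supp_iff)
  then have "supp X \<subseteq> insert d (E - B)" using assms(3) cosig_supp[of B d] by blast
  then have X: "X e = X d * cosig B d e" for e
    using cosig_unique[OF B(1,2) orthogonal_cocircuit[OF _ assms(1)]] by blast
  have "X d = Y d \<or> X d = - Y d"
    using d d' cocircuit_values[OF assms(1), of d] cocircuit_values[OF assms(2), of d] by auto
  then show ?thesis
  proof
    assume "X d = Y d"
    then have "X e = Y e" for e using X[of e] B(3)[of e] by simp
    then show ?thesis by (simp add: fun_eq_iff)
  next
    assume "X d = - Y d"
    then have "X e = - Y e" for e using X[of e] B(3)[of e] by simp
    then show ?thesis by (simp add: fun_eq_iff)
  qed
qed

text \<open>Elimination as an instance of painting, rooted at an \<open>f\<close> in the support of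
  \<open>X\<close> but not of \<open>Y\<close>. A circuit outcome would have product 1 with
  \<open>X\<close> off \<open>e\<close>, which forces the value -1 at \<open>e\<close>; then all its
  products with \<open>Y\<close> are 1, a contradiction.\<close>

lemma cocircuit_elim:
  assumes X: "X \<in> cocircuits M" and Y: "Y \<in> cocircuits M" and ne: "X \<noteq> opposite Y"
    and e: "X e = 1" "Y e = -1"
  shows "\<exists>Z\<in>cocircuits M. Z e = 0 \<and> (\<forall>f. Z f \<noteq> 0 \<longrightarrow> Z f = X f \<or> Z f = Y f)"
proof -
  have "X \<noteq> Y" using e by auto
  then have "\<not> supp X \<subseteq> supp Y" using cocircuit_incomparable[OF X Y] ne by blast
  then obtain f where f: "X f \<noteq> 0" "Y f = 0" by auto
  define \<sigma> where "\<sigma> = (\<lambda>g. if X g \<noteq> 0 then X g else Y g)"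
  \<comment> \<open>The elements other than \<open>e\<close> on which \<open>X\<close> and
    \<open>Y\<close> disagree in sign lie neither in \<open>K\<close> nor in \<open>G\<close>: the
    new cocircuit may take either sign there. It has to avoid \<open>e\<close> and everything
    outside both supports.\<close>
  define K where "K = {g. (X g \<noteq> 0 \<or> Y g \<noteq> 0) \<and> g \<noteq> e \<and> \<not> (X g \<noteq> 0 \<and> Y g \<noteq> 0 \<and> X g \<noteq> Y g)}"
  define G where "G = insert e (E - supp X - supp Y)"
  note Xv = cocircuit_values[OF X] and Yv = cocircuit_values[OF Y]
  have XE: "supp X \<subseteq> E" "supp Y \<subseteq> E" using cocircuit_signed[OF X] cocircuit_signed[OF Y] by (auto simp: signed_subset_def)
  have KE: "K \<subseteq> E" using XE by (auto simp: K_def subset_iff)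
  then have finK: "finite K" using finite_ground by (rule finite_subset)
  have eE: "e \<in> E" using XE e by (auto simp: subset_iff)
  then have GE: "G \<subseteq> E" by (auto simp: G_def)
  have KG: "K \<inter> G = {}" by (auto simp: K_def G_def)
  have fK: "f \<in> K" using f e by (auto simp: K_def)
  have sig: "\<sigma> g = 1 \<or> \<sigma> g = -1" if "g \<in> K" for g
    using that Xv[of g] Yv[of g] by (auto simp: K_def \<sigma>_def)
  from painting[of K f G \<sigma>, OF finK fK KE GE KG sig]
  consider C where "C \<in> circuits M" "C f \<noteq> 0" "supp C \<subseteq> K \<union> G" "\<forall>f\<in>K. C f \<noteq> 0 \<longrightarrow> C f = \<sigma> f"
    | D where "D \<in> cocircuits M" "D f \<noteq> 0" "supp D \<inter> G = {}" "\<forall>f\<in>K. D f \<noteq> 0 \<longrightarrow> D f = \<sigma> f" by blast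
  then show ?thesis
  proof cases
    case 1
    have in_K: "g \<in> K" if "C g \<noteq> 0" "X g \<noteq> 0 \<or> Y g \<noteq> 0" "g \<noteq> e" for g
    proof -
      have "g \<in> K \<union> G" using 1(3) that(1) by (auto simp: subset_iff)
      then show ?thesis using that(2,3) by (auto simp: G_def)
    qed
    have pX: "C g * X g = 1" if "C g \<noteq> 0" "X g \<noteq> 0" "g \<noteq> e" for g
      using 1(4)[rule_format, OF in_K that(1)] that Xv[of g] by (auto simp: \<sigma>_def)
    have pY: "C g * Y g = 1" if "C g \<noteq> 0" "Y g \<noteq> 0" "g \<noteq> e" for g
      using 1(4)[rule_format, OF in_K that(1)] in_K[OF that(1)] that Xv[of g] Yv[of g] by (auto simp: \<sigma>_def K_def)
    have "C e = -1"
    proof (rule ccontr)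
      assume "C e \<noteq> -1"
      then have "C g * X g = 1" if "C g \<noteq> 0" "X g \<noteq> 0" for g
        using pX[OF that] that e circuit_values[OF 1(1), of e] by (cases "g = e") auto
      from orthogonal_const[OF orthogonal_cocircuit[OF 1(1) X] this] show False using f 1(2) by blast
    qed
    then have "C g * Y g = 1" if "C g \<noteq> 0" "Y g \<noteq> 0" for g
      using pY[OF that] e by (cases "g = e") auto
    from orthogonal_const[OF orthogonal_cocircuit[OF 1(1) Y] this, of e] \<open>C e = -1\<close> e show ?thesis by simp
  next
    case 2
    have "D g = X g \<or> D g = Y g" if g: "D g \<noteq> 0" for g
    proof (cases "g \<in> K")
      case True
      then show ?thesis using 2(4)[rule_format, OF True g] by (auto simp: \<sigma>_def)
    next
      case False
      have "g \<notin> G" using 2(3) g by auto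
      moreover have "g \<in> E" using cocircuit_signed[OF 2(1)] g by (auto simp: signed_subset_def subset_iff)
      ultimately have "X g \<noteq> 0" "Y g \<noteq> 0" "X g \<noteq> Y g" using False by (auto simp: G_def K_def)
      then show ?thesis using Xv[of g] Yv[of g] cocircuit_values[OF 2(1), of g] g by auto
    qed
    moreover have "D e = 0" using 2(3) by (auto simp: G_def)
    ultimately show ?thesis using 2(1) by blast
  qed
qed

lemma oriented_matroid_dual: "oriented_matroid (dual M)"
  by (rule oriented_matroidI)
    (use finite_ground cocircuit_signed cocircuit_nonempty cocircuit_opposite cocircuit_incomparable
      cocircuit_elim in simp_all)

lemma om_dual: "om (dual M)"
  by (simp add: om_def oriented_matroid_dual)

section \<open>Bases of the dual matroid and biduality\<close>

lemma cocircuit_meets: "D \<in> cocircuits M \<Longrightarrow> is_basis M B \<Longrightarrow> supp D \<inter> B \<noteq> {}"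
  by (simp add: cocircuits_def underlying_cocircuit_def)

lemma cocircuit_within:
  assumes "S \<subseteq> E" "\<forall>B. is_basis M B \<longrightarrow> S \<inter> B \<noteq> {}"
  shows "\<exists>D\<in>cocircuits M. supp D \<subseteq> S"
proof -
  define \<A> where "\<A> = {T. T \<subseteq> S \<and> (\<forall>B. is_basis M B \<longrightarrow> T \<inter> B \<noteq> {})}"
  have "finite S" using assms(1) finite_ground by (rule finite_subset)
  then have fin: "finite \<A>" unfolding \<A>_def by simp
  have "S \<in> \<A>" using assms(2) by (simp add: \<A>_def)
  from finite_has_minimal2[OF fin this] obtain T where T': "T \<in> \<A>" "\<forall>U\<in>\<A>. U \<le> T \<longrightarrow> T = U"
    by (elim bexE conjE) (rule that)
  have T: "T \<subseteq> S" "\<And>B. is_basis M B \<Longrightarrow> T \<inter> B \<noteq> {}"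
    "\<And>U. U \<subseteq> T \<Longrightarrow> (\<forall>B. is_basis M B \<longrightarrow> U \<inter> B \<noteq> {}) \<Longrightarrow> T = U"
    using T' unfolding \<A>_def by blast+
  have "\<exists>B. is_basis M B \<and> U \<inter> B = {}" if "U \<subset> T" for U
    using T(3)[of U] that by blast
  then have u: "underlying_cocircuit M T" using T(1,2) assms(1) unfolding underlying_cocircuit_def by blast
  obtain d where "d \<in> T" using ex_basis T(2) by blast
  from underlying_cocircuit_cosig[OF u this] obtain B where "is_basis M B" "d \<in> B" "T = supp (cosig B d)" by blast
  then show ?thesis using cosig_cocircuit[of B d] T(1) by blast
qed

lemma indep_dual: "indep (dual M) S \<longleftrightarrow> S \<subseteq> E \<and> (\<exists>B. is_basis M B \<and> S \<inter> B = {})"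
proof
  assume S: "indep (dual M) S"
  then have SE: "S \<subseteq> E" by (simp add: indep_def)
  have "\<exists>B. is_basis M B \<and> S \<inter> B = {}"
  proof (rule ccontr)
    assume "\<not> ?thesis"
    then have "\<forall>B. is_basis M B \<longrightarrow> S \<inter> B \<noteq> {}" by blast
    from cocircuit_within[OF SE this] obtain D where "D \<in> cocircuits M" "supp D \<subseteq> S" by blast
    then show False using S by (simp add: indep_def)
  qed
  with SE show "S \<subseteq> E \<and> (\<exists>B. is_basis M B \<and> S \<inter> B = {})" by blast
next
  assume "S \<subseteq> E \<and> (\<exists>B. is_basis M B \<and> S \<inter> B = {})"
  then obtain B where S: "S \<subseteq> E" "is_basis M B" "S \<inter> B = {}" by blast
  have "\<not> supp D \<subseteq> S" if "D \<in> cocircuits M" for D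
    using cocircuit_meets[OF that S(2)] S(3) by blast
  then show "indep (dual M) S" using S by (simp add: indep_def)
qed

lemma basis_dual: "is_basis (dual M) S \<longleftrightarrow> S \<subseteq> E \<and> is_basis M (E - S)"
proof
  assume S: "is_basis (dual M) S"
  then obtain B where B: "S \<subseteq> E" "is_basis M B" "S \<inter> B = {}"
    unfolding is_basis_def indep_dual by blast
  then have "indep (dual M) (E - B)" "S \<subseteq> E - B" by (auto simp: indep_dual)
  then have "E - B = S" using S unfolding is_basis_def by blast
  then have "E - S = B" using basis_ground[OF B(2)] by blast
  then show "S \<subseteq> E \<and> is_basis M (E - S)" using B by simp
next
  assume S: "S \<subseteq> E \<and> is_basis M (E - S)"
  have "T = S" if T: "indep (dual M) T" "S \<subseteq> T" for T
  proof -
    obtain B where B: "T \<subseteq> E" "is_basis M B" "T \<inter> B = {}" using T(1) by (auto simp: indep_dual)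
    have "B \<subseteq> E - S" using B T(2) basis_ground[OF B(2)] by blast
    then have "E - S = B" using basis_maximal[OF B(2)] S basis_indep by blast
    then show ?thesis using B S T(2) by blast
  qed
  moreover have "indep (dual M) S" using S by (auto simp: indep_dual)
  ultimately show "is_basis (dual M) S" unfolding is_basis_def by blast
qed

lemma basis_dual_compl: "B \<subseteq> E \<Longrightarrow> is_basis (dual M) (E - B) \<longleftrightarrow> is_basis M B"
  by (simp add: basis_dual double_diff)

lemma circuit_cocircuit_dual:
  assumes X: "X \<in> circuits M"
  shows "X \<in> cocircuits (dual M)"
proof -
  have "supp X \<inter> B \<noteq> {}" if "is_basis (dual M) B" for B
  proof -
    have "indep M (E - B)" using that basis_dual basis_indep by blast
    from indep_circuit[OF this X] obtain e where "X e \<noteq> 0" "e \<notin> E - B" by blast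
    then show ?thesis using circuit_ground[OF X] by auto
  qed
  moreover have "\<exists>B. is_basis (dual M) B \<and> D \<inter> B = {}" if D: "D \<subset> supp X" for D
  proof -
    have "indep M D"
      unfolding indep_def
    proof (intro conjI ballI notI)
      show "D \<subseteq> E" using D circuit_ground[OF X] by auto
    next
      fix Y assume Y: "Y \<in> circuits M" "supp Y \<subseteq> D"
      then have "Y = X \<or> Y = opposite X"
        using circuit_incomparable[OF Y(1) X] D by blast
      then have "supp X = supp Y" by auto
      then show False using Y D by blast
    qed
    then obtain B where B: "is_basis M B" "D \<subseteq> B" using indep_extend by blast
    then show ?thesis using basis_dual_compl[OF basis_ground[OF B(1)]] by blast
  qed
  ultimately have "underlying_cocircuit (dual M) (supp X)"
    using circuit_signed[OF X] by (auto simp: underlying_cocircuit_def signed_subset_def)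
  moreover have "orthogonal Y X" if "Y \<in> cocircuits M" for Y
    using orthogonal_cocircuit[OF X that] by (simp add: orthogonal_sym)
  ultimately show ?thesis using circuit_signed[OF X] by (simp add: cocircuits_def[of "dual M"])
qed

text \<open>For the converse inclusion, a cocircuit of the dual meets the complement of every basis,
  so its support is dependent and contains a circuit. Incomparability in the dual identifies the two
  up to sign.\<close>

lemma cocircuits_dual [simp]: "cocircuits (dual M) = circuits M"
proof
  show "circuits M \<subseteq> cocircuits (dual M)" using circuit_cocircuit_dual by blast
  show "cocircuits (dual M) \<subseteq> circuits M"
  proof
    fix Y assume Y: "Y \<in> cocircuits (dual M)"
    then have u: "underlying_cocircuit (dual M) (supp Y)" by (simp add: cocircuits_def[of "dual M"])
    have "\<not> indep M (supp Y)"
    proof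
      assume "indep M (supp Y)"
      then obtain B where B: "is_basis M B" "supp Y \<subseteq> B" using indep_extend by blast
      then have "is_basis (dual M) (E - B)" using basis_dual_compl basis_ground by blast
      then show False using u B(2) by (auto simp: underlying_cocircuit_def)
    qed
    moreover have "supp Y \<subseteq> E" using u by (simp add: underlying_cocircuit_def)
    ultimately obtain X where X: "X \<in> circuits M" "supp X \<subseteq> supp Y" by (auto simp: indep_def)
    then have "X = Y \<or> X = opposite Y"
      using om.cocircuit_incomparable[OF om_dual circuit_cocircuit_dual[OF X(1)] Y] by blast
    then show "Y \<in> circuits M" using X(1) circuit_opposite[OF X(1)] by auto
  qed
qed

lemma dual_dual [simp]: "dual (dual M) = M"
  by (rule omatroid.equality) (simp_all add: dual_def[of "dual M"])

lemma fund_circuit_dual: "fund_circuit (dual M) (E - B) b = fund_cocircuit M B b"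
  by (simp add: fund_circuit_def fund_cocircuit_def)

lemma fund_cocircuit_dual: "B \<subseteq> E \<Longrightarrow> fund_cocircuit (dual M) (E - B) e = fund_circuit M B e"
  by (simp add: fund_circuit_def fund_cocircuit_def double_diff)

end

section \<open>Reorientation\<close>

definition flip_sign :: "'a set \<Rightarrow> 'a \<Rightarrow> int" where
  "flip_sign A e = (if e \<in> A then -1 else 1)"

lemma flip_sign_cases: "flip_sign A e = 1 \<or> flip_sign A e = -1"
  by (simp add: flip_sign_def)

lemma flip_sign_square [simp]: "flip_sign A e * flip_sign A e = 1"
  by (simp add: flip_sign_def)

lemma flip_sign_cancel [simp]: "flip_sign A e * (flip_sign A e * c) = c"
  by (simp add: flip_sign_def)

lemma flip_sign_nz [simp]: "flip_sign A e \<noteq> 0"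
  by (simp add: flip_sign_def)

lemma ground_reorient [simp]: "ground (reorient A M) = ground M"
  by (simp add: reorient_def)

lemma circuits_reorient: "circuits (reorient A M) = (\<lambda>X e. flip_sign A e * X e) ` circuits M"
  unfolding reorient_def flip_sign_def by (auto intro!: image_eqI ext)

lemma flip_opposite: "opposite (\<lambda>e. flip_sign A e * X e) = (\<lambda>e. flip_sign A e * opposite X e)"
  by (simp add: fun_eq_iff)

lemma supp_flip [simp]: "supp (\<lambda>e. flip_sign A e * X e) = supp X"
  by auto

context om
begin

lemma om_reorient: "om (reorient A M)"
  unfolding om_def
proof (rule oriented_matroidI)
  let ?f = "\<lambda>X e. flip_sign A e * X e"
  show "finite (ground (reorient A M))" using finite_ground by simp
  show "\<exists>e. X e \<noteq> 0" if "X \<in> circuits (reorient A M)" for X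
    using that circuit_nonempty by (auto simp: circuits_reorient)
  show "opposite X \<in> circuits (reorient A M)" if "X \<in> circuits (reorient A M)" for X
    using that circuit_opposite unfolding circuits_reorient by (auto simp only: flip_opposite)
  show "signed_subset (ground (reorient A M)) X" if X: "X \<in> circuits (reorient A M)" for X
  proof -
    obtain X' where X': "X' \<in> circuits M" "X = ?f X'" using X by (auto simp: circuits_reorient)
    have "X e \<in> {-1, 0, 1}" for e
      using circuit_values[OF X'(1), of e] flip_sign_cases[of A e] X'(2) by auto
    then show ?thesis using circuit_ground[OF X'(1)] X'(2) by (auto simp: signed_subset_def)
  qed
  show "X = Y \<or> X = opposite Y"
    if XY: "X \<in> circuits (reorient A M)" "Y \<in> circuits (reorient A M)" "supp X \<subseteq> supp Y" for X Y
  proof -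
    obtain X' where X': "X' \<in> circuits M" "X = ?f X'" using XY(1) by (auto simp: circuits_reorient)
    obtain Y' where Y': "Y' \<in> circuits M" "Y = ?f Y'" using XY(2) by (auto simp: circuits_reorient)
    have "supp X' \<subseteq> supp Y'" using XY(3) X'(2) Y'(2) by simp
    from circuit_incomparable[OF X'(1) Y'(1) this] show ?thesis using X'(2) Y'(2) by (auto simp only: flip_opposite)
  qed
  show "\<exists>Z\<in>circuits (reorient A M). Z e = 0 \<and> (\<forall>f. Z f \<noteq> 0 \<longrightarrow> Z f = X f \<or> Z f = Y f)"
    if XY: "X \<in> circuits (reorient A M)" "Y \<in> circuits (reorient A M)" "X \<noteq> opposite Y" "X e = 1" "Y e = -1" for X Y e
  proof -
    obtain X' where X': "X' \<in> circuits M" "X = ?f X'" using XY(1) by (auto simp: circuits_reorient)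
    obtain Y' where Y': "Y' \<in> circuits M" "Y = ?f Y'" using XY(2) by (auto simp: circuits_reorient)
    have ne: "X' \<noteq> opposite Y'" using XY(3) X'(2) Y'(2) by (auto simp only: flip_opposite)
    have "X' e \<noteq> 0" "Y' e = - X' e"
      using XY(4,5) X'(2) Y'(2) flip_sign_cases[of A e] by auto
    from circuit_elim[OF X'(1) Y'(1) ne this] obtain Z where
      Z: "Z \<in> circuits M" "Z e = 0" "\<And>f. Z f \<noteq> 0 \<Longrightarrow> Z f = X' f \<or> Z f = Y' f" by blast
    have fZ: "?f Z \<in> circuits (reorient A M)" using Z(1) by (simp add: circuits_reorient)
    have "?f Z f = X f \<or> ?f Z f = Y f" if "?f Z f \<noteq> 0" for f
      using Z(3)[of f] that X'(2) Y'(2) by auto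
    moreover have "?f Z e = 0" using Z(2) by simp
    ultimately show ?thesis by (intro bexI[OF _ fZ] conjI allI impI)
  qed
qed

lemma indep_reorient [simp]: "indep (reorient A M) S \<longleftrightarrow> indep M S"
  by (simp add: indep_def circuits_reorient)

lemma basis_reorient [simp]: "is_basis (reorient A M) B \<longleftrightarrow> is_basis M B"
  by (simp add: is_basis_def)

text \<open>The factor \<open>flip_sign A e\<close> restores the value 1 at \<open>e\<close>, which
  reorienting \<open>e\<close> would destroy.\<close>

lemma fund_circuit_reorient:
  assumes B: "is_basis M B" and e: "e \<in> E - B"
  shows "fund_circuit (reorient A M) B e f = flip_sign A e * flip_sign A f * fc B e f"
proof -
  interpret R: om "reorient A M" by (rule om_reorient)
  have B': "is_basis (reorient A M) B" and e': "e \<in> R.E - B" using B e by simp_all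
  let ?X = "\<lambda>f. flip_sign A f * fc B e f"
  have X: "?X \<in> circuits (reorient A M)"
    using fund_circuit_circuit[OF B e] by (simp add: circuits_reorient)
  have "supp ?X \<subseteq> insert e B" using fund_circuit_supp[OF B e] by simp
  from R.circuit_eq_fund(2)[OF B' e' X this, of f]
  have "flip_sign A f * fc B e f = flip_sign A e * fund_circuit (reorient A M) B e f"
    by (simp add: fund_circuit_self[OF B e])
  then show ?thesis by (simp add: mult.assoc)
qed

lemma fund_cocircuit_reorient:
  assumes B: "is_basis M B" and b: "b \<in> B"
  shows "fund_cocircuit (reorient A M) B b f = flip_sign A b * flip_sign A f * fund_cocircuit M B b f"
proof -
  interpret R: om "reorient A M" by (rule om_reorient)
  have B': "is_basis (reorient A M) B" using B by simp
  consider "f = b" | "f \<in> E - B" | "f \<noteq> b" "f \<notin> E - B" by blast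
  then show ?thesis
  proof cases
    case 1
    then show ?thesis using fund_cocircuit_self[OF B b] R.fund_cocircuit_self[OF B' b] by simp
  next
    case 2
    then show ?thesis
      using fund_cocircuit_outside[OF B b 2] R.fund_cocircuit_outside[OF B' b, of f] fund_circuit_reorient[OF B 2]
      by simp
  next
    case 3
    then have "fund_cocircuit M B b f = 0" "fund_cocircuit (reorient A M) B b f = 0"
      using fund_cocircuit_in[OF B b, of f] R.fund_cocircuit_in[OF B' b, of f] by auto
    then show ?thesis by simp
  qed
qed

section \<open>Minors\<close>

lemma om_restrict_om: "F \<subseteq> E \<Longrightarrow> om (om_restrict M F)"
  unfolding om_def
proof (rule oriented_matroidI)
  assume F: "F \<subseteq> E"
  show "finite (ground (om_restrict M F))"
    using F finite_ground by (simp add: om_restrict_def finite_subset)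
  show "signed_subset (ground (om_restrict M F)) X" if "X \<in> circuits (om_restrict M F)" for X
    using that circuit_signed by (auto simp: om_restrict_def signed_subset_def)
  show "\<exists>Z\<in>circuits (om_restrict M F). Z e = 0 \<and> (\<forall>f. Z f \<noteq> 0 \<longrightarrow> Z f = X f \<or> Z f = Y f)"
    if XY: "X \<in> circuits (om_restrict M F)" "Y \<in> circuits (om_restrict M F)" "X \<noteq> opposite Y" "X e = 1" "Y e = -1" for X Y e
  proof -
    have X: "X \<in> circuits M" "supp X \<subseteq> F" and Y: "Y \<in> circuits M" "supp Y \<subseteq> F"
      using XY by (simp_all add: om_restrict_def)
    obtain Z where Z: "Z \<in> circuits M" "Z e = 0" "\<And>f. Z f \<noteq> 0 \<Longrightarrow> Z f = X f \<or> Z f = Y f"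
      using circuit_elim[OF X(1) Y(1) XY(3), of e] XY(4,5) by auto
    have "supp Z \<subseteq> supp X \<union> supp Y"
    proof
      fix f assume "f \<in> supp Z"
      then show "f \<in> supp X \<union> supp Y" using Z(3)[of f] by auto
    qed
    then have "Z \<in> circuits (om_restrict M F)" using X Y Z(1) by (auto simp: om_restrict_def)
    then show ?thesis using Z by blast
  qed
qed (use circuit_nonempty circuit_opposite circuit_incomparable in \<open>simp_all add: om_restrict_def\<close>)

end

lemma ground_restrict [simp]: "ground (om_restrict M F) = F"
  by (simp add: om_restrict_def)

lemma ground_contract [simp]: "ground (om_contract M F) = ground M - F"
  by (simp add: om_contract_def Let_def)

lemma circuits_restrict: "circuits (om_restrict M F) = {X \<in> circuits M. supp X \<subseteq> F}"
  by (simp add: om_restrict_def)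

lemma supp_sdelete [simp]: "supp (sdelete F X) = supp X - F"
  by (auto simp: sdelete_def split: if_splits)

lemma sdelete_apply: "e \<notin> F \<Longrightarrow> sdelete F X e = X e"
  by (simp add: sdelete_def)

lemma orthogonal_sdelete: "supp D \<inter> F = {} \<Longrightarrow> orthogonal D X \<Longrightarrow> orthogonal D (sdelete F X)"
proof -
  assume D: "supp D \<inter> F = {}" and o: "orthogonal D X"
  have s: "supp D \<inter> supp (sdelete F X) = supp D \<inter> supp X" using D by auto
  have "sdelete F X e = X e" if "e \<in> supp D \<inter> supp X" for e
    using that D by (auto simp: sdelete_def)
  then show ?thesis using o unfolding orthogonal_def s by (metis (no_types, lifting))
qed

section \<open>Contraction as the dual of deletion, and minors of a basis\<close>

definition traces :: "'a omatroid \<Rightarrow> 'a set \<Rightarrow> 'a signed set" where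
  "traces M F = {Y \<in> sdelete F ` circuits M. supp Y \<noteq> {}}"

lemma traceI:
  assumes "X \<in> circuits M" "sdelete F X e \<noteq> 0"
  shows "sdelete F X \<in> traces M F"
proof -
  have "e \<in> supp (sdelete F X)" using assms(2) by (simp only: supp_iff not_False_eq_True)
  then show ?thesis using assms(1) unfolding traces_def by blast
qed

lemma circuits_contract:
  "circuits (om_contract M F) = {Y \<in> traces M F. \<forall>Z\<in>traces M F. supp Z \<subseteq> supp Y \<longrightarrow> supp Z = supp Y}"
  by (simp add: om_contract_def traces_def Let_def)

context om
begin

lemma circuit_contract_within:
  assumes "Y \<in> traces M F"
  shows "\<exists>Z\<in>circuits (om_contract M F). supp Z \<subseteq> supp Y"
  using assms
proof (induction "card (supp Y)" arbitrary: Y rule: less_induct)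
  case less
  show ?case
  proof (cases "Y \<in> circuits (om_contract M F)")
    case False
    then obtain Z where Z: "Z \<in> traces M F" "supp Z \<subset> supp Y"
      using less.prems by (auto simp: circuits_contract)
    obtain X where "X \<in> circuits M" "Y = sdelete F X" using less.prems by (auto simp: traces_def)
    then have "supp Y \<subseteq> E" using circuit_ground[of X] by auto
    then have "card (supp Z) < card (supp Y)" using Z(2) finite_ground by (meson finite_subset psubset_card_mono)
    from less.hyps[OF this Z(1)] show ?thesis using Z(2) by blast
  qed blast
qed

text \<open>Traces are orthogonal to cocircuits avoiding \<open>F\<close>, so each of them contains
  the support of a cocircuit of the deletion of the dual; conversely each such cocircuit is a trace.
  The minimal traces are therefore exactly these cocircuits.\<close>

lemma contract_eq_dual:
  assumes F: "F \<subseteq> E"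
  shows "om_contract M F = dual (om_restrict (dual M) (E - F))"
proof -
  let ?N = "om_restrict (dual M) (E - F)"
  interpret D: om "dual M" by (rule om_dual)
  interpret N: om ?N by (rule D.om_restrict_om) simp
  have Ncirc: "circuits ?N = {D \<in> cocircuits M. supp D \<subseteq> E - F}" by (simp add: circuits_restrict)
  have orth: "orthogonal D Y" if Y: "Y \<in> traces M F" and D: "D \<in> circuits ?N" for Y D
  proof -
    obtain X where X: "X \<in> circuits M" "Y = sdelete F X" using Y unfolding traces_def by blast
    have "orthogonal D X" using orthogonal_cocircuit[OF X(1), of D] D orthogonal_sym[of X D] by (simp add: Ncirc)
    moreover have "supp D \<inter> F = {}" using D by (auto simp: Ncirc)
    ultimately show ?thesis using X(2) orthogonal_sdelete by blast
  qed
  have trace_signed: "signed_subset (E - F) Y" if Y: "Y \<in> traces M F" for Y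
  proof -
    obtain X where X: "X \<in> circuits M" "Y = sdelete F X" using Y unfolding traces_def by blast
    have "signed_subset E X" by (rule circuit_signed[OF X(1)])
    then show ?thesis unfolding signed_subset_def X(2) supp_sdelete by (auto simp: sdelete_def)
  qed
  have within: "\<exists>Z\<in>cocircuits ?N. supp Z \<subseteq> supp Y" if Y: "Y \<in> traces M F" for Y
  proof (rule N.cocircuit_within)
    show sub: "supp Y \<subseteq> N.E" using trace_signed[OF Y] by (simp add: signed_subset_def)
    have "supp Y \<noteq> {}" using Y by (simp add: traces_def)
    then obtain y where "y \<in> supp Y" by blast
    then have y: "Y y \<noteq> 0" by simp
    show "\<forall>B. is_basis ?N B \<longrightarrow> supp Y \<inter> B \<noteq> {}"
    proof (intro allI impI)
      fix B assume B: "is_basis ?N B"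
      show "supp Y \<inter> B \<noteq> {}"
        by (rule N.meets_basis[OF B sub, of y]) (use y orthogonal_meets[OF orth[OF Y]] in auto)
    qed
  qed
  have trace: "Y \<in> traces M F" if Y: "Y \<in> cocircuits ?N" for Y
  proof -
    obtain y where y: "Y y \<noteq> 0" using N.cocircuit_nonempty[OF Y] by blast
    obtain S where S: "is_basis ?N S" "y \<in> S" "\<And>e. Y e = Y y * N.cosig S y e"
      using N.cocircuit_cosig[OF Y y] by blast
    have SE: "S \<subseteq> E - F" using N.basis_ground[OF S(1)] by simp
    have "indep ?N S" using S(1) by (rule N.basis_indep)
    then have "indep (dual M) S" unfolding indep_def Ncirc using SE by auto
    \<comment> \<open>Extending \<open>S\<close> to a basis of the whole dual gives a basis
      \<open>B\<close> of \<open>M\<close> whose fundamental circuit at \<open>y\<close> has a trace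
      in the support allowed by \<open>S\<close>; uniqueness of the signature makes \<open>Y\<close>
      a multiple of it.\<close>
    then obtain T where T: "is_basis (dual M) T" "S \<subseteq> T" using D.indep_extend by blast
    define B where "B = E - T"
    have B: "is_basis M B" using T(1) by (simp add: basis_dual B_def)
    have yE: "y \<in> E - B" using S(2) SE T(2) by (auto simp: B_def)
    note Fy = fund_circuit_props[OF B yE]
    have yF: "y \<notin> F" using S(2) SE by blast
    let ?Y = "sdelete F (fc B y)"
    have Yy: "?Y y = 1" using yF Fy(3) by (simp add: sdelete_apply)
    have tr: "?Y \<in> traces M F" by (rule traceI[OF Fy(1), of F y]) (simp add: Yy)
    have "supp (fc B y) \<subseteq> insert y (E - S)"
      using Fy(2) T(2) by (auto simp: B_def)
    then have sub: "supp ?Y \<subseteq> insert y (N.E - S)" by auto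
    have Ye: "Y e = sdelete F (\<lambda>f. Y y * fc B y f) e" for e
    proof -
      have "?Y e = ?Y y * N.cosig S y e"
        by (rule N.cosig_unique[OF S(1,2) _ sub]) (rule orth[OF tr])
      then have "Y e = Y y * ?Y e" unfolding Yy mult_1 using S(3)[of e] by metis
      also have "\<dots> = sdelete F (\<lambda>f. Y y * fc B y f) e" by (simp add: sdelete_def)
      finally show ?thesis .
    qed
    have "(\<lambda>f. Y y * fc B y f) \<in> circuits M"
      using circuit_scale[OF Fy(1)] N.cocircuit_values[OF Y, of y] y by blast
    moreover have Y': "Y = sdelete F (\<lambda>f. Y y * fc B y f)" using Ye by blast
    moreover have "sdelete F (\<lambda>f. Y y * fc B y f) y \<noteq> 0" using y by (simp only: Y'[symmetric] not_False_eq_True)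
    ultimately show ?thesis using traceI by metis
  qed
  have "circuits (om_contract M F) = cocircuits ?N"
  proof
    show "circuits (om_contract M F) \<subseteq> cocircuits ?N"
    proof
      fix Y assume "Y \<in> circuits (om_contract M F)"
      then have Y: "Y \<in> traces M F" and min: "\<And>Z. Z \<in> traces M F \<Longrightarrow> supp Z \<subseteq> supp Y \<Longrightarrow> supp Z = supp Y"
        by (auto simp: circuits_contract)
      obtain Z where Z: "Z \<in> cocircuits ?N" "supp Z \<subseteq> supp Y" using within[OF Y] by blast
      have "supp Z = supp Y" by (rule min[OF trace[OF Z(1)] Z(2)])
      then have "underlying_cocircuit ?N (supp Y)" using Z(1) by (simp add: cocircuits_def[of ?N])
      then show "Y \<in> cocircuits ?N"
        using trace_signed[OF Y] orth[OF Y] by (simp add: cocircuits_def[of ?N])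
    qed
    show "cocircuits ?N \<subseteq> circuits (om_contract M F)"
    proof
      fix Y assume Y: "Y \<in> cocircuits ?N"
      have "supp Z = supp Y" if Z: "Z \<in> traces M F" "supp Z \<subseteq> supp Y" for Z
      proof -
        obtain W where W: "W \<in> cocircuits ?N" "supp W \<subseteq> supp Z" using within[OF Z(1)] by blast
        have "W = Y \<or> W = opposite Y"
          by (rule N.cocircuit_incomparable[OF W(1) Y]) (use W(2) Z(2) in blast)
        then have "supp W = supp Y" by auto
        then show ?thesis using W(2) Z(2) by blast
      qed
      then show "Y \<in> circuits (om_contract M F)" using trace[OF Y] by (simp add: circuits_contract)
    qed
  qed
  then show ?thesis by (intro omatroid.equality) (simp_all add: dual_def[of ?N])
qed

lemma om_contract_om: "F \<subseteq> E \<Longrightarrow> om (om_contract M F)"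
  using om.om_dual[OF om.om_restrict_om[OF om_dual]] contract_eq_dual by simp

lemma dual_contract: "F \<subseteq> E \<Longrightarrow> dual (om_contract M F) = om_restrict (dual M) (E - F)"
  using om.dual_dual[OF om.om_restrict_om[OF om_dual]] contract_eq_dual by simp

lemma dual_restrict: "F \<subseteq> E \<Longrightarrow> dual (om_restrict M F) = om_contract (dual M) (E - F)"
  using om.contract_eq_dual[OF om_dual, of "E - F"] by (simp add: double_diff)

lemma restrict_contract:
  assumes "F \<subseteq> G" "G \<subseteq> E"
  shows "om_restrict (om_contract M F) (G - F) = om_contract (om_restrict M G) F"
proof (rule omatroid.equality)
  have tr: "traces (om_restrict M G) F = {Y \<in> traces M F. supp Y \<subseteq> G - F}"
  proof -
    have "supp X \<subseteq> G \<longleftrightarrow> supp (sdelete F X) \<subseteq> G - F" for X using assms(1) by auto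
    then show ?thesis by (auto simp: traces_def circuits_restrict simp del: supp_sdelete)
  qed
  show "circuits (om_restrict (om_contract M F) (G - F)) = circuits (om_contract (om_restrict M G) F)"
    unfolding circuits_restrict circuits_contract tr by blast
qed simp_all

lemma om_minor: "F \<subseteq> G \<Longrightarrow> G \<subseteq> E \<Longrightarrow> om (om_contract (om_restrict M G) F)"
  using om.om_contract_om[OF om_restrict_om] by simp

lemma dual_minor:
  assumes "F \<subseteq> G" "G \<subseteq> E"
  shows "dual (om_contract (om_restrict M G) F) = om_contract (om_restrict (dual M) (E - F)) (E - G)"
proof -
  have "dual (om_contract (om_restrict M G) F) = om_restrict (om_contract (dual M) (E - G)) (G - F)"
    using om.dual_contract[OF om_restrict_om[OF assms(2)]] assms dual_restrict by simp
  also have "G - F = (E - F) - (E - G)" using assms by blast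
  also have "om_restrict (om_contract (dual M) (E - G)) ((E - F) - (E - G)) =
      om_contract (om_restrict (dual M) (E - F)) (E - G)"
    by (rule om.restrict_contract[OF om_dual]) (use assms in auto)
  finally show ?thesis .
qed

text \<open>Closure of \<open>F\<close> and \<open>G\<close> under fundamental circuits makes
  \<open>B\<close> compatible with the minor: traces of fundamental circuits provide the
  dependencies, and orthogonality to fundamental cocircuits of \<open>M\<close> provides
  independence and the signs.\<close>

lemma minor_basis:
  assumes B: "is_basis M B" and FG: "F \<subseteq> G" "G \<subseteq> E"
    and F: "\<And>e. e \<in> F - B \<Longrightarrow> supp (fc B e) \<subseteq> F"
    and G: "\<And>e. e \<in> G - B \<Longrightarrow> supp (fc B e) \<subseteq> G"
  shows "is_basis (om_contract (om_restrict M G) F) (B \<inter> (G - F))" (is "is_basis ?N ?B")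
    and "\<And>e f. e \<in> G - F - B \<Longrightarrow> f \<in> G - F \<Longrightarrow> fund_circuit (om_contract (om_restrict M G) F) (B \<inter> (G - F)) e f = fc B e f"
proof -
  interpret R: om "om_restrict M G" by (rule om_restrict_om[OF FG(2)])
  interpret N: om ?N by (rule om_minor[OF FG])
  have NE: "N.E = G - F" by simp
  have trace: "\<exists>X\<in>circuits M. supp X \<subseteq> G \<and> Y = sdelete F X" if "Y \<in> circuits ?N" for Y
    using that by (auto simp: circuits_contract traces_def circuits_restrict)
  \<comment> \<open>Closure of \<open>F\<close> read on the cocircuit side: fundamental cocircuits
    of basis elements outside \<open>F\<close> miss \<open>F\<close>, so a circuit and its trace
    have the same elements in common with them.\<close>
  have cos: "cosig B b f = 0" if "b \<in> B" "b \<notin> F" "f \<in> F" for b f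
  proof (rule ccontr)
    assume nz: "cosig B b f \<noteq> 0"
    then have f: "f \<in> E - B" using cosig_support[OF nz] that by auto
    then have "fc B f b \<noteq> 0" using nz cosig_outside[OF that(1) f] by simp
    then show False using F[of f] f that by (auto simp: subset_iff)
  qed
  have ind: "indep ?N ?B"
    unfolding indep_def
  proof (intro conjI ballI notI)
    show "?B \<subseteq> N.E" by auto
  next
    fix Y assume Y: "Y \<in> circuits ?N" "supp Y \<subseteq> ?B"
    obtain X where X: "X \<in> circuits M" "supp X \<subseteq> G" "Y = sdelete F X" using trace[OF Y(1)] by blast
    obtain y where y: "Y y \<noteq> 0" using N.circuit_nonempty[OF Y(1)] by blast
    then have yB: "y \<in> B" "y \<notin> F" using Y(2) by auto
    have Xy: "X y \<noteq> 0" using y X(3) by (auto simp: sdelete_def split: if_splits)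
    have "X f * cosig B y f = X y" if f: "X f \<noteq> 0" "cosig B y f \<noteq> 0" for f
    proof -
      have "f \<notin> F" using cos[OF yB] f(2) by blast
      then have "f \<in> supp Y" using f(1) X(3) by simp
      then have "f \<in> B" using Y(2) by blast
      then have "f = y" using cosig_support[OF f(2)] by blast
      then show ?thesis using cosig_self[of B y] by simp
    qed
    from orthogonal_const[OF cosig_orthogonal[OF B yB(1) X(1)] this]
    show False using Xy cosig_self[of B y] zero_neq_one by metis
  qed
  have dep: "\<exists>Y\<in>circuits ?N. supp Y \<subseteq> insert e ?B" if e: "e \<in> G - F - B" for e
  proof -
    have eE: "e \<in> E - B" using e FG by blast
    note Fe = fund_circuit_props[OF B eE]
    have "fc B e \<in> circuits (om_restrict M G)" using Fe(1) G[of e] e by (simp add: circuits_restrict)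
    moreover have ee: "sdelete F (fc B e) e \<noteq> 0" using Fe(3) e by (simp add: sdelete_apply)
    ultimately have "sdelete F (fc B e) \<in> traces (om_restrict M G) F" by (rule traceI)
    from R.circuit_contract_within[OF this]
    obtain Y where Y: "Y \<in> circuits ?N" "supp Y \<subseteq> supp (fc B e) - F" by auto
    then have "supp Y \<subseteq> insert e ?B" using Fe(2) G[of e] e by blast
    then show ?thesis using Y(1) by blast
  qed
  show basis: "is_basis ?N ?B"
    unfolding is_basis_def
  proof (intro conjI allI impI)
    show "indep ?N ?B" by (rule ind)
    fix S assume S: "indep ?N S \<and> ?B \<subseteq> S"
    have "S \<subseteq> G - F" using S by (simp add: indep_def)
    moreover have "e \<notin> S" if "e \<in> G - F - B" for e
    proof
      assume "e \<in> S"
      then have "insert e ?B \<subseteq> S" using S by blast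
      then show False using dep[OF that] S unfolding indep_def by blast
    qed
    ultimately show "S = ?B" using S by blast
  qed
  show "fund_circuit ?N ?B e f = fc B e f" if e: "e \<in> G - F - B" and f: "f \<in> G - F" for e f
  proof -
    have eE: "e \<in> E - B" using e FG by blast
    have eN: "e \<in> N.E - ?B" using e by auto
    note Fe = fund_circuit_props[OF B eE] and FN = N.fund_circuit_props[OF basis eN]
    obtain X where X: "X \<in> circuits M" "supp X \<subseteq> G" "fund_circuit ?N ?B e = sdelete F X"
      using trace[OF FN(1)] by blast
    have Xe: "X e = 1" using FN(3) X(3) e by (simp add: sdelete_apply)
    have Xf: "X f = fund_circuit ?N ?B e f" if "f \<notin> F" for f using X(3) that by (simp add: sdelete_apply)
    consider "f = e" | "f \<noteq> e" "f \<notin> B" | "f \<in> B" by blast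
    then show ?thesis
    proof cases
      case 1
      then show ?thesis using FN(3) Fe(3) by simp
    next
      case 2
      have "fund_circuit ?N ?B e f = 0" using N.fund_circuit_in[OF basis eN, of f] 2 by blast
      moreover have "fc B e f = 0" using fund_circuit_in[OF B eE, of f] 2 by blast
      ultimately show ?thesis by simp
    next
      case 3
      then have fF: "f \<notin> F" "f \<noteq> e" using f e by auto
      \<comment> \<open>The lift \<open>X\<close> of the circuit of the minor may contain elements
        of \<open>F\<close> outside \<open>B\<close>, but the fundamental cocircuit of
        \<open>f\<close> avoids them, leaving only \<open>e\<close> and \<open>f\<close> in
        common.\<close>
      have "X e * cosig B f e = - (X f * cosig B f f)"
      proof (rule orthogonal_two[OF cosig_orthogonal[OF B 3 X(1)]])
        fix g assume g: "X g \<noteq> 0" "cosig B f g \<noteq> 0"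
        have "g \<notin> F" using cos[OF 3 fF(1)] g(2) by blast
        then have "fund_circuit ?N ?B e g \<noteq> 0" using g(1) Xf by simp
        then have "g = e \<or> g \<in> B" using N.fund_circuit_in[OF basis eN, of g] by blast
        then show "g = e \<or> g = f" using cosig_support[OF g(2)] by blast
      qed (use fF in simp)
      then have "X f = fc B e f" using Xe cosig_self[of B f] cosig_outside[OF 3 eE] by simp
      then show ?thesis using Xf[OF fF(1)] by simp
    qed
  qed
qed

end

section \<open>Uniqueness of the fully optimal basis\<close>

locale ordered_om = om M for M :: "'a::linorder omatroid"
begin

lemma finite_supp_circuit: "C \<in> circuits M \<Longrightarrow> finite (supp C)"
  using circuit_ground by (intro finite_subset[OF _ finite_ground]) auto

lemma Min_fund_circuit:
  assumes B: "is_basis M B" and e: "e \<in> E - B"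
    and opt: "fc B e e = - fc B e (Min (supp (fc B e)))"
  shows "Min (supp (fc B e)) \<in> B" "fc B e (Min (supp (fc B e))) = -1" "Min (supp (fc B e)) < e"
    "fc B e f \<noteq> 0 \<Longrightarrow> Min (supp (fc B e)) \<le> f"
proof -
  note Fe = fund_circuit_props[OF B e]
  let ?m = "Min (supp (fc B e))"
  have fin: "finite (supp (fc B e))" by (rule finite_supp_circuit[OF Fe(1)])
  have es: "e \<in> supp (fc B e)" using Fe(3) by simp
  show le: "fc B e f \<noteq> 0 \<Longrightarrow> ?m \<le> f" for f using fin by simp
  show m: "fc B e ?m = -1" using opt Fe(3) by simp
  then have "?m \<noteq> e" using Fe(3) by auto
  moreover have "?m \<le> e" using fin es by simp
  ultimately show "?m < e" by simp
  show "?m \<in> B" using fund_circuit_in[OF B e, of ?m] m \<open>?m \<noteq> e\<close> by simp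
qed

text \<open>Let \<open>b\<close> be the smallest element of \<open>B\<close> whose fundamental cocircuit meets \<open>C\<close>.
  An element \<open>f \<noteq> b\<close> common to both has \<open>b\<close> as the minimum of its fundamental circuit, so
  the signs of \<open>C\<close> and of that cocircuit are opposite, up to the factor \<open>c\<close>, at all common
  elements except \<open>b\<close>; orthogonality then determines the sign of \<open>C\<close> at \<open>b\<close>.\<close>

lemma first_meeting:
  assumes B: "is_basis M B" and C: "C \<in> circuits M" and c: "c = 1 \<or> c = -1"
    and opt: "\<And>e. C e \<noteq> 0 \<Longrightarrow> e \<notin> B \<Longrightarrow> fc B e e = - fc B e (Min (supp (fc B e)))"
    and sign: "\<And>e. C e \<noteq> 0 \<Longrightarrow> e \<notin> B \<Longrightarrow> C e = - c"
  shows "\<exists>b. C b = c \<and> (\<forall>e. C e \<noteq> 0 \<longrightarrow> b \<le> e)"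
proof -
  define T where "T = {b \<in> B. \<exists>f. cosig B b f \<noteq> 0 \<and> C f \<noteq> 0}"
  have finT: "finite T"
    using basis_ground[OF B] by (intro finite_subset[OF _ finite_ground]) (auto simp: T_def)
  have inT: "Min (supp (fc B e)) \<in> T" "Min (supp (fc B e)) < e" if e: "C e \<noteq> 0" "e \<notin> B" for e
  proof -
    have eE: "e \<in> E - B" using e circuit_ground[OF C] by blast
    note m = Min_fund_circuit[OF B eE opt[OF e]]
    have "cosig B (Min (supp (fc B e))) e \<noteq> 0" using cosig_outside[OF m(1) eE] m(2) by simp
    then show "Min (supp (fc B e)) \<in> T" using m(1) e(1) by (auto simp: T_def)
    show "Min (supp (fc B e)) < e" by (rule m(3))
  qed
  obtain e where "C e \<noteq> 0" "e \<notin> B" using indep_circuit[OF basis_indep[OF B] C] by blast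
  then have "T \<noteq> {}" using inT by blast
  define b where "b = Min T"
  have b: "b \<in> T" using finT \<open>T \<noteq> {}\<close> by (simp add: b_def)
  have le: "b \<le> b'" if "b' \<in> T" for b' using finT that by (simp add: b_def)
  from b have bB: "b \<in> B" by (simp add: T_def)
  have prod: "C f * cosig B b f = - c" if f: "C f \<noteq> 0" "cosig B b f \<noteq> 0" "f \<noteq> b" for f
  proof -
    have fE: "f \<in> E - B" using cosig_support[OF f(2)] f(3) by blast
    then have fB: "f \<notin> B" by blast
    note m = Min_fund_circuit[OF B fE opt[OF f(1) fB]]
    have bf: "cosig B b f = - fc B f b" by (rule cosig_outside[OF bB fE])
    then have "Min (supp (fc B f)) \<le> b" using f(2) by (intro m(4)) simp
    moreover have "b \<le> Min (supp (fc B f))" by (rule le[OF inT(1)[OF f(1) fB]])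
    ultimately have "Min (supp (fc B f)) = b" by simp
    then show ?thesis using m(2) bf sign[OF f(1) fB] by simp
  qed
  have "C b = c"
  proof (rule ccontr)
    assume "C b \<noteq> c"
    then have "C f * cosig B b f = - c" if "C f \<noteq> 0" "cosig B b f \<noteq> 0" for f
      using prod[OF that] that circuit_values[OF C, of b] c cosig_self[of B b] by (cases "f = b") auto
    from orthogonal_const[OF cosig_orthogonal[OF B bB C] this] show False
      using b by (auto simp: T_def)
  qed
  moreover have "b \<le> e" if e: "C e \<noteq> 0" for e
  proof (cases "e \<in> B")
    case True
    have "cosig B e e \<noteq> 0" by (simp add: cosig_self)
    then have "e \<in> T" using e True unfolding T_def by blast
    then show ?thesis by (rule le)
  next
    case False
    show ?thesis using le[OF inT(1)[OF e False]] inT(2)[OF e False] by simp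
  qed
  ultimately show ?thesis by blast
qed

text \<open>Applied to \<open>B\<close> with sign 1 and to \<open>B'\<close> with sign -1,
  \<open>first_meeting\<close> determines the sign of the smallest element of \<open>C\<close> in
  two incompatible ways.\<close>

lemma no_separating_circuit:
  assumes B: "is_basis M B" "is_basis M B'" and C: "C \<in> circuits M" and sub: "supp C \<subseteq> B \<union> B'"
    and sign: "\<And>f. C f \<noteq> 0 \<Longrightarrow> f \<in> B - B' \<Longrightarrow> C f = 1" "\<And>f. C f \<noteq> 0 \<Longrightarrow> f \<in> B' - B \<Longrightarrow> C f = -1"
    and opt: "\<And>e. C e \<noteq> 0 \<Longrightarrow> e \<notin> B \<Longrightarrow> fc B e e = - fc B e (Min (supp (fc B e)))"
    and opt': "\<And>e. C e \<noteq> 0 \<Longrightarrow> e \<notin> B' \<Longrightarrow> fc B' e e = - fc B' e (Min (supp (fc B' e)))"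
  shows False
proof -
  have sub': "f \<in> B \<or> f \<in> B'" if "C f \<noteq> 0" for f using that sub by (auto simp: subset_iff)
  have "C e = - 1" if "C e \<noteq> 0" "e \<notin> B" for e using sub'[OF that(1)] sign(2)[OF that(1)] that(2) by blast
  with first_meeting[OF B(1) C, of 1] opt obtain b where b: "C b = 1" "\<forall>e. C e \<noteq> 0 \<longrightarrow> b \<le> e" by auto
  have "C e = - (- 1)" if "C e \<noteq> 0" "e \<notin> B'" for e using sub'[OF that(1)] sign(1)[OF that(1)] that(2) by auto
  with first_meeting[OF B(2) C, of "-1"] opt' obtain b' where b': "C b' = -1" "\<forall>e. C e \<noteq> 0 \<longrightarrow> b' \<le> e" by auto
  have "b = b'" using b b' by (intro antisym) auto
  then show False using b b' by simp
qed

lemma fully_optimal_outside: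
  "fully_optimal M B \<Longrightarrow> e \<in> E - B \<Longrightarrow> fc B e e = - fc B e (Min (supp (fc B e)))"
  by (simp add: fully_optimal_def Let_def)

lemma fully_optimal_inside:
  "fully_optimal M B \<Longrightarrow> b \<in> B \<Longrightarrow> b \<noteq> Min E \<Longrightarrow>
    fund_cocircuit M B b b = - fund_cocircuit M B b (Min (supp (fund_cocircuit M B b)))"
  by (simp add: fully_optimal_def Let_def)

lemma fully_optimal_Min:
  assumes "fully_optimal M B" "E \<noteq> {}"
  shows "Min E \<in> B"
proof (rule ccontr)
  assume "Min E \<notin> B"
  then have e: "Min E \<in> E - B" using assms(2) finite_ground by simp
  have B: "is_basis M B" using assms(1) by (simp add: fully_optimal_def)
  note m = Min_fund_circuit[OF B e fully_optimal_outside[OF assms(1) e]]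
  have "Min (supp (fc B (Min E))) \<in> E" using m(1) basis_ground[OF B] by blast
  then have "Min E \<le> Min (supp (fc B (Min E)))" using finite_ground by simp
  then show False using m(3) by simp
qed

lemma fully_optimal_unique:
  assumes opt: "fully_optimal M B" "fully_optimal M B'"
  shows "B = B'"
proof (rule ccontr)
  assume ne: "B \<noteq> B'"
  have B: "is_basis M B" "is_basis M B'" using opt by (simp_all add: fully_optimal_def)
  have BE: "B \<subseteq> E" "B' \<subseteq> E" using B basis_ground by blast+
  define K where "K = (B - B') \<union> (B' - B)"
  define \<sigma> where "\<sigma> = (\<lambda>e. if e \<in> B then 1 else (-1::int))"
  obtain x where x: "x \<in> K" using ne by (auto simp: K_def)
  have K: "K \<subseteq> E" "B \<inter> B' \<subseteq> E" "K \<inter> (B \<inter> B') = {}" using BE by (auto simp: K_def)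
  have finK: "finite K" using K(1) finite_ground by (rule finite_subset)
  have s: "\<And>f. f \<in> K \<Longrightarrow> \<sigma> f = 1 \<or> \<sigma> f = -1" by (simp add: \<sigma>_def)
  from painting[of K x "B \<inter> B'" \<sigma>, OF finK x K s]
  show False
  proof
    assume "\<exists>C\<in>circuits M. C x \<noteq> 0 \<and> supp C \<subseteq> K \<union> B \<inter> B' \<and> (\<forall>f\<in>K. C f \<noteq> 0 \<longrightarrow> C f = \<sigma> f)"
    then obtain C where C: "C \<in> circuits M" "supp C \<subseteq> K \<union> B \<inter> B'" "\<forall>f\<in>K. C f \<noteq> 0 \<longrightarrow> C f = \<sigma> f" by blast
    show False
    proof (rule no_separating_circuit[OF B C(1)])
      show "supp C \<subseteq> B \<union> B'" using C(2) by (auto simp: K_def)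
    qed (use C(3) fully_optimal_outside[OF opt(1)] fully_optimal_outside[OF opt(2)] circuit_ground[OF C(1)]
        in \<open>auto simp: K_def \<sigma>_def\<close>)
  next
    assume "\<exists>D\<in>cocircuits M. D x \<noteq> 0 \<and> supp D \<inter> (B \<inter> B') = {} \<and> (\<forall>f\<in>K. D f \<noteq> 0 \<longrightarrow> D f = \<sigma> f)"
    then obtain D where D: "D \<in> cocircuits M" "supp D \<inter> (B \<inter> B') = {}" "\<forall>f\<in>K. D f \<noteq> 0 \<longrightarrow> D f = \<sigma> f" by blast
    have DE: "e \<in> E" if "D e \<noteq> 0" for e
      using cocircuit_signed[OF D(1)] that by (auto simp: signed_subset_def subset_iff)
    have "E \<noteq> {}" using x K(1) by blast
    \<comment> \<open>There is no inside condition for \<open>Min E\<close>. As it lies in both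
      bases, \<open>D\<close> vanishes on it, so the condition is available wherever it is
      invoked.\<close>
    then have p: "Min E \<in> B" "Min E \<in> B'" using opt fully_optimal_Min by blast+
    then have Dp: "D (Min E) = 0" using D(2) by auto
    interpret D: ordered_om "dual M" by (simp add: ordered_om_def om_dual)
    \<comment> \<open>Complements exchange the roles: \<open>B - B'\<close>, where \<open>D\<close>
      is positive, equals \<open>(E - B') - (E - B)\<close>, so \<open>E - B'\<close> comes
      first.\<close>
    have B_dual: "is_basis (dual M) (E - B')" "is_basis (dual M) (E - B)"
      using B basis_dual_compl BE by blast+
    show False
    proof (rule D.no_separating_circuit[OF B_dual])
      show "D \<in> circuits (dual M)" using D(1) by simp
      show "supp D \<subseteq> (E - B') \<union> (E - B)" using D(2) DE by auto
      show "D f = 1" if "D f \<noteq> 0" "f \<in> E - B' - (E - B)" for f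
        using that D(3) by (auto simp: K_def \<sigma>_def)
      show "D f = -1" if "D f \<noteq> 0" "f \<in> E - B - (E - B')" for f
        using that D(3) by (auto simp: K_def \<sigma>_def)
      show "D.fc (E - B') e e = - D.fc (E - B') e (Min (supp (D.fc (E - B') e)))"
        if e: "D e \<noteq> 0" "e \<notin> E - B'" for e
        unfolding fund_circuit_dual using DE[OF e(1)] e Dp by (intro fully_optimal_inside[OF opt(2)]) auto
      show "D.fc (E - B) e e = - D.fc (E - B) e (Min (supp (D.fc (E - B) e)))"
        if e: "D e \<noteq> 0" "e \<notin> E - B" for e
        unfolding fund_circuit_dual using DE[OF e(1)] e Dp by (intro fully_optimal_inside[OF opt(1)]) auto
    qed
  qed
qed

lemma alpha_bounded_eq: "fully_optimal M B \<Longrightarrow> alpha_bounded M = B"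
  unfolding alpha_bounded_def by (rule the_equality) (simp_all add: fully_optimal_unique)

section \<open>The partition into basis intervals\<close>

lemma finite_supp_cocircuit: "D \<in> cocircuits M \<Longrightarrow> finite (supp D)"
  using cocircuit_signed by (intro finite_subset[OF _ finite_ground]) (auto simp: signed_subset_def)

lemma Ext_act_iff:
  assumes B: "is_basis M B" and e: "e \<in> E - B"
  shows "e \<in> Ext_act M B \<longleftrightarrow> (\<forall>f. fc B e f \<noteq> 0 \<longrightarrow> e \<le> f)"
proof -
  note Fe = fund_circuit_props[OF B e]
  have "e \<in> supp (fc B e)" "finite (supp (fc B e))" using Fe finite_supp_circuit by auto
  then have "e = Min (supp (fc B e)) \<longleftrightarrow> (\<forall>f\<in>supp (fc B e). e \<le> f)"
    using Min_eq_iff[of "supp (fc B e)" e] by (metis empty_iff)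
  then show ?thesis using e by (simp add: Ext_act_def Ball_def)
qed

lemma Int_act_iff:
  assumes B: "is_basis M B" and b: "b \<in> B"
  shows "b \<in> Int_act M B \<longleftrightarrow> (\<forall>f. fund_cocircuit M B b f \<noteq> 0 \<longrightarrow> b \<le> f)"
proof -
  let ?D = "fund_cocircuit M B b"
  have "b \<in> supp ?D" "finite (supp ?D)"
    using fund_cocircuit_self[OF B b] fund_cocircuit_cocircuit[OF B b] finite_supp_cocircuit by auto
  then have "b = Min (supp ?D) \<longleftrightarrow> (\<forall>f\<in>supp ?D. b \<le> f)"
    using Min_eq_iff[of "supp ?D" b] by (metis empty_iff)
  then show ?thesis using b by (simp add: Int_act_def Ball_def)
qed

lemma Int_act_iff':
  assumes B: "is_basis M B" and b: "b \<in> B"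
  shows "b \<in> Int_act M B \<longleftrightarrow> (\<forall>e\<in>E - B. fc B e b \<noteq> 0 \<longrightarrow> b \<le> e)"
  unfolding Int_act_iff[OF B b]
  using fund_cocircuit_outside[OF B b] fund_cocircuit_in[OF B b] by (metis neg_equal_0_iff_equal order_refl)

text \<open>The interval of \<open>B\<close> contains \<open>X\<close> if and only if \<open>B\<close> is produced by the greedy
  algorithm that first scans \<open>X\<close> downwards and then the complement of \<open>X\<close> upwards.\<close>

definition scan_before :: "'a set \<Rightarrow> 'a \<Rightarrow> 'a \<Rightarrow> bool" where
  "scan_before X c e \<longleftrightarrow> (if e \<in> X then c \<in> X \<and> e < c else c \<in> X \<or> c < e)"

text \<open>For \<open>c\<close> in the fundamental circuit of \<open>e\<close>, activity of
  \<open>e\<close> in \<open>X\<close> gives \<open>e \<le> c\<close>, and activity of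
  \<open>c\<close> outside \<open>X\<close> gives \<open>c \<le> e\<close>. Both at once are
  impossible for distinct elements, which is why \<open>e\<close> in \<open>X\<close> also forces
  \<open>c\<close> in \<open>X\<close>.\<close>

lemma interval_iff_scan:
  assumes B: "is_basis M B" and X: "X \<subseteq> E"
  shows "X \<in> basis_interval M B \<longleftrightarrow>
    (\<forall>e\<in>E - B. \<forall>c\<in>B. fc B e c \<noteq> 0 \<longrightarrow> scan_before X c e)" (is "?L \<longleftrightarrow> ?R")
proof
  assume L: ?L
  show ?R
  proof (intro ballI impI)
    fix e c assume e: "e \<in> E - B" and c: "c \<in> B" and nz: "fc B e c \<noteq> 0"
    have ne: "c \<noteq> e" using e c by blast
    have 1: "c \<in> Int_act M B" if "c \<notin> X" using L c that by (auto simp: basis_interval_def)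
    have 2: "e \<in> Ext_act M B" if "e \<in> X" using L e that by (auto simp: basis_interval_def)
    have "e \<le> c" if "e \<in> X" using 2[OF that] nz by (simp add: Ext_act_iff[OF B e])
    moreover have "c \<le> e" if "c \<notin> X" using 1[OF that] nz e by (simp add: Int_act_iff'[OF B c])
    ultimately show "scan_before X c e" using ne unfolding scan_before_def by force
  qed
next
  assume R: ?R
  have "b \<in> X" if b: "b \<in> B" "b \<notin> Int_act M B" for b
  proof (rule ccontr)
    assume "b \<notin> X"
    then have "b \<le> e" if "e \<in> E - B" "fc B e b \<noteq> 0" for e
      using R b(1) that unfolding scan_before_def by (meson less_imp_le)
    then show False using b Int_act_iff'[OF B b(1)] by blast
  qed
  moreover have "e \<in> Ext_act M B" if e: "e \<in> X" "e \<notin> B" for e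
  proof -
    have eE: "e \<in> E - B" using e X by blast
    have "e \<le> f" if f: "fc B e f \<noteq> 0" for f
    proof (cases "f = e")
      case False
      then have "f \<in> B" using fund_circuit_in[OF B eE f] by blast
      then show ?thesis using R eE f e(1) unfolding scan_before_def by (meson less_imp_le)
    qed simp
    then show ?thesis using Ext_act_iff[OF B eE] by blast
  qed
  ultimately show ?L by (auto simp: basis_interval_def)
qed

text \<open>Let \<open>e\<close> be the element of the symmetric difference scanned earliest. In the
  basis without \<open>e\<close>, all other elements of its fundamental circuit are scanned before
  \<open>e\<close>, so they belong to both bases; the other basis would contain this
  circuit.\<close>

lemma interval_unique:
  assumes B: "is_basis M B" "is_basis M B'" and X: "X \<subseteq> E"
    and I: "X \<in> basis_interval M B" "X \<in> basis_interval M B'"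
  shows "B = B'"
proof (rule ccontr)
  assume ne: "B \<noteq> B'"
  define K where "K = (B - B') \<union> (B' - B)"
  have KE: "K \<subseteq> E" using basis_ground[OF B(1)] basis_ground[OF B(2)] by (auto simp: K_def)
  then have fin: "finite K" using finite_ground by (rule finite_subset)
  \<comment> \<open>The earliest element is the largest one in \<open>X\<close> if there is any, and
    otherwise the smallest one.\<close>
  have "\<exists>e\<in>K. \<forall>c\<in>K. \<not> scan_before X c e"
  proof (cases "K \<inter> X = {}")
    case True
    have "K \<noteq> {}" using ne by (auto simp: K_def)
    then have "Min K \<in> K" "\<forall>c\<in>K. Min K \<le> c" using fin by auto
    then show ?thesis using True by (intro bexI[of _ "Min K"]) (auto simp: scan_before_def)
  next
    case False
    then have "Max (K \<inter> X) \<in> K \<inter> X" using fin by (intro Max_in) auto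
    moreover have "\<forall>c\<in>K \<inter> X. c \<le> Max (K \<inter> X)" using fin by simp
    ultimately have "Max (K \<inter> X) \<in> K" "Max (K \<inter> X) \<in> X" "\<forall>c\<in>K. c \<in> X \<longrightarrow> c \<le> Max (K \<inter> X)" by blast+
    then show ?thesis by (intro bexI[of _ "Max (K \<inter> X)"]) (auto simp: scan_before_def)
  qed
  then obtain e where e: "e \<in> K" "\<And>c. c \<in> K \<Longrightarrow> \<not> scan_before X c e" by blast
  have contra: False if B: "is_basis M B1" "is_basis M B2" and I: "X \<in> basis_interval M B1"
    and e1: "e \<in> B2 - B1" and K: "K = (B1 - B2) \<union> (B2 - B1)" for B1 B2
  proof -
    have eE: "e \<in> E - B1" using e1 basis_ground[OF B(2)] by blast
    have "supp (fc B1 e) \<subseteq> B2"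
    proof
      fix c assume "c \<in> supp (fc B1 e)"
      then have nz: "fc B1 e c \<noteq> 0" by simp
      show "c \<in> B2"
      proof (cases "c = e")
        case False
        then have c: "c \<in> B1" using fund_circuit_in[OF B(1) eE nz] by blast
        then have "scan_before X c e" using interval_iff_scan[OF B(1) X] I eE nz by blast
        then show ?thesis using e(2) c K by blast
      qed (use e1 in blast)
    qed
    then show False using basis_indep[OF B(2)] fund_circuit_circuit[OF B(1) eE] by (simp add: indep_def)
  qed
  show False
  proof (cases "e \<in> B")
    case True
    then show False using contra[OF B(2,1) I(2)] e(1) by (auto simp: K_def)
  next
    case False
    then show False using contra[OF B I(1)] e(1) by (auto simp: K_def)
  qed
qed

lemma interval_exists:
  assumes X: "X \<subseteq> E"
  shows "\<exists>B. is_basis M B \<and> X \<in> basis_interval M B"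
proof -
  \<comment> \<open>The weight is the rank in the scan. A basis of minimum total weight admits no
    improving exchange, which is the scan condition.\<close>
  define w where "w = (\<lambda>e. card {c \<in> E. scan_before X c e})"
  have finB: "finite B" if "is_basis M B" for B using basis_ground[OF that] finite_ground by (rule finite_subset)
  obtain B where B: "is_basis M B" and min: "\<And>B'. is_basis M B' \<Longrightarrow> sum w B \<le> sum w B'"
    using ex_basis arg_min_nat_lemma[of "is_basis M" _ "sum w"] by metis
  have "scan_before X c e" if e: "e \<in> E - B" and c: "c \<in> B" and nz: "fc B e c \<noteq> 0" for e c
  proof (rule ccontr)
    assume ns: "\<not> scan_before X c e"
    have ce: "c \<noteq> e" "c \<in> E" using e c basis_ground[OF B] by auto
    then have ec: "scan_before X e c" using ns by (auto simp: scan_before_def split: if_splits)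
    have "{f \<in> E. scan_before X f e} \<subset> {f \<in> E. scan_before X f c}"
      using ec e ce(2) by (auto simp: scan_before_def split: if_splits)
    then have "w e < w c" unfolding w_def using finite_ground by (intro psubset_card_mono) auto
    moreover have "sum w B = w c + sum w (B - {c})" using c finB[OF B] by (simp add: sum.remove)
    moreover have "sum w (insert e (B - {c})) = w e + sum w (B - {c})" using e finB[OF B] by simp
    ultimately have "sum w (insert e (B - {c})) < sum w B" by simp
    then show False using min[OF basis_exchange[OF B e c nz]] by simp
  qed
  then show ?thesis using interval_iff_scan[OF B X] B by blast
qed

lemma interval_basis_props:
  assumes "X \<subseteq> E"
  shows "is_basis M (interval_basis M X)" "X \<in> basis_interval M (interval_basis M X)"
proof -
  have "\<exists>!B. is_basis M B \<and> X \<in> basis_interval M B"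
    using interval_exists[OF assms] interval_unique[OF _ _ assms] by blast
  from theI'[OF this] show "is_basis M (interval_basis M X)" "X \<in> basis_interval M (interval_basis M X)"
    unfolding interval_basis_def by auto
qed

end

section \<open>Decomposition of a basis and the active filtration\<close>

lemma UN_shift: "(\<Union>k\<in>{1..n::nat}. f k) = (\<Union>k\<in>{..<n}. f (Suc k))"
proof -
  have "{1..n} = Suc ` {..<n}" by (simp add: image_Suc_lessThan)
  then show ?thesis by (metis image_image)
qed

text \<open>The hypotheses describe the outcome of the single pass: \<open>prt\<close> is the map Part and \<open>I\<close> is
  the set of internal elements. They are invariant under duality, with \<open>B\<close> and \<open>I\<close> replaced by
  their complements.\<close>

locale decomposed_basis = ordered_om M for M :: "'a::linorder omatroid" +
  fixes B :: "'a set" and prt :: "'a \<Rightarrow> 'a" and I :: "'a set"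
  assumes basis: "is_basis M B"
    and I_ground: "I \<subseteq> E"
    and part_ground: "e \<in> E \<Longrightarrow> prt e \<in> E"
    and part_le: "e \<in> E \<Longrightarrow> prt e \<le> e"
    and part_part: "e \<in> E \<Longrightarrow> prt (prt e) = prt e"
    and part_I: "e \<in> E \<Longrightarrow> prt e \<in> I \<longleftrightarrow> e \<in> I"
    and part_self: "e \<in> E \<Longrightarrow> prt e = e \<Longrightarrow> e \<in> I \<longleftrightarrow> e \<in> B"
    and link: "e \<in> E - B \<Longrightarrow> b \<in> B \<Longrightarrow> fc B e b \<noteq> 0 \<Longrightarrow>
      (b \<in> I \<longrightarrow> e \<in> I \<and> prt b \<le> prt e) \<and> (e \<notin> I \<longrightarrow> prt e \<le> prt b)"
    and opt_outside: "e \<in> E - B \<Longrightarrow> prt e \<noteq> e \<Longrightarrow>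
      fc B e (Min {c \<in> supp (fc B e). prt c = prt e}) = -1"
    and opt_inside: "b \<in> B \<Longrightarrow> prt b \<noteq> b \<Longrightarrow>
      fund_cocircuit M B b (Min {c \<in> supp (fund_cocircuit M B b). prt c = prt b}) = -1"
begin

text \<open>The assumption \<open>link\<close> is self-dual: passing to complements and exchanging
  \<open>b\<close> with \<open>e\<close> replaces membership in \<open>I\<close> by its
  contrapositive and swaps the two inequalities.\<close>

lemma decomposed_dual: "decomposed_basis (dual M) (E - B) prt (E - I)"
proof -
  have BE: "B \<subseteq> E" by (rule basis_ground[OF basis])
  show ?thesis
  proof (unfold_locales, unfold ground_dual)
    show "oriented_matroid (dual M)" by (rule oriented_matroid_dual)
    show "is_basis (dual M) (E - B)" using basis BE by (simp add: basis_dual_compl)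
    show "E - I \<subseteq> E" by blast
    fix e
    show "e \<in> E \<Longrightarrow> prt e \<in> E" by (rule part_ground)
    show "e \<in> E \<Longrightarrow> prt e \<le> e" by (rule part_le)
    show "e \<in> E \<Longrightarrow> prt (prt e) = prt e" by (rule part_part)
    show "e \<in> E \<Longrightarrow> prt e \<in> E - I \<longleftrightarrow> e \<in> E - I" using part_I part_ground by blast
    show "e \<in> E \<Longrightarrow> prt e = e \<Longrightarrow> e \<in> E - I \<longleftrightarrow> e \<in> E - B" using part_self by blast
  next
    fix e b assume e: "e \<in> E - (E - B)" and b: "b \<in> E - B"
      and nz: "fund_circuit (dual M) (E - B) e b \<noteq> 0"
    have "e \<in> B" using e by blast
    moreover have "fc B b e \<noteq> 0"
      using nz fund_cocircuit_outside[OF basis \<open>e \<in> B\<close> b] by (simp add: fund_circuit_dual)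
    ultimately show "(b \<in> E - I \<longrightarrow> e \<in> E - I \<and> prt b \<le> prt e) \<and> (e \<notin> E - I \<longrightarrow> prt e \<le> prt b)"
      using link[OF b] e b by blast
  next
    fix e assume "e \<in> E - (E - B)" "prt e \<noteq> e"
    then show "fund_circuit (dual M) (E - B) e
        (Min {c \<in> supp (fund_circuit (dual M) (E - B) e). prt c = prt e}) = - 1"
      unfolding fund_circuit_dual using opt_inside by blast
  next
    fix b assume "b \<in> E - B" "prt b \<noteq> b"
    then show "fund_cocircuit (dual M) (E - B) b
        (Min {c \<in> supp (fund_cocircuit (dual M) (E - B) b). prt c = prt b}) = - 1"
      unfolding fund_cocircuit_dual[OF BE] by (rule opt_outside)
  qed
qed

lemma part_min_outside:
  assumes e: "e \<in> E - B" "prt e \<noteq> e"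
  obtains m where "m \<in> B" "prt m = prt e" "fc B e m = -1"
    "\<And>c. fc B e c \<noteq> 0 \<Longrightarrow> prt c = prt e \<Longrightarrow> m \<le> c"
proof -
  let ?S = "{c \<in> supp (fc B e). prt c = prt e}"
  have fin: "finite ?S" using finite_supp_circuit[OF fund_circuit_circuit[OF basis e(1)]]
    by (rule finite_subset[rotated]) blast
  have "e \<in> ?S" using fund_circuit_self[OF basis e(1)] by simp
  then have S: "Min ?S \<in> ?S" using Min_in[OF fin] by blast
  have m: "fc B e (Min ?S) = -1" by (rule opt_outside[OF e])
  then have "Min ?S \<noteq> e" using fund_circuit_self[OF basis e(1)] by auto
  then have "Min ?S \<in> B" using fund_circuit_in[OF basis e(1), of "Min ?S"] m by auto
  moreover have "Min ?S \<le> c" if "fc B e c \<noteq> 0" "prt c = prt e" for c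
    using fin that by (intro Min_le) simp_all
  ultimately show ?thesis using that[of "Min ?S"] S m by blast
qed

text \<open>Stated through fundamental circuits, whose values are the negatives of those of
  cocircuits; hence the sign 1 here, against -1 outside the basis.\<close>

lemma part_min_inside:
  assumes b: "b \<in> B" "prt b \<noteq> b"
  obtains m where "m \<in> E - B" "prt m = prt b" "fc B m b = 1"
    "\<And>c. c \<in> E - B \<Longrightarrow> fc B c b \<noteq> 0 \<Longrightarrow> prt c = prt b \<Longrightarrow> m \<le> c"
proof -
  let ?S = "{c \<in> supp (fund_cocircuit M B b). prt c = prt b}"
  have fin: "finite ?S" using finite_supp_cocircuit[OF fund_cocircuit_cocircuit[OF basis b(1)]]
    by (rule finite_subset[rotated]) blast
  have "b \<in> ?S" using fund_cocircuit_self[OF basis b(1)] by simp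
  then have S: "Min ?S \<in> ?S" using Min_in[OF fin] by blast
  have m: "fund_cocircuit M B b (Min ?S) = -1" by (rule opt_inside[OF b])
  then have "Min ?S \<noteq> b" using fund_cocircuit_self[OF basis b(1)] by auto
  then have mE: "Min ?S \<in> E - B" using fund_cocircuit_in[OF basis b(1), of "Min ?S"] m by auto
  moreover have "fc B (Min ?S) b = 1" using fund_cocircuit_outside[OF basis b(1) mE] m by simp
  moreover have "Min ?S \<le> c" if "c \<in> E - B" "fc B c b \<noteq> 0" "prt c = prt b" for c
    using fund_cocircuit_outside[OF basis b(1) that(1)] that fin by (intro Min_le) simp_all
  ultimately show ?thesis using that[of "Min ?S"] S by blast
qed

text \<open>A circuit that is positive on the internal elements of parts at least \<open>prt x\<close> cannot
  contain such an element. Otherwise let \<open>b\<close> be an element of the basis in the largest of these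
  parts, and smallest in this part, whose fundamental cocircuit meets the circuit: the two have
  only equal signs in common.\<close>

lemma positive_cocircuit_through:
  assumes x: "x \<in> I"
  obtains D where "D \<in> cocircuits M" "positive D" "D x \<noteq> 0"
    "\<And>f. D f \<noteq> 0 \<Longrightarrow> f \<in> I \<and> prt x \<le> prt f"
proof -
  define K where "K = {f \<in> I. prt x \<le> prt f}"
  have KE: "K \<subseteq> E" and xK: "x \<in> K" using I_ground x by (auto simp: K_def)
  have finK: "finite K" using KE finite_ground by (rule finite_subset)
  have "(\<exists>C\<in>circuits M. C x \<noteq> 0 \<and> supp C \<subseteq> K \<union> (E - K) \<and> (\<forall>f\<in>K. C f \<noteq> 0 \<longrightarrow> C f = 1)) \<or>
    (\<exists>D\<in>cocircuits M. D x \<noteq> 0 \<and> supp D \<inter> (E - K) = {} \<and> (\<forall>f\<in>K. D f \<noteq> 0 \<longrightarrow> D f = 1))"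
    by (rule painting[of K x "E - K" "\<lambda>_. 1", OF finK xK KE]) auto
  then show ?thesis
  proof
    assume "\<exists>C\<in>circuits M. C x \<noteq> 0 \<and> supp C \<subseteq> K \<union> (E - K) \<and> (\<forall>f\<in>K. C f \<noteq> 0 \<longrightarrow> C f = 1)"
    then obtain C where C: "C \<in> circuits M" "C x \<noteq> 0" "\<forall>f\<in>K. C f \<noteq> 0 \<longrightarrow> C f = 1" by blast
    define T where "T = {b \<in> B \<inter> K. \<exists>f. cosig B b f \<noteq> 0 \<and> C f \<noteq> 0}"
    have finT: "finite T" using finK by (rule finite_subset[rotated]) (auto simp: T_def)
    have inT: "\<exists>m\<in>T. prt m = prt e \<and> fc B e m = -1 \<and> (\<forall>c. fc B e c \<noteq> 0 \<longrightarrow> prt c = prt e \<longrightarrow> m \<le> c)"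
      if e: "e \<in> K" "C e \<noteq> 0" "e \<notin> B" for e
    proof -
      have eI: "e \<in> I" and eE: "e \<in> E - B" using e KE by (auto simp: K_def)
      then have "prt e \<noteq> e" using part_self[of e] e(3) by blast
      from part_min_outside[OF eE this] obtain m where m: "m \<in> B" "prt m = prt e" "fc B e m = -1"
        "\<And>c. fc B e c \<noteq> 0 \<Longrightarrow> prt c = prt e \<Longrightarrow> m \<le> c" by blast
      have "m \<in> E" using m(1) basis_ground[OF basis] by blast
      then have "m \<in> I" using part_I[of m] part_I[of e] m(2) eI eE by simp
      then have "m \<in> K" using m(2) e(1) by (simp add: K_def)
      moreover have "cosig B m e \<noteq> 0" using cosig_outside[OF m(1) eE] m(3) by simp
      ultimately have "m \<in> T" using m(1) e(2) unfolding T_def by blast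
      then show ?thesis using m by blast
    qed
    have "T \<noteq> {}"
    proof (cases "x \<in> B")
      case True
      have "cosig B x x \<noteq> 0" by (simp add: cosig_self)
      then show ?thesis using True xK C(2) unfolding T_def by blast
    next
      case False
      then show ?thesis using inT[OF xK C(2)] by blast
    qed
    define p where "p = Max (prt ` T)"
    have "p \<in> prt ` T" using finT \<open>T \<noteq> {}\<close> by (simp add: p_def)
    then have ne: "{b \<in> T. prt b = p} \<noteq> {}" by auto
    have p_max: "prt b \<le> p" if "b \<in> T" for b using finT that by (simp add: p_def)
    define b where "b = Min {b \<in> T. prt b = p}"
    have "b \<in> {b \<in> T. prt b = p}" using finT ne unfolding b_def by (intro Min_in) auto
    then have b: "b \<in> T" "prt b = p" by auto
    have b_min: "b \<le> b'" if "b' \<in> T" "prt b' = p" for b' using finT that by (simp add: b_def)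
    have bB: "b \<in> B" and bK: "b \<in> K" using b(1) by (auto simp: T_def)
    then have bI: "b \<in> I" by (simp add: K_def)
    have "C f * cosig B b f = 1" if f: "C f \<noteq> 0" "cosig B b f \<noteq> 0" for f
    proof (cases "f = b")
      case True
      then show ?thesis using C(3) f(1) bK cosig_self[of B b] by simp
    next
      case False
      then have fE: "f \<in> E - B" using cosig_support[OF f(2)] by blast
      have bf: "cosig B b f = - fc B f b" by (rule cosig_outside[OF bB fE])
      then have nz: "fc B f b \<noteq> 0" using f(2) by simp
      have fI: "f \<in> I" "prt b \<le> prt f" using link[OF fE bB nz] bI by auto
      then have fK: "f \<in> K" using bK by (auto simp: K_def)
      then obtain m where m: "m \<in> T" "prt m = prt f" "fc B f m = -1"
        "\<forall>c. fc B f c \<noteq> 0 \<longrightarrow> prt c = prt f \<longrightarrow> m \<le> c" using inT[OF fK f(1)] fE by blast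
      \<comment> \<open>\<open>link\<close> places \<open>f\<close> in a part at least
        \<open>p\<close>, while its minimizing element \<open>m\<close> belongs to \<open>T\<close>,
        whose parts are at most \<open>p\<close>.\<close>
      have pf: "prt f = p" using p_max[OF m(1)] m(2) fI(2) b(2) by simp
      have "m = b" using b_min[OF m(1)] m(2,4) nz pf b(2) by (intro antisym) auto
      then show ?thesis using bf m(3) C(3) fK f(1) by simp
    qed
    from orthogonal_const[OF cosig_orthogonal[OF basis bB C(1)] this]
    have "C f = 0 \<or> cosig B b f = 0" for f .
    then show ?thesis using b(1) by (auto simp: T_def)
  next
    assume "\<exists>D\<in>cocircuits M. D x \<noteq> 0 \<and> supp D \<inter> (E - K) = {} \<and> (\<forall>f\<in>K. D f \<noteq> 0 \<longrightarrow> D f = 1)"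
    then obtain D where D: "D \<in> cocircuits M" "D x \<noteq> 0" "supp D \<inter> (E - K) = {}" "\<forall>f\<in>K. D f \<noteq> 0 \<longrightarrow> D f = 1"
      by blast
    have "supp D \<subseteq> E" using cocircuit_signed[OF D(1)] by (simp add: signed_subset_def)
    then have sub: "supp D \<subseteq> K" using D(3) by blast
    then have "positive D" using D(4) by (auto simp: positive_def)
    then show ?thesis using that[OF D(1) _ D(2)] sub by (auto simp: K_def subset_iff)
  qed
qed

text \<open>An external element lies on a positive circuit, by the preceding lemma in the dual, and
  a positive circuit cannot meet a positive cocircuit.\<close>

lemma positive_cocircuit_internal:
  assumes D: "D \<in> cocircuits M" "positive D" and f: "D f \<noteq> 0"
  shows "f \<in> I"
proof (rule ccontr)
  interpret D: decomposed_basis "dual M" "E - B" prt "E - I" by (rule decomposed_dual)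
  assume "f \<notin> I"
  moreover have "f \<in> E" using cocircuit_signed[OF D(1)] f by (auto simp: signed_subset_def subset_iff)
  ultimately obtain C where C: "C \<in> circuits M" "positive C" "C f \<noteq> 0"
    using D.positive_cocircuit_through[of f] by auto
  have "C g * D g = 1" if "C g \<noteq> 0" "D g \<noteq> 0" for g
    using that C(2) D(2) by (auto simp: positive_def)
  from orthogonal_const[OF orthogonal_cocircuit[OF C(1) D(1)] this] show False
    using C(3) f by blast
qed

text \<open>The smallest part met by a positive cocircuit contributes its smallest element. Otherwise
  take the smallest element of this part outside the basis whose fundamental circuit meets the
  cocircuit: the two have only equal signs in common.\<close>

lemma positive_cocircuit_Min:
  assumes D: "D \<in> cocircuits M" "positive D"
  shows "D (Min (prt ` supp D)) \<noteq> 0" "Min (supp D) = Min (prt ` supp D)"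
proof -
  define p where "p = Min (prt ` supp D)"
  have fin: "finite (supp D)" by (rule finite_supp_cocircuit[OF D(1)])
  have DE: "f \<in> E" if "D f \<noteq> 0" for f
    using cocircuit_signed[OF D(1)] that by (auto simp: signed_subset_def subset_iff)
  obtain y where "D y \<noteq> 0" using cocircuit_nonempty[OF D(1)] by blast
  then have ne: "supp D \<noteq> {}" by auto
  have "p \<in> prt ` supp D" using fin ne by (simp add: p_def)
  then obtain x where x: "D x \<noteq> 0" "prt x = p" by auto
  have p_le: "p \<le> prt f" if "D f \<noteq> 0" for f using fin that by (simp add: p_def)
  show Dp: "D (Min (prt ` supp D)) \<noteq> 0"
  proof
    assume "D (Min (prt ` supp D)) = 0"
    then have p0: "D p = 0" by (simp add: p_def)
    define T where "T = {e \<in> E - B. prt e = p \<and> (\<exists>f. fc B e f \<noteq> 0 \<and> D f \<noteq> 0)}"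
    have finT: "finite T" using finite_ground by (rule finite_subset[rotated]) (auto simp: T_def)
    have inT: "\<exists>m\<in>T. fc B m b = 1 \<and> (\<forall>c\<in>E - B. fc B c b \<noteq> 0 \<longrightarrow> prt c = p \<longrightarrow> m \<le> c)"
      if b: "b \<in> B" "D b \<noteq> 0" "prt b = p" for b
    proof -
      have "prt b \<noteq> b" using b p0 by auto
      from part_min_inside[OF b(1) this] obtain m where m: "m \<in> E - B" "prt m = prt b" "fc B m b = 1"
        "\<And>c. c \<in> E - B \<Longrightarrow> fc B c b \<noteq> 0 \<Longrightarrow> prt c = prt b \<Longrightarrow> m \<le> c" by blast
      have "fc B m b \<noteq> 0" using m(3) by simp
      then have "m \<in> T" using m(1,2) b unfolding T_def by auto
      then show ?thesis using m(3,4) b(3) by auto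
    qed
    have "T \<noteq> {}"
    proof (cases "x \<in> B")
      case True
      then show ?thesis using inT x by blast
    next
      case False
      then have xE: "x \<in> E - B" using DE[OF x(1)] by blast
      have "fc B x x \<noteq> 0" using fund_circuit_self[OF basis xE] by simp
      then have "x \<in> T" using xE x unfolding T_def by blast
      then show ?thesis by blast
    qed
    define e where "e = Min T"
    have e: "e \<in> T" using finT \<open>T \<noteq> {}\<close> by (simp add: e_def)
    have e_min: "e \<le> c" if "c \<in> T" for c using finT that by (simp add: e_def)
    have eE: "e \<in> E - B" "prt e = p" using e by (auto simp: T_def)
    have "fc B e f * D f = 1" if f: "fc B e f \<noteq> 0" "D f \<noteq> 0" for f
    proof -
      have D1: "D f = 1" using D(2) f(2) by (simp add: positive_def)
      show ?thesis
      proof (cases "f = e")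
        case True
        then show ?thesis using D1 fund_circuit_self[OF basis eE(1)] by simp
      next
        case False
        then have fB: "f \<in> B" using fund_circuit_in[OF basis eE(1) f(1)] by blast
        have "f \<in> I" by (rule positive_cocircuit_internal[OF D f(2)])
        \<comment> \<open>Positive cocircuits are internal, so \<open>link\<close> bounds the part
          of \<open>f\<close> from above; minimality of \<open>p\<close> gives equality, and the
          choice of \<open>e\<close> applies to \<open>f\<close>.\<close>
        then have "prt f \<le> p" using link[OF eE(1) fB f(1)] eE(2) by simp
        then have "prt f = p" using p_le[OF f(2)] by simp
        from inT[OF fB f(2) this] obtain m where m: "m \<in> T" "fc B m f = 1"
          "\<forall>c\<in>E - B. fc B c f \<noteq> 0 \<longrightarrow> prt c = p \<longrightarrow> m \<le> c" by blast
        have "m = e" using e_min[OF m(1)] m(3) eE f(1) by (intro antisym) auto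
        then show ?thesis using m(2) D1 by simp
      qed
    qed
    from orthogonal_const[OF orthogonal_cocircuit[OF fund_circuit_circuit[OF basis eE(1)] D(1)] this]
    have "fc B e f = 0 \<or> D f = 0" for f .
    then show False using e by (auto simp: T_def)
  qed
  show "Min (supp D) = Min (prt ` supp D)"
  proof (rule Min_eqI[OF fin])
    show "Min (prt ` supp D) \<in> supp D" using Dp by simp
    fix f assume "f \<in> supp D"
    then have "D f \<noteq> 0" by simp
    then show "Min (prt ` supp D) \<le> f" using p_le[of f] part_le[OF DE, of f] by (simp add: p_def)
  qed
qed

section \<open>Active elements, filtration and active basis on the internal side\<close>

definition act :: "'a set" where
  "act = {a \<in> I. prt a = a}"

lemma part_act: "e \<in> I \<Longrightarrow> prt e \<in> act"
  using I_ground part_I part_part by (auto simp: act_def)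

lemma finite_act: "finite act"
  using I_ground finite_ground by (intro finite_subset[of act E]) (auto simp: act_def)

text \<open>Minima of positive cocircuits are values of \<open>prt\<close> on internal elements.
  Conversely, the positive cocircuit through a fixed point \<open>a\<close> that stays in parts at
  least \<open>a\<close> has minimum \<open>a\<close>.\<close>

lemma Ostar_act_eq: "Ostar_act M = act"
proof
  show "Ostar_act M \<subseteq> act"
  proof
    fix a assume "a \<in> Ostar_act M"
    then obtain D where D: "D \<in> cocircuits M" "positive D" "a = Min (supp D)"
      by (auto simp: Ostar_act_def)
    have "supp D \<noteq> {}" using cocircuit_nonempty[OF D(1)] by auto
    then have "a \<in> prt ` supp D"
      using D(3) positive_cocircuit_Min(2)[OF D(1,2)] finite_supp_cocircuit[OF D(1)] by simp
    then show "a \<in> act" using positive_cocircuit_internal[OF D(1,2)] part_act by auto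
  qed
  show "act \<subseteq> Ostar_act M"
  proof
    fix a assume a: "a \<in> act"
    then obtain D where D: "D \<in> cocircuits M" "positive D" "D a \<noteq> 0" "\<And>f. D f \<noteq> 0 \<Longrightarrow> f \<in> I \<and> prt a \<le> prt f"
      using positive_cocircuit_through[of a] by (auto simp: act_def)
    have "Min (supp D) = a"
    proof (rule Min_eqI[OF finite_supp_cocircuit[OF D(1)]])
      show "a \<in> supp D" using D(3) by simp
      fix f assume "f \<in> supp D"
      then have f: "f \<in> I" "prt a \<le> prt f" using D(4) by auto
      have "prt f \<le> f" using f(1) I_ground part_le by blast
      then show "a \<le> f" using f(2) a by (simp add: act_def)
    qed
    then show "a \<in> Ostar_act M" using D(1,2) by (auto simp: Ostar_act_def)
  qed
qed

lemma filtration_step: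
  "E - \<Union> {supp D | D. D \<in> cocircuits M \<and> positive D \<and> a \<le> Min (supp D)} =
    {e \<in> E. e \<in> I \<longrightarrow> prt e < a}"
proof -
  have lower: "f \<in> I \<and> a \<le> prt f" if D: "D \<in> cocircuits M" "positive D" "a \<le> Min (supp D)" and f: "f \<in> supp D" for D f
  proof -
    have "Min (prt ` supp D) \<le> prt f" using f finite_supp_cocircuit[OF D(1)] by simp
    then show ?thesis
      using positive_cocircuit_Min(2)[OF D(1,2)] positive_cocircuit_internal[OF D(1,2)] D(3) f by simp
  qed
  have upper: "\<exists>D. D \<in> cocircuits M \<and> positive D \<and> a \<le> Min (supp D) \<and> f \<in> supp D"
    if f: "f \<in> I" "a \<le> prt f" for f
  proof -
    obtain D where D: "D \<in> cocircuits M" "positive D" "D f \<noteq> 0" "\<And>g. D g \<noteq> 0 \<Longrightarrow> g \<in> I \<and> prt f \<le> prt g"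
      using positive_cocircuit_through[OF f(1)] by blast
    have ge: "a \<le> g" if "g \<in> supp D" for g
    proof -
      have g: "g \<in> I" "prt f \<le> prt g" using D(4) that by auto
      have "prt g \<le> g" using g(1) I_ground part_le by blast
      then show ?thesis using g(2) f(2) by simp
    qed
    have "f \<in> supp D" using D(3) by simp
    then have "Min (supp D) \<in> supp D" using finite_supp_cocircuit[OF D(1)] by (intro Min_in) auto
    then show ?thesis using ge D(1-3) by auto
  qed
  have "f \<in> \<Union> {supp D | D. D \<in> cocircuits M \<and> positive D \<and> a \<le> Min (supp D)} \<longleftrightarrow>
      f \<in> I \<and> \<not> prt f < a" (is "?L \<longleftrightarrow> ?R") for f
  proof
    assume ?L
    then obtain D where "D \<in> cocircuits M" "positive D" "a \<le> Min (supp D)" "f \<in> supp D" by auto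
    from lower[OF this] show ?R by (simp add: not_less)
  next
    assume ?R
    then obtain D where "D \<in> cocircuits M \<and> positive D \<and> a \<le> Min (supp D)" "f \<in> supp D"
      using upper[of f] by (auto simp only: not_less)
    then show ?L by blast
  qed
  then show ?thesis by blast
qed

lemma filt_lower:
  assumes "k < card act"
  shows "filt M k = {e \<in> E. e \<in> I \<longrightarrow> prt e < sorted_list_of_set act ! k}"
  using assms filtration_step by (simp add: filt_def Ostar_act_eq Let_def)

text \<open>The index \<open>Suc k\<close> refers to the next active element, or to the whole ground
  set if there is none. Since \<open>prt\<close> takes only active values on \<open>I\<close>, being
  below the next one means being at most the current one.\<close>

lemma filt_upper:
  assumes "k < card act"
  shows "filt M (Suc k) = {e \<in> E. e \<in> I \<longrightarrow> prt e \<le> sorted_list_of_set act ! k}"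
proof -
  let ?as = "sorted_list_of_set act"
  have len: "length ?as = card act" and set: "set ?as = act" using finite_act by simp_all
  have mono: "?as ! i < ?as ! j" if "i < j" "j < card act" for i j
    using that len by (metis sorted_wrt_nth_less strict_sorted_list_of_set)
  have ex: "\<exists>i<card act. prt e = ?as ! i" if "e \<in> I" for e
    using part_act[OF that] set len by (metis in_set_conv_nth)
  have le: "prt e \<le> ?as ! k \<longleftrightarrow> Suc k < card act \<longrightarrow> prt e < ?as ! Suc k" if e: "e \<in> I" for e
  proof -
    obtain i where i: "i < card act" "prt e = ?as ! i" using ex[OF e] by blast
    consider "i \<le> k" | "i = Suc k" | "i > Suc k" by linarith
    then show ?thesis
    proof cases
      case 1
      then have "prt e \<le> ?as ! k" using i(2) mono[of i k] assms by (cases "i = k") auto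
      moreover have "prt e < ?as ! Suc k" if "Suc k < card act" using 1 i(2) mono[of i "Suc k"] that by simp
      ultimately show ?thesis by simp
    next
      case 2
      then show ?thesis using i mono[of k i] by auto
    next
      case 3
      then show ?thesis using i mono[of k i] mono[of "Suc k" i] by auto
    qed
  qed
  show ?thesis
  proof (cases "Suc k < card act")
    case True
    then show ?thesis using filt_lower[OF True] le by auto
  next
    case False
    then have "filt M (Suc k) = E" using len by (simp add: filt_def Ostar_act_eq Let_def)
    then show ?thesis using le False by auto
  qed
qed

lemma filt_ground: "filt M k \<subseteq> E"
  by (auto simp: filt_def Let_def)

lemma filt_mono:
  assumes "k < card act"
  shows "filt M k \<subseteq> filt M (Suc k)"
  by (auto simp: filt_lower[OF assms] filt_upper[OF assms])

lemma filt_diff: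
  assumes "k < card act"
  shows "filt M (Suc k) - filt M k = {e \<in> I. prt e = sorted_list_of_set act ! k}"
  using I_ground by (auto simp: filt_lower[OF assms] filt_upper[OF assms])

text \<open>The minor lives on a single part. Its fundamental circuits and cocircuits are those of
  \<open>B\<close> cut down to this part, so the smallest element in the same part becomes the
  smallest element of the whole support, as full optimality asks.\<close>

lemma alpha_part:
  assumes a: "a \<in> act"
  defines "G \<equiv> {e \<in> E. e \<in> I \<longrightarrow> prt e \<le> a}" and "F \<equiv> {e \<in> E. e \<in> I \<longrightarrow> prt e < a}"
  shows "alpha_bounded (om_contract (om_restrict M G) F) = {b \<in> B \<inter> I. prt b = a}"
proof -
  let ?N = "om_contract (om_restrict M G) F"
  have FG: "F \<subseteq> G" "G \<subseteq> E" by (auto simp: F_def G_def)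
  have diff: "G - F = {e \<in> I. prt e = a}" using I_ground by (auto simp: F_def G_def)
  \<comment> \<open>By \<open>link\<close>, an internal basis element in the fundamental circuit of
    \<open>e\<close> makes \<open>e\<close> internal and has no larger part. Hence any condition
    \<open>R\<close> inherited by smaller parts defines a closed set; it is used with
    \<open><\<close> for \<open>F\<close> and \<open>\<le>\<close> for \<open>G\<close>.\<close>
  have closed: "supp (fc B e) \<subseteq> {e \<in> E. e \<in> I \<longrightarrow> R (prt e)}"
    if e: "e \<in> {e \<in> E. e \<in> I \<longrightarrow> R (prt e)} - B" and R: "\<And>c d. c \<le> d \<Longrightarrow> R d \<Longrightarrow> R c" for e R
  proof
    fix f assume "f \<in> supp (fc B e)"
    then have nz: "fc B e f \<noteq> 0" by simp
    have eE: "e \<in> E - B" using e by blast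
    show "f \<in> {e \<in> E. e \<in> I \<longrightarrow> R (prt e)}"
    proof (cases "f = e")
      case False
      then have f: "f \<in> B" using fund_circuit_in[OF basis eE nz] by blast
      then have "f \<in> E" using basis_ground[OF basis] by blast
      moreover have "R (prt f)" if "f \<in> I" using link[OF eE f nz] that e R by blast
      ultimately show ?thesis by blast
    qed (use e in blast)
  qed
  have cF: "supp (fc B e) \<subseteq> F" if "e \<in> F - B" for e
    using that unfolding F_def by (rule closed) auto
  have cG: "supp (fc B e) \<subseteq> G" if "e \<in> G - B" for e
    using that unfolding G_def by (rule closed) auto
  let ?B = "B \<inter> (G - F)"
  interpret N: ordered_om ?N using om_minor[OF FG] by (simp add: ordered_om_def)
  note mb = minor_basis[OF basis FG cF cG]
  have NB: "is_basis ?N ?B" by (rule mb(1))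
  have NE: "N.E = G - F" by simp
  have circ: "N.fc ?B e f = fc B e f" if "e \<in> G - F - B" "f \<in> G - F" for e f using mb(2) that by blast
  have cocirc: "fund_cocircuit ?N ?B b f = fund_cocircuit M B b f" if b: "b \<in> ?B" and f: "f \<in> G - F" for b f
  proof -
    have bB: "b \<in> B" using b by blast
    consider "f = b" | "f \<noteq> b" "f \<in> B" | "f \<notin> B" by blast
    then show ?thesis
    proof cases
      case 1
      then show ?thesis using fund_cocircuit_self[OF basis bB] N.fund_cocircuit_self[OF NB b] by simp
    next
      case 2
      then have "fund_cocircuit M B b f = 0" using fund_cocircuit_in[OF basis bB, of f] by blast
      moreover have "fund_cocircuit ?N ?B b f = 0" using N.fund_cocircuit_in[OF NB b, of f] 2 f by blast
      ultimately show ?thesis by simp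
    next
      case 3
      have "f \<in> E - B" "f \<in> N.E - ?B" using 3 f FG by auto
      then show ?thesis
        using fund_cocircuit_outside[OF basis bB, of f] N.fund_cocircuit_outside[OF NB b, of f] circ[of f b] 3 f b
        by simp
    qed
  qed
  have part_in: "f \<in> G - F \<longleftrightarrow> prt f = prt e" if "f \<in> E" "e \<in> G - F" for e f
    using that part_I[of f] part_I[of e] I_ground unfolding diff by auto
  \<comment> \<open>The element \<open>a\<close> naming the part is thereby the one that the inside
    condition exempts.\<close>
  have "Min N.E = a"
    unfolding NE diff using a part_le I_ground finite_subset[OF I_ground finite_ground]
    by (intro Min_eqI) (auto simp: act_def)
  have "fully_optimal ?N ?B"
    unfolding fully_optimal_def Let_def \<open>Min N.E = a\<close>
  proof (intro conjI ballI NB)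
    fix b assume b: "b \<in> ?B - {a}"
    let ?D = "fund_cocircuit ?N ?B b"
    have bB: "b \<in> ?B" "b \<in> B" and bG: "b \<in> G - F" using b by auto
    have "prt b \<noteq> b" using b diff by auto
    note opt = opt_inside[OF bB(2) this]
    have DN: "f \<in> G - F" if "?D f \<noteq> 0" for f
      using N.fund_cocircuit_in[OF NB bB(1) that] bG NE by blast
    have DE: "f \<in> E" if "fund_cocircuit M B b f \<noteq> 0" for f
      using fund_cocircuit_in[OF basis bB(2) that] bG FG by blast
    have S: "supp ?D = {c \<in> supp (fund_cocircuit M B b). prt c = prt b}"
    proof (intro set_eqI iffI)
      fix f assume "f \<in> supp ?D"
      then have nz: "?D f \<noteq> 0" by simp
      have f: "f \<in> G - F" by (rule DN[OF nz])
      then have "prt f = prt b" using part_in[OF _ bG, of f] FG by blast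
      then show "f \<in> {c \<in> supp (fund_cocircuit M B b). prt c = prt b}"
        using nz cocirc[OF bB(1) f] by simp
    next
      fix f assume "f \<in> {c \<in> supp (fund_cocircuit M B b). prt c = prt b}"
      then have nz: "fund_cocircuit M B b f \<noteq> 0" and "prt f = prt b" by simp_all
      then have "f \<in> G - F" using part_in[OF DE[OF nz] bG] by blast
      then show "f \<in> supp ?D" using nz cocirc[OF bB(1)] by simp
    qed
    have "b \<in> supp ?D" using N.fund_cocircuit_self[OF NB bB(1)] by simp
    then have "Min (supp ?D) \<in> supp ?D"
      using Min_in[OF N.finite_supp_cocircuit[OF N.fund_cocircuit_cocircuit[OF NB bB(1)]]] by blast
    then have "?D (Min (supp ?D)) \<noteq> 0" by (simp only: supp_iff not_False_eq_True)
    then have "?D (Min (supp ?D)) = -1" using cocirc[OF bB(1) DN] opt S by simp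
    then show "?D b = - ?D (Min (supp ?D))" using N.fund_cocircuit_self[OF NB bB(1)] by simp
  next
    fix e assume e: "e \<in> N.E - ?B"
    let ?C = "N.fc ?B e"
    have eN: "e \<in> G - F - B" and eG: "e \<in> G - F" and eE: "e \<in> E - B" using e FG by auto
    have "prt e \<noteq> e" using part_self[of e] eE eG diff by auto
    note opt = opt_outside[OF eE this]
    have CN: "f \<in> G - F" if "?C f \<noteq> 0" for f
      using N.fund_circuit_in[OF NB e that] eG NE by blast
    have CE: "f \<in> E" if "fc B e f \<noteq> 0" for f
      using fund_circuit_in[OF basis eE that] eE basis_ground[OF basis] by blast
    have S: "supp ?C = {c \<in> supp (fc B e). prt c = prt e}"
    proof (intro set_eqI iffI)
      fix f assume "f \<in> supp ?C"
      then have nz: "?C f \<noteq> 0" by simp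
      have f: "f \<in> G - F" by (rule CN[OF nz])
      then have "prt f = prt e" using part_in[OF _ eG, of f] FG by blast
      then show "f \<in> {c \<in> supp (fc B e). prt c = prt e}"
        using nz circ[OF eN f] by simp
    next
      fix f assume "f \<in> {c \<in> supp (fc B e). prt c = prt e}"
      then have nz: "fc B e f \<noteq> 0" and "prt f = prt e" by simp_all
      then have "f \<in> G - F" using part_in[OF CE[OF nz] eG] by blast
      then show "f \<in> supp ?C" using nz circ[OF eN] by simp
    qed
    have "e \<in> supp ?C" using N.fund_circuit_self[OF NB e] by simp
    then have "Min (supp ?C) \<in> supp ?C"
      using Min_in[OF N.finite_supp_circuit[OF N.fund_circuit_circuit[OF NB e]]] by blast
    then have "?C (Min (supp ?C)) \<noteq> 0" by (simp only: supp_iff not_False_eq_True)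
    then have "?C (Min (supp ?C)) = -1" using circ[OF eN CN] opt S by simp
    then show "?C e = - ?C (Min (supp ?C))" using N.fund_circuit_self[OF NB e] by simp
  qed
  from N.alpha_bounded_eq[OF this] show ?thesis unfolding diff by auto
qed

lemma alpha_step:
  assumes "k < card act"
  shows "alpha_bounded (om_contract (om_restrict M (filt M (Suc k))) (filt M k)) =
    {b \<in> B \<inter> I. prt b = sorted_list_of_set act ! k}"
proof -
  have "sorted_list_of_set act ! k \<in> act"
    using assms finite_act by (metis length_sorted_list_of_set nth_mem set_sorted_list_of_set)
  from alpha_part[OF this] show ?thesis by (simp add: filt_lower[OF assms] filt_upper[OF assms])
qed

lemma ex_act_index:
  assumes "e \<in> I"
  shows "\<exists>k<card act. prt e = sorted_list_of_set act ! k"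
  using part_act[OF assms] finite_act
  by (metis in_set_conv_nth length_sorted_list_of_set set_sorted_list_of_set)

lemma alpha_internal:
  "(\<Union>k\<in>{1..card (Ostar_act M)}. alpha_bounded (om_contract (om_restrict M (filt M k)) (filt M (k - 1)))) = B \<inter> I"
proof -
  have "(\<Union>k\<in>{..<card act}. {b \<in> B \<inter> I. prt b = sorted_list_of_set act ! k}) = B \<inter> I"
    using ex_act_index by auto
  then show ?thesis unfolding Ostar_act_eq UN_shift using alpha_step by simp
qed

section \<open>The external side by duality\<close>

lemma O_act_dual: "O_act M = Ostar_act (dual M)"
  by (simp add: O_act_def Ostar_act_def)

lemma filt'_dual: "filt' M k = E - filt (dual M) k"
proof -
  have "\<Union> {supp C | C. C \<in> circuits M \<and> positive C \<and> a \<le> Min (supp C)} \<subseteq> E" for a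
    using circuit_ground by auto
  then show ?thesis by (simp add: filt_def filt'_def Let_def O_act_dual double_diff)
qed

text \<open>The minor between \<open>filt' M (Suc k)\<close> and \<open>filt' M k\<close> is dual to
  the minor of \<open>dual M\<close> between \<open>filt (dual M) k\<close> and
  \<open>filt (dual M) (Suc k)\<close>. The internal result there, complemented within the minor,
  gives the corresponding part of \<open>B\<close>.\<close>

lemma alpha_external:
  "(\<Union>k\<in>{1..card (O_act M)}. alpha_dual_bounded (om_contract (om_restrict M (filt' M (k - 1))) (filt' M k))) = B - I"
proof -
  interpret D: decomposed_basis "dual M" "E - B" prt "E - I" by (rule decomposed_dual)
  have BE: "B \<subseteq> E" by (rule basis_ground[OF basis])
  have step: "alpha_dual_bounded (om_contract (om_restrict M (filt' M k)) (filt' M (Suc k))) =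
      {b \<in> B - I. prt b = sorted_list_of_set D.act ! k}" if k: "k < card D.act" for k
  proof -
    have g: "filt (dual M) i \<subseteq> E" for i using D.filt_ground by simp
    have "dual (om_contract (om_restrict M (filt' M k)) (filt' M (Suc k))) =
        om_contract (om_restrict (dual M) (E - filt' M (Suc k))) (E - filt' M k)"
      using D.filt_mono[OF k] by (intro dual_minor) (auto simp: filt'_dual)
    then have "alpha_bounded (dual (om_contract (om_restrict M (filt' M k)) (filt' M (Suc k)))) =
        {b \<in> (E - B) \<inter> (E - I). prt b = sorted_list_of_set D.act ! k}"
      using D.alpha_step[OF k] g by (simp add: filt'_dual double_diff)
    moreover have "filt' M k - filt' M (Suc k) = {e \<in> E - I. prt e = sorted_list_of_set D.act ! k}"
      using D.filt_diff[OF k] g[of k] g[of "Suc k"] unfolding filt'_dual by blast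
    ultimately show ?thesis using BE by (auto simp: alpha_dual_bounded_def)
  qed
  have "(\<Union>k\<in>{..<card D.act}. {b \<in> B - I. prt b = sorted_list_of_set D.act ! k}) = B - I"
    using D.ex_act_index BE by blast
  then show ?thesis unfolding O_act_dual D.Ostar_act_eq UN_shift using step by simp
qed

theorem alpha_eq: "alpha M = B"
  unfolding alpha_def alpha_internal alpha_external by blast

theorem O_act_eq: "O_act M = {e \<in> E - I. prt e = e}"
proof -
  interpret D: decomposed_basis "dual M" "E - B" prt "E - I" by (rule decomposed_dual)
  show ?thesis by (simp add: O_act_dual D.Ostar_act_eq D.act_def)
qed

end

section \<open>The single pass\<close>

text \<open>The outcome of rules (II) and (IV) at \<open>e\<close>, for the fundamental cocircuit or circuit \<open>V\<close>
  of \<open>e\<close>, the map Part \<open>p\<close> and the set \<open>A\<close> of reoriented elements. Rule (II) has \<open>S\<close> the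
  external and \<open>T\<close> the internal elements; rule (IV) has them exchanged.\<close>

definition attached ::
  "'a::linorder signed \<Rightarrow> ('a \<Rightarrow> 'a) \<Rightarrow> 'a set \<Rightarrow> 'a set \<Rightarrow> 'a set \<Rightarrow> 'a \<Rightarrow> bool" where
  "attached V p A S T e \<longleftrightarrow>
    (if {c \<in> supp V. c < e} \<inter> S \<noteq> {} then e \<in> S \<and> p e = Max (p ` ({c \<in> supp V. c < e} \<inter> S))
     else e \<in> T \<and> p e = Min (p ` {c \<in> supp V. c < e})) \<and>
    (\<exists>a. a = Min {c \<in> supp V. c < e \<and> p c = p e} \<and> flip_sign A e * flip_sign A a * V a = -1)"

text \<open>The maximum or minimum is attained, \<open>b\<close> ensuring that there is something to
  choose from; so \<open>e\<close> inherits its part from an earlier element on its own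
  side.\<close>

lemma attached_witness:
  assumes "attached V p A S T e" "finite (supp V)" "V b \<noteq> 0" "b < e"
  obtains c where "V c \<noteq> 0" "c < e" "p c = p e" "c \<in> S \<and> e \<in> S \<or> c \<notin> S \<and> e \<in> T"
proof (cases "{c \<in> supp V. c < e} \<inter> S = {}")
  case True
  then have e: "e \<in> T" "p e = Min (p ` {c \<in> supp V. c < e})" using assms(1) by (simp_all add: attached_def)
  have fin: "finite (p ` {c \<in> supp V. c < e})" by (intro finite_imageI finite_subset[OF _ assms(2)]) blast
  have "p b \<in> p ` {c \<in> supp V. c < e}" using assms(3,4) by simp
  then have "p e \<in> p ` {c \<in> supp V. c < e}" using Min_in[OF fin] e(2) by auto
  then obtain c where "c \<in> {c \<in> supp V. c < e}" "p e = p c" by blast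
  then show ?thesis using that[of c] True e(1) by auto
next
  case False
  then have e: "e \<in> S" "p e = Max (p ` ({c \<in> supp V. c < e} \<inter> S))" using assms(1) by (simp_all add: attached_def)
  have "finite ({c \<in> supp V. c < e} \<inter> S)" by (rule finite_subset[OF _ assms(2)]) blast
  then have "p e \<in> p ` ({c \<in> supp V. c < e} \<inter> S)" unfolding e(2) using False by (intro Max_in) auto
  then obtain c where "c \<in> {c \<in> supp V. c < e} \<inter> S" "p e = p c" by blast
  then show ?thesis using that[of c] e(1) by auto
qed

text \<open>Some element below \<open>e\<close> shares its part, so dropping the restriction to
  elements below \<open>e\<close> leaves the minimum unchanged.\<close>

lemma attached_sign:
  assumes att: "attached V p A S T e" and V: "finite (supp V)" "V b \<noteq> 0" "b < e"
  shows "flip_sign A e * flip_sign A (Min {c \<in> supp V. p c = p e}) * V (Min {c \<in> supp V. p c = p e}) = -1"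
proof -
  obtain c where c: "V c \<noteq> 0" "c < e" "p c = p e" using attached_witness[OF att V] by blast
  let ?m = "{c \<in> supp V. c < e \<and> p c = p e}"
  have fin: "finite {c \<in> supp V. p c = p e}" by (rule finite_subset[OF _ V(1)]) blast
  then have fin': "finite ?m" by (rule rev_finite_subset) blast
  have "c \<in> ?m" using c by simp
  then have m: "Min ?m \<in> ?m" using Min_in[OF fin'] by blast
  have "Min {c \<in> supp V. p c = p e} = Min ?m"
  proof (rule Min_eqI[OF fin])
    show "Min ?m \<in> {c \<in> supp V. p c = p e}" using m by blast
    fix f assume f: "f \<in> {c \<in> supp V. p c = p e}"
    show "Min ?m \<le> f"
    proof (cases "f < e")
      case True
      then show ?thesis using f by (intro Min_le[OF fin']) blast
    next
      case False
      then show ?thesis using m by auto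
    qed
  qed
  then show ?thesis using att by (simp add: attached_def)
qed

text \<open>Only elements up to \<open>e\<close> are inspected; the witness guarantees that the
  minimum in question is a genuine element below \<open>e\<close>.\<close>

lemma attached_cong:
  assumes att: "attached V p A S T e" and V: "finite (supp V)" "V b \<noteq> 0" "b < e"
    and eq: "\<And>f. f \<le> e \<Longrightarrow> p' f = p f" "\<And>f. f \<le> e \<Longrightarrow> f \<in> A' \<longleftrightarrow> f \<in> A"
      "\<And>f. f \<le> e \<Longrightarrow> f \<in> S' \<longleftrightarrow> f \<in> S" "\<And>f. f \<le> e \<Longrightarrow> f \<in> T' \<longleftrightarrow> f \<in> T"
  shows "attached V p' A' S' T' e"
proof -
  let ?J = "{c \<in> supp V. c < e}"
  have J: "?J \<inter> S' = ?J \<inter> S" using eq(3) by auto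
  have im: "p' ` K = p ` K" if "K \<subseteq> ?J" for K using that eq(1) by (intro image_cong) auto
  have e: "p' e = p e" "e \<in> A' \<longleftrightarrow> e \<in> A" "e \<in> S' \<longleftrightarrow> e \<in> S" "e \<in> T' \<longleftrightarrow> e \<in> T" using eq by auto
  have m: "{c \<in> supp V. c < e \<and> p' c = p e} = {c \<in> supp V. c < e \<and> p c = p e}" (is "_ = ?m")
    using eq(1) by auto
  obtain c where c: "V c \<noteq> 0" "c < e" "p c = p e" using attached_witness[OF att V] by blast
  have "finite ?m" by (rule finite_subset[OF _ V(1)]) blast
  moreover have "c \<in> ?m" using c by simp
  ultimately have "Min ?m \<in> ?m" using Min_in by blast
  then have "Min ?m < e" by blast
  then have fl: "flip_sign A' (Min ?m) = flip_sign A (Min ?m)" "flip_sign A' e = flip_sign A e"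
    using eq(2)[OF less_imp_le] e(2) by (simp_all add: flip_sign_def)
  show ?thesis
    unfolding attached_def J m fl e im[of "?J \<inter> S", OF Int_lower1] im[of ?J, OF order_refl]
  proof (intro conjI exI[of _ "Min ?m"] refl)
    show "flip_sign A e * flip_sign A' (Min ?m) * V (Min ?m) = - 1"
      using att unfolding attached_def fl by blast
  qed (use att in \<open>simp add: attached_def del: supp_iff\<close>)
qed

text \<open>Unprimed data precede the step at \<open>e\<close>, primed data follow it.
  \<open>V\<close> belongs to \<open>M\<close> and stays fixed during the scan, while
  \<open>W\<close> is its version in the current reorientation; storing the outcome through
  \<open>V\<close> and sign factors makes it comparable with later states.\<close>

lemma attachedI:
  assumes V: "finite (supp V)" "V b \<noteq> 0" "b < e" "V e = 1" "\<And>f. V f = 0 \<or> V f = 1 \<or> V f = -1"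
    and e: "e \<notin> S" "e \<notin> A"
    and W: "\<And>f. W f = flip_sign A e * flip_sign A f * V f"
    and S': "S' = (if {c \<in> supp V. c < e} \<inter> S \<noteq> {} then insert e S else S)"
    and T': "T' = (if {c \<in> supp V. c < e} \<inter> S \<noteq> {} then T else insert e T)"
    and p': "p' = p(e := if {c \<in> supp V. c < e} \<inter> S \<noteq> {} then Max (p ` ({c \<in> supp V. c < e} \<inter> S))
        else Min (p ` {c \<in> supp V. c < e}))"
    and A': "A' = (if W e \<noteq> - W (Min {c \<in> supp V. c < e \<and> p' c = p' e}) then insert e A else A)"
  shows "attached V p' A' S' T' e"
proof -
  let ?J = "{c \<in> supp V. c < e}"
  have J: "?J \<inter> S' = ?J \<inter> S" by (auto simp: S')
  have im: "p' ` K = p ` K" if "K \<subseteq> ?J" for K using that by (intro image_cong) (auto simp: p')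
  have 1: "if ?J \<inter> S' \<noteq> {} then e \<in> S' \<and> p' e = Max (p' ` (?J \<inter> S')) else e \<in> T' \<and> p' e = Min (p' ` ?J)"
    unfolding J im[of "?J \<inter> S", OF Int_lower1] im[of ?J, OF order_refl] by (simp add: S' T' p')
  \<comment> \<open>Either rule takes an extremum over the parts of a nonempty set of earlier
    elements, so the value is attained.\<close>
  let ?K = "if ?J \<inter> S \<noteq> {} then ?J \<inter> S else ?J"
  have fin: "finite ?J" by (rule finite_subset[OF _ V(1)]) blast
  then have finK: "finite (p ` ?K)" by simp
  have "b \<in> ?J" using V by simp
  then have neK: "p ` ?K \<noteq> {}" by auto
  have "p' e = (if ?J \<inter> S \<noteq> {} then Max (p ` ?K) else Min (p ` ?K))" by (simp add: p')
  then have "p' e \<in> p ` ?K" using Max_in[OF finK neK] Min_in[OF finK neK] by presburger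
  then obtain c where c: "c \<in> ?J" "p' e = p c" by (auto split: if_splits)
  then have cm: "c \<in> {c \<in> supp V. c < e \<and> p' c = p' e}" (is "_ \<in> ?m") by (auto simp: p')
  have "finite ?m" by (rule finite_subset[OF _ V(1)]) blast
  then have "Min ?m \<in> ?m" using Min_in cm by blast
  then have a': "Min ?m \<in> supp V" "Min ?m < e" by blast+
  then have a: "V (Min ?m) \<noteq> 0" "Min ?m \<noteq> e" by (simp_all only: supp_iff less_imp_neq not_False_eq_True)
  have fe: "flip_sign A e = 1" using e(2) by (simp add: flip_sign_def)
  have We: "W e = 1" using W V(4) by simp
  have Wa: "W (Min ?m) = flip_sign A (Min ?m) * V (Min ?m)" using W fe by simp
  have Wa1: "W (Min ?m) = 1 \<or> W (Min ?m) = -1"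
    using V(5)[of "Min ?m"] a(1) flip_sign_cases[of A "Min ?m"] Wa by auto
  have fa: "flip_sign A' (Min ?m) = flip_sign A (Min ?m)" using a(2) by (simp add: A' flip_sign_def)
  \<comment> \<open>As \<open>Min ?m\<close> differs from \<open>e\<close>, reorienting
    \<open>e\<close> changes exactly one of the two sign factors.\<close>
  have "flip_sign A' e * flip_sign A' (Min ?m) * V (Min ?m) = -1"
  proof (cases "W (Min ?m) = -1")
    case True
    then have "A' = A" using A' We by simp
    then show ?thesis using fe Wa True by simp
  next
    case False
    then have w: "W (Min ?m) = 1" using Wa1 by simp
    then have "A' = insert e A" using A' We by simp
    then have "flip_sign A' e = -1" by (simp add: flip_sign_def)
    then show ?thesis using fa Wa w by (simp add: mult.assoc)
  qed
  then show ?thesis unfolding attached_def using 1 by blast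
qed

lemma step_frame:
  assumes "f \<noteq> e"
  shows "f \<in> internal (step M B P Q e s) \<longleftrightarrow> f \<in> internal s" "f \<in> external (step M B P Q e s) \<longleftrightarrow> f \<in> external s"
    "f \<in> flipped (step M B P Q e s) \<longleftrightarrow> f \<in> flipped s" "part (step M B P Q e s) f = part s f"
  using assms
  by (simp_all add: step_def Let_def adjust_def flip_if_def set_internal_def set_external_def)

lemma part_adjust_sel:
  "internal (adjust Y e s) = internal s" "external (adjust Y e s) = external s" "part (adjust Y e s) = part s"
  "flipped (adjust Y e s) = (if Y e \<noteq> - Y (Min {c \<in> supp Y. c < e \<and> part s c = part s e})
    then insert e (flipped s) else flipped s)"
  by (simp_all add: adjust_def flip_if_def Let_def)

section \<open>The invariant of the scan\<close>

locale pass = ordered_om M for M :: "'a::linorder omatroid" +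
  fixes B P Q :: "'a set"
  assumes basis: "is_basis M B"
begin

definition processed :: "'a \<Rightarrow> 'a state \<Rightarrow> bool" where
  "processed e s \<longleftrightarrow> (e \<in> internal s \<longleftrightarrow> e \<notin> external s) \<and>
    (if e \<in> B then
       if e \<in> Int_act M B then e \<in> internal s \<and> part s e = e \<and> (e \<in> flipped s \<longleftrightarrow> e \<in> P)
       else attached (fund_cocircuit M B e) (part s) (flipped s) (external s) (internal s) e
     else
       if e \<in> Ext_act M B then e \<in> external s \<and> part s e = e \<and> (e \<in> flipped s \<longleftrightarrow> e \<in> Q)
       else attached (fc B e) (part s) (flipped s) (internal s) (external s) e)"

lemma inside_props:
  assumes "e \<in> B"
  shows "finite (supp (fund_cocircuit M B e))" "fund_cocircuit M B e e = 1"
    "fund_cocircuit M B e f = 0 \<or> fund_cocircuit M B e f = 1 \<or> fund_cocircuit M B e f = -1"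
    "e \<notin> Int_act M B \<Longrightarrow> \<exists>b. fund_cocircuit M B e b \<noteq> 0 \<and> b < e"
  using fund_cocircuit_cocircuit[OF basis assms] finite_supp_cocircuit fund_cocircuit_self[OF basis assms]
    cocircuit_values Int_act_iff[OF basis assms] by (auto simp: not_le)

lemma outside_props:
  assumes "e \<in> E - B"
  shows "finite (supp (fc B e))" "fc B e e = 1" "fc B e f = 0 \<or> fc B e f = 1 \<or> fc B e f = -1"
    "e \<notin> Ext_act M B \<Longrightarrow> \<exists>b. fc B e b \<noteq> 0 \<and> b < e"
  using fund_circuit_circuit[OF basis assms] finite_supp_circuit fund_circuit_self[OF basis assms]
    circuit_values Ext_act_iff[OF basis assms] by (auto simp: not_le)

lemma processed_step:
  assumes e: "e \<in> E" "e \<notin> internal s" "e \<notin> external s" "e \<notin> flipped s"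
  shows "processed e (step M B P Q e s)"
proof -
  let ?N = "reorient (flipped s) M"
  consider "e \<in> B" "e \<in> Int_act M B" | "e \<notin> B" "e \<in> Ext_act M B"
    | "e \<in> B" "e \<notin> Int_act M B" | "e \<notin> B" "e \<notin> Ext_act M B" by blast
  then show ?thesis
  proof cases
    case 3
    let ?V = "fund_cocircuit M B e" and ?W = "fund_cocircuit ?N B e"
    let ?J = "{c \<in> supp ?V. c < e}"
    note V = inside_props[OF 3(1)]
    obtain b where b: "?V b \<noteq> 0" "b < e" using V(4)[OF 3(2)] by blast
    have W: "?W f = flip_sign (flipped s) e * flip_sign (flipped s) f * ?V f" for f
      by (rule fund_cocircuit_reorient[OF basis 3(1)])
    then have sW: "supp ?W = supp ?V" by auto
    have step: "step M B P Q e s = adjust ?W e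
        (if ?J \<inter> external s \<noteq> {} then set_external e (Max (part s ` (?J \<inter> external s))) s
         else set_internal e (Min (part s ` ?J)) s)"
      using 3 by (simp add: step_def Let_def sW del: supp_iff)
    have "attached ?V (part (step M B P Q e s)) (flipped (step M B P Q e s))
        (external (step M B P Q e s)) (internal (step M B P Q e s)) e"
      by (rule attachedI[OF V(1) b V(2,3) e(3,4) W, where p = "part s" and T = "internal s"])
        (simp_all add: step part_adjust_sel sW set_external_def set_internal_def del: supp_iff)
    moreover have "e \<in> internal (step M B P Q e s) \<longleftrightarrow> e \<notin> external (step M B P Q e s)"
      using e by (simp add: step part_adjust_sel set_external_def set_internal_def)
    ultimately show ?thesis using 3 by (simp add: processed_def)
  next
    case 4
    then have eE: "e \<in> E - B" using e by blast
    let ?V = "fc B e" and ?W = "fund_circuit ?N B e"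
    let ?J = "{c \<in> supp ?V. c < e}"
    note V = outside_props[OF eE]
    obtain b where b: "?V b \<noteq> 0" "b < e" using V(4)[OF 4(2)] by blast
    have W: "?W f = flip_sign (flipped s) e * flip_sign (flipped s) f * ?V f" for f
      by (rule fund_circuit_reorient[OF basis eE])
    then have sW: "supp ?W = supp ?V" by auto
    have step: "step M B P Q e s = adjust ?W e
        (if ?J \<inter> internal s \<noteq> {} then set_internal e (Max (part s ` (?J \<inter> internal s))) s
         else set_external e (Min (part s ` ?J)) s)"
      using 4 by (simp add: step_def Let_def sW del: supp_iff)
    have "attached ?V (part (step M B P Q e s)) (flipped (step M B P Q e s))
        (internal (step M B P Q e s)) (external (step M B P Q e s)) e"
      by (rule attachedI[OF V(1) b V(2,3) e(2,4) W, where p = "part s" and T = "external s"])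
        (simp_all add: step part_adjust_sel sW set_external_def set_internal_def del: supp_iff)
    moreover have "e \<in> internal (step M B P Q e s) \<longleftrightarrow> e \<notin> external (step M B P Q e s)"
      using e by (simp add: step part_adjust_sel set_external_def set_internal_def)
    ultimately show ?thesis using 4 by (simp add: processed_def)
  qed (use e in \<open>simp_all add: processed_def step_def Let_def flip_if_def set_internal_def set_external_def\<close>)
qed

text \<open>The specification at \<open>e\<close> depends on elements up to \<open>e\<close>, and a
  step at a larger \<open>g\<close> changes only what is recorded about \<open>g\<close>.\<close>

lemma processed_frame:
  assumes e: "e \<in> E" "e < g" and pr: "processed e s"
  shows "processed e (step M B P Q g s)"
proof -
  have fr: "f \<in> internal (step M B P Q g s) \<longleftrightarrow> f \<in> internal s"
    "f \<in> external (step M B P Q g s) \<longleftrightarrow> f \<in> external s"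
    "f \<in> flipped (step M B P Q g s) \<longleftrightarrow> f \<in> flipped s" "part (step M B P Q g s) f = part s f"
    if "f \<le> e" for f using step_frame[of f g M B P Q s] that e(2) by auto
  consider "e \<in> B" "e \<notin> Int_act M B" | "e \<in> E - B" "e \<notin> Ext_act M B"
    | "e \<in> Int_act M B \<and> e \<in> B \<or> e \<in> Ext_act M B \<and> e \<notin> B" using e(1) by blast
  then show ?thesis
  proof cases
    case 1
    obtain b where b: "fund_cocircuit M B e b \<noteq> 0" "b < e" using inside_props(4)[OF 1] by blast
    have "attached (fund_cocircuit M B e) (part s) (flipped s) (external s) (internal s) e"
      using pr 1 by (simp add: processed_def)
    from attached_cong[OF this inside_props(1)[OF 1(1)] b fr(4,3,2,1)] show ?thesis
      using pr 1 fr(1,2)[of e] by (simp add: processed_def)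
  next
    case 2
    obtain b where b: "fc B e b \<noteq> 0" "b < e" using outside_props(4)[OF 2] by blast
    have "attached (fc B e) (part s) (flipped s) (internal s) (external s) e"
      using pr 2 by (simp add: processed_def)
    from attached_cong[OF this outside_props(1)[OF 2(1)] b fr(4,3,1,2)] show ?thesis
      using pr 2 fr(1,2)[of e] by (simp add: processed_def)
  next
    case 3
    then show ?thesis using pr fr[of e] by (auto simp: processed_def)
  qed
qed

text \<open>The inclusions in \<open>set L\<close> say that the next element is still untouched, as
  \<open>processed_step\<close> demands.\<close>

lemma pass_invariant:
  assumes "sorted_wrt (<) L" "set L \<subseteq> E"
  defines "s \<equiv> fold (step M B P Q) L initial_state"
  shows "(\<forall>e\<in>set L. processed e s) \<and> internal s \<subseteq> set L \<and> external s \<subseteq> set L \<and> flipped s \<subseteq> set L"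
  using assms(1,2) unfolding s_def
proof (induction L rule: rev_induct)
  case Nil
  then show ?case by (simp add: initial_state_def)
next
  case (snoc g L)
  let ?s = "fold (step M B P Q) L initial_state"
  have L: "\<forall>e\<in>set L. e < g" "g \<in> E" "set L \<subseteq> E" "sorted_wrt (<) L" using snoc.prems by (auto simp: sorted_wrt_append)
  have IH: "\<forall>e\<in>set L. processed e ?s" "internal ?s \<subseteq> set L" "external ?s \<subseteq> set L" "flipped ?s \<subseteq> set L"
    using snoc.IH L by blast+
  have "g \<notin> set L" using L(1) by blast
  then have "processed g (step M B P Q g ?s)" using IH L(2) by (intro processed_step) auto
  moreover have "processed e (step M B P Q g ?s)" if "e \<in> set L" for e
    using that L IH(1) by (intro processed_frame) auto
  moreover have "internal (step M B P Q g ?s) \<subseteq> insert g (set L)" "external (step M B P Q g ?s) \<subseteq> insert g (set L)"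
    "flipped (step M B P Q g ?s) \<subseteq> insert g (set L)"
    using step_frame[of _ g M B P Q ?s] IH by blast+
  ultimately show ?case by simp
qed

section \<open>Properties of the completed scan\<close>

definition final :: "'a state" where
  "final = fold (step M B P Q) (sorted_list_of_set E) initial_state"

lemma final_processed: "e \<in> E \<Longrightarrow> processed e final"
  and final_ground: "internal final \<subseteq> E" "external final \<subseteq> E" "flipped final \<subseteq> E"
  using pass_invariant[of "sorted_list_of_set E"] finite_ground by (auto simp: final_def)

lemma external_iff: "e \<in> E \<Longrightarrow> e \<in> external final \<longleftrightarrow> e \<notin> internal final"
  using final_processed[of e] by (auto simp: processed_def)

lemma attached_inside:
  "e \<in> B \<Longrightarrow> e \<notin> Int_act M B \<Longrightarrow>
    attached (fund_cocircuit M B e) (part final) (flipped final) (external final) (internal final) e"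
  using final_processed[of e] basis_ground[OF basis] by (auto simp: processed_def)

lemma attached_outside:
  "e \<in> E - B \<Longrightarrow> e \<notin> Ext_act M B \<Longrightarrow>
    attached (fc B e) (part final) (flipped final) (internal final) (external final) e"
  using final_processed[of e] by (auto simp: processed_def)

lemma active_inside:
  "e \<in> Int_act M B \<Longrightarrow> e \<in> B \<and> e \<in> internal final \<and> part final e = e \<and> (e \<in> flipped final \<longleftrightarrow> e \<in> P)"
  using final_processed[of e] basis_ground[OF basis] by (auto simp: processed_def Int_act_def)

lemma active_outside:
  "e \<in> Ext_act M B \<Longrightarrow> e \<in> E - B \<and> e \<notin> internal final \<and> part final e = e \<and> (e \<in> flipped final \<longleftrightarrow> e \<in> Q)"
  using final_processed[of e] by (auto simp: processed_def Ext_act_def)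

lemma part_smaller:
  assumes e: "e \<in> E" "e \<notin> Int_act M B" "e \<notin> Ext_act M B"
  shows "\<exists>c\<in>E. c < e \<and> part final c = part final e \<and> (c \<in> internal final \<longleftrightarrow> e \<in> internal final)"
proof (cases "e \<in> B")
  case True
  note V = inside_props[OF True]
  obtain b where "fund_cocircuit M B e b \<noteq> 0" "b < e" using V(4)[OF e(2)] by blast
  from attached_witness[OF attached_inside[OF True e(2)] V(1) this]
  obtain c where c: "fund_cocircuit M B e c \<noteq> 0" "c < e" "part final c = part final e"
    "c \<in> external final \<and> e \<in> external final \<or> c \<notin> external final \<and> e \<in> internal final" by blast
  have "c \<in> E" using fund_cocircuit_in[OF basis True c(1)] e(1) by blast
  then show ?thesis using c(2-4) external_iff e(1) by blast
next
  case False
  then have eE: "e \<in> E - B" using e(1) by blast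
  note V = outside_props[OF eE]
  obtain b where "fc B e b \<noteq> 0" "b < e" using V(4)[OF e(3)] by blast
  from attached_witness[OF attached_outside[OF eE e(3)] V(1) this]
  obtain c where c: "fc B e c \<noteq> 0" "c < e" "part final c = part final e"
    "c \<in> internal final \<and> e \<in> internal final \<or> c \<notin> internal final \<and> e \<in> external final" by blast
  have "c \<in> E" using fund_circuit_in[OF basis eE c(1)] e(1) basis_ground[OF basis] by blast
  then show ?thesis using c(2-4) external_iff e(1) by blast
qed

text \<open>A non-active element shares its part with a smaller element on the same side; the
  descent ends at an active element, which is its own part.\<close>

lemma part_active:
  assumes "e \<in> E"
  shows "part final e \<in> Int_act M B \<union> Ext_act M B \<and> part final e \<le> e \<and>
    (part final e \<in> internal final \<longleftrightarrow> e \<in> internal final)"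
  using assms
proof (induction "card {f \<in> E. f < e}" arbitrary: e rule: less_induct)
  case less
  show ?case
  proof (cases "e \<in> Int_act M B \<union> Ext_act M B")
    case True
    then have "part final e = e" using active_inside active_outside by blast
    then show ?thesis using True by simp
  next
    case False
    then obtain c where c: "c \<in> E" "c < e" "part final c = part final e" "c \<in> internal final \<longleftrightarrow> e \<in> internal final"
      using part_smaller[OF less.prems] by blast
    have "{f \<in> E. f < c} \<subset> {f \<in> E. f < e}" using c by auto
    then have "card {f \<in> E. f < c} < card {f \<in> E. f < e}" using finite_ground by (simp add: psubset_card_mono)
    from less.hyps[OF this c(1)] show ?thesis using c by auto
  qed
qed

lemma part_fixed:
  assumes "e \<in> E"
  shows "part final e = e \<longleftrightarrow> e \<in> Int_act M B \<union> Ext_act M B"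
  using part_active[OF assms] active_inside[of e] active_outside[of e] by auto

text \<open>Whichever of \<open>b\<close> and \<open>e\<close> comes later is not active and finds
  the other in its fundamental circuit or cocircuit. Its rule, a maximum over one side or else a
  minimum, gives the inequalities, and rules (II) and (IV) lead to the same condition.\<close>

lemma part_link:
  assumes e: "e \<in> E - B" and b: "b \<in> B" and nz: "fc B e b \<noteq> 0"
  shows "(b \<in> internal final \<longrightarrow> e \<in> internal final \<and> part final b \<le> part final e) \<and>
    (e \<notin> internal final \<longrightarrow> part final e \<le> part final b)"
proof -
  have bE: "b \<in> E" using b basis_ground[OF basis] by blast
  have "b \<noteq> e" using e b by blast
  then consider "b < e" | "e < b" by fastforce
  then show ?thesis
  proof cases
    case 1
    have "e \<notin> Ext_act M B" using 1 nz Ext_act_iff[OF basis e] by (auto simp: not_le)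
    note att = attached_outside[OF e this]
    let ?J = "{c \<in> supp (fc B e). c < e}"
    have bJ: "b \<in> ?J" using 1 nz by simp
    have fin: "finite ?J" by (rule finite_subset[OF _ outside_props(1)[OF e]]) blast
    show ?thesis
    proof (cases "?J \<inter> internal final = {}")
      case True
      then have "e \<in> external final" "part final e = Min (part final ` ?J)" using att by (simp_all add: attached_def)
      moreover have "Min (part final ` ?J) \<le> part final b" using fin bJ by (intro Min_le) blast+
      moreover have "b \<notin> internal final" using True bJ by blast
      ultimately show ?thesis by simp
    next
      case False
      then have "e \<in> internal final" "part final e = Max (part final ` (?J \<inter> internal final))"
        using att by (simp_all add: attached_def)
      moreover have "part final b \<le> Max (part final ` (?J \<inter> internal final))" if "b \<in> internal final"
        using fin bJ that by (intro Max_ge) blast+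
      ultimately show ?thesis by simp
    qed
  next
    case 2
    have nz': "fund_cocircuit M B b e \<noteq> 0" using nz fund_cocircuit_outside[OF basis b e] by simp
    then have "b \<notin> Int_act M B" using 2 Int_act_iff[OF basis b] by (auto simp: not_le)
    note att = attached_inside[OF b this]
    let ?J = "{c \<in> supp (fund_cocircuit M B b). c < b}"
    have eJ: "e \<in> ?J" using 2 nz' by simp
    have fin: "finite ?J" by (rule finite_subset[OF _ inside_props(1)[OF b]]) blast
    have ext: "e \<in> external final \<longleftrightarrow> e \<notin> internal final" "b \<in> external final \<longleftrightarrow> b \<notin> internal final"
      using external_iff e bE by blast+
    show ?thesis
    proof (cases "?J \<inter> external final = {}")
      case True
      then have "part final b = Min (part final ` ?J)" using att by (simp_all add: attached_def)
      moreover have "Min (part final ` ?J) \<le> part final e" using fin eJ by (intro Min_le) blast+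
      moreover have "e \<notin> external final" using True eJ by blast
      ultimately show ?thesis using ext by simp
    next
      case False
      then have "b \<in> external final" "part final b = Max (part final ` (?J \<inter> external final))"
        using att by (simp_all add: attached_def)
      moreover have "part final e \<le> Max (part final ` (?J \<inter> external final))" if "e \<in> external final"
        using fin eJ that by (intro Max_ge) blast+
      ultimately show ?thesis using ext by simp
    qed
  qed
qed

lemma final_decomposed:
  "decomposed_basis (reorient (flipped final) M) B (part final) (internal final)"
proof -
  interpret N: ordered_om "reorient (flipped final) M"
    using om_reorient by (simp add: ordered_om_def)
  show ?thesis
  proof (unfold_locales, unfold ground_reorient)
    show "is_basis (reorient (flipped final) M) B" using basis by simp
    show "internal final \<subseteq> E" by (rule final_ground)
    have act: "Int_act M B \<union> Ext_act M B \<subseteq> E" using basis_ground[OF basis] by (auto simp: Int_act_def Ext_act_def)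
    fix e
    show "e \<in> E \<Longrightarrow> part final e \<in> E" using part_active[of e] act by blast
    show "e \<in> E \<Longrightarrow> part final e \<le> e" using part_active[of e] by blast
    show "e \<in> E \<Longrightarrow> part final (part final e) = part final e"
      using part_active[of e] part_fixed[of "part final e"] act by blast
    show "e \<in> E \<Longrightarrow> (part final e \<in> internal final) = (e \<in> internal final)" using part_active[of e] by blast
    show "e \<in> E \<Longrightarrow> part final e = e \<Longrightarrow> (e \<in> internal final) = (e \<in> B)"
      using part_fixed[of e] active_inside[of e] active_outside[of e] by blast
  next
    fix e b assume e: "e \<in> E - B" "b \<in> B" "N.fc B e b \<noteq> 0"
    then have "fc B e b \<noteq> 0" by (simp add: fund_circuit_reorient[OF basis e(1)])
    then show "(b \<in> internal final \<longrightarrow> e \<in> internal final \<and> part final b \<le> part final e) \<and>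
        (e \<notin> internal final \<longrightarrow> part final e \<le> part final b)" by (rule part_link[OF e(1,2)])
  next
    fix e assume e: "e \<in> E - B" "part final e \<noteq> e"
    have W: "N.fc B e f = flip_sign (flipped final) e * flip_sign (flipped final) f * fc B e f" for f
      by (rule fund_circuit_reorient[OF basis e(1)])
    then have s: "supp (N.fc B e) = supp (fc B e)" by auto
    have ext: "e \<notin> Ext_act M B" using e part_fixed by blast
    obtain b where b: "fc B e b \<noteq> 0" "b < e" using outside_props(4)[OF e(1) ext] by blast
    show "N.fc B e (Min {c \<in> supp (N.fc B e). part final c = part final e}) = -1"
      unfolding s W by (rule attached_sign[OF attached_outside[OF e(1) ext] outside_props(1)[OF e(1)] b])
  next
    fix b assume b: "b \<in> B" "part final b \<noteq> b"
    have W: "fund_cocircuit (reorient (flipped final) M) B b f =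
        flip_sign (flipped final) b * flip_sign (flipped final) f * fund_cocircuit M B b f" for f
      by (rule fund_cocircuit_reorient[OF basis b(1)])
    then have s: "supp (fund_cocircuit (reorient (flipped final) M) B b) = supp (fund_cocircuit M B b)" by auto
    have "b \<in> E" using b(1) basis_ground[OF basis] by blast
    then have int: "b \<notin> Int_act M B" using b part_fixed by blast
    obtain c where c: "fund_cocircuit M B b c \<noteq> 0" "c < b" using inside_props(4)[OF b(1) int] by blast
    show "fund_cocircuit (reorient (flipped final) M) B b
        (Min {c \<in> supp (fund_cocircuit (reorient (flipped final) M) B b). part final c = part final b}) = -1"
      unfolding s W by (rule attached_sign[OF attached_inside[OF b(1) int] inside_props(1)[OF b(1)] c])
  qed
qed

lemma procedure_result_final: "procedure_result M B P Q = flipped final"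
  by (simp add: procedure_result_def final_def)

text \<open>Rules (I) and (III) make \<open>P\<close> and \<open>Q\<close> the reoriented active
  elements, which are what the refined map removes from and adds to the active basis.\<close>

lemma refined_alpha_procedure:
  assumes "P \<subseteq> Int_act M B" "Q \<subseteq> Ext_act M B"
  shows "refined_alpha M (procedure_result M B P Q) = (B - P) \<union> Q"
proof -
  interpret D: decomposed_basis "reorient (flipped final) M" B "part final" "internal final"
    by (rule final_decomposed)
  have "Ostar_act (reorient (flipped final) M) = Int_act M B"
    unfolding D.Ostar_act_eq D.act_def
    using part_fixed final_ground(1) active_inside active_outside by blast
  moreover have "O_act (reorient (flipped final) M) = Ext_act M B"
    unfolding D.O_act_eq ground_reorient
    using part_fixed active_inside active_outside by blast
  moreover have "flipped final \<inter> Int_act M B = P" "flipped final \<inter> Ext_act M B = Q"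
    using assms active_inside active_outside by blast+
  ultimately show ?thesis
    unfolding procedure_result_final refined_alpha_def D.alpha_eq by simp
qed

lemma procedure_result_ground: "procedure_result M B P Q \<subseteq> E"
  using final_ground by (simp add: procedure_result_final)

end

section \<open>The preimage under the refined active bijection\<close>

context ordered_om
begin

text \<open>Inside the interval, \<open>X\<close> and \<open>B\<close> differ only in active
  elements, so the removed and the added elements can be read off from \<open>X\<close>.\<close>

lemma interval_decomposition:
  assumes B: "is_basis M B" and X: "X \<in> basis_interval M B"
    and P: "P \<subseteq> Int_act M B" and Q: "Q \<subseteq> Ext_act M B"
  shows "X = (B - P) \<union> Q \<longleftrightarrow> P = Int_act M B - X \<and> Q = Ext_act M B \<inter> X"
proof -
  have sub: "Int_act M B \<subseteq> B" "Ext_act M B \<inter> B = {}" by (auto simp: Int_act_def Ext_act_def)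
  have "B - Int_act M B \<subseteq> X" "X \<subseteq> B \<union> Ext_act M B" using X by (auto simp: basis_interval_def)
  then show ?thesis using sub P Q by (intro iffI conjI set_eqI) blast+
qed

lemma procedure_inverts:
  assumes X: "X \<subseteq> E"
  shows "refined_alpha M (procedure_result M (interval_basis M X) (P_set M X) (Q_set M X)) = X"
    and "procedure_result M (interval_basis M X) (P_set M X) (Q_set M X) \<subseteq> E"
proof -
  note B = interval_basis_props[OF X]
  interpret pass M "interval_basis M X" "P_set M X" "Q_set M X" by unfold_locales (rule B(1))
  have sub: "P_set M X \<subseteq> Int_act M (interval_basis M X)" "Q_set M X \<subseteq> Ext_act M (interval_basis M X)"
    by (auto simp: P_set_def Q_set_def)
  have "X = (interval_basis M X - P_set M X) \<union> Q_set M X"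
    using interval_decomposition[OF B sub] by (simp add: P_set_def Q_set_def)
  then show "refined_alpha M (procedure_result M (interval_basis M X) (P_set M X) (Q_set M X)) = X"
    using refined_alpha_procedure[OF sub] by simp
  show "procedure_result M (interval_basis M X) (P_set M X) (Q_set M X) \<subseteq> E"
    by (rule procedure_result_ground)
qed

text \<open>The procedure is a right inverse, so \<open>refined_alpha M\<close> is onto the finite set of subsets of
  the ground set, and therefore injective.\<close>

lemma refined_alpha_inj: "inj_on (refined_alpha M) (Pow E)"
proof (rule eq_card_imp_inj_on)
  show fin: "finite (Pow E)" using finite_ground by simp
  have "Pow E \<subseteq> refined_alpha M ` Pow E"
  proof
    fix X assume "X \<in> Pow E"
    then have X: "X \<subseteq> E" by simp
    show "X \<in> refined_alpha M ` Pow E"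
      using procedure_inverts[OF X] by (metis Pow_iff image_eqI)
  qed
  then have "card (Pow E) \<le> card (refined_alpha M ` Pow E)" using fin by (intro card_mono) auto
  then show "card (refined_alpha M ` Pow E) = card (Pow E)" using card_image_le[OF fin, of "refined_alpha M"] by simp
qed

end

theorem theorem8p5:
  fixes M :: "'a::linorder omatroid" and X P Q B :: "'a set"
  assumes "oriented_matroid M"
    and "X \<subseteq> ground M"
    and "P = P_set M X"
    and "Q = Q_set M X"
    and "B = (X - Q) \<union> P"
  shows "(\<forall>B' P' Q'. B' = B \<and> P' = P \<and> Q' = Q \<longleftrightarrow>
            is_basis M B' \<and> X \<in> basis_interval M B' \<and> X = (B' - P') \<union> Q' \<and>
            P' \<subseteq> Int_act M B' \<and> Q' \<subseteq> Ext_act M B') \<and>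
         {A. A \<subseteq> ground M \<and> refined_alpha M A = X} = {procedure_result M B P Q}"
proof -
  interpret ordered_om M using assms(1) by (simp add: ordered_om_def om_def)
  note X = assms(2)
  note B0 = interval_basis_props[OF X]
  have sub: "P \<subseteq> Int_act M (interval_basis M X)" "Q \<subseteq> Ext_act M (interval_basis M X)"
    by (auto simp: assms(3,4) P_set_def Q_set_def)
  have X_eq: "X = (interval_basis M X - P) \<union> Q"
    using interval_decomposition[OF B0 sub] by (simp add: assms(3,4) P_set_def Q_set_def)
  have "Int_act M (interval_basis M X) \<subseteq> interval_basis M X"
    "Ext_act M (interval_basis M X) \<inter> interval_basis M X = {}" by (auto simp: Int_act_def Ext_act_def)
  \<comment> \<open>\<open>P\<close> lies in the basis and \<open>Q\<close> is disjoint from it, so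
    the description of \<open>X\<close> can be solved for the basis.\<close>
  then have B: "interval_basis M X = B" using sub X_eq unfolding assms(5) by blast
  have char: "B' = B \<and> P' = P \<and> Q' = Q \<longleftrightarrow>
      is_basis M B' \<and> X \<in> basis_interval M B' \<and> X = (B' - P') \<union> Q' \<and>
      P' \<subseteq> Int_act M B' \<and> Q' \<subseteq> Ext_act M B'" (is "?L \<longleftrightarrow> ?R") for B' P' Q'
  proof
    assume ?L
    then show ?R using B0 sub X_eq unfolding B by blast
  next
    assume R: ?R
    then have "B' = interval_basis M X" using interval_unique[OF _ B0(1) X _ B0(2)] by blast
    then have B': "B' = B" by (simp only: B)
    have "P' = Int_act M B' - X \<and> Q' = Ext_act M B' \<inter> X" using R interval_decomposition by blast
    then show ?L using B' by (simp add: assms(3,4) P_set_def Q_set_def B)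
  qed
  have pre: "refined_alpha M (procedure_result M B P Q) = X" "procedure_result M B P Q \<subseteq> E"
    using procedure_inverts[OF X] by (simp_all add: B assms(3,4))
  have "A = procedure_result M B P Q" if "A \<subseteq> E" "refined_alpha M A = X" for A
    by (rule inj_onD[OF refined_alpha_inj]) (use that pre in simp_all)
  then have "{A. A \<subseteq> E \<and> refined_alpha M A = X} = {procedure_result M B P Q}"
    using pre by blast
  then show ?thesis using char by blast
qed

end
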